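(* Let $\mathsf{C}$ be a cocomplete category (locally small, admitting all small colimits), and let $D:\mathsf{J}\to\mathsf{C}$ and $D':\mathsf{K}\to\mathsf{C}$ be small diagrams. Then $D'$ is a partial colimit of $D$ for the monad $\mathsf{Diag}$ if and only if $D'$ can be written as the (pointwise) left Kan extension of $D$ along a split opfibration $\mathsf{J}\to\mathsf{K}$.
   Context: For a locally small category $\mathsf{C}$, $\mathsf{Diag}(\mathsf{C})$ is the (locally small) category whose objects are small diagrams $(\mathsf{J},D)$, i.e. a small category $\mathsf{J}$ with a functor $D:\mathsf{J}\to\mathsf{C}$, and whose morphisms $(\mathsf{J},D)\to(\mathsf{J}',D')$ are pairs $(R,\rho)$ of a functor $R:\mathsf{J}\to\mathsf{J}'$ and a natural transformation $\rho:D\Rightarrow D'\circ R$. An object $E$ of $\mathsf{Diag}(\mathsf{Diag}(\mathsf{C}))$ is a functor $E:\mathsf{I}\to\mathsf{Diag}(\mathsf{C})$, $\mathsf{I}$ small; write $E(I)=(E_0I,\,E_1I:E_0I\to\mathsf{C})$ and, for $i:I\to I'$, $E(i)=(E_0i:E_0I\to E_0I',\;E_1i:E_1I\Rightarrow E_1I'\circ E_0i)$. The diagram $\mu(E)$ in $\mathsf{C}$ has as domain the Grothendieck construction $\int E_0$ of $E_0:\mathsf{I}\to\mathsf{Cat}$ (objects $(I,X)$ with $X\in E_0I$; morphisms $(i,f):(I,X)\to(I',X')$ with $i:I\to I'$ and $f:E_0i(X)\to X'$), and is given by $\mu(E)(I,X)=E_1I(X)$, $\mu(E)(i,f)=E_1I'(f)\circ(E_1i)_X$.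 For $\mathsf{C}$ cocomplete, let $c:\mathsf{Diag}(\mathsf{C})\to\mathsf{C}$ be the functor given by a choice of colimit for each small diagram (acting on morphisms by the induced maps between colimits). $c_*E$ denotes the diagram $c\circ E:\mathsf{I}\to\mathsf{C}$. A partial evaluation from $D$ to $D'$ for the monad $\mathsf{Diag}$ is an object $E$ of $\mathsf{Diag}(\mathsf{Diag}(\mathsf{C}))$ such that $\mu(E)\cong D$ and $c_*E\cong D'$ in $\mathsf{Diag}(\mathsf{C})$. If such an $E$ exists, $D'$ is called a partial colimit of $D$ for the monad $\mathsf{Diag}$. *)

theory Defs
  imports "HOL-Library.FuncSet" "HOL-Library.Equipollence"
begin

section \<open>Size\<close>

text \<open>
  The type \<open>'u\<close> plays the role of the Grothendieck universe: its elements serve as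
  names for the members of small sets, and a set (over any type) is small when its
  cardinality is strictly below that of \<open>'u\<close>.  The predicate \<open>universe\<close> says that
  \<open>card 'u\<close> is a regular strong limit cardinal.  Uncountability is not imposed, so
  that the axioms are satisfiable within HOL (by \<open>nat\<close>, see below).
\<close>

definition small :: "'u itself \<Rightarrow> 'x set \<Rightarrow> bool" where
  "small _ A \<longleftrightarrow> A \<prec> (UNIV :: 'u set)"

definition universe :: "'u itself \<Rightarrow> bool" where
  "universe U \<longleftrightarrow>
     infinite (UNIV :: 'u set) \<and>
     (\<forall>A :: 'u set. small U A \<longrightarrow> small U (Pow A)) \<and>
     (\<forall>(A :: 'u set) (B :: 'u \<Rightarrow> 'u set).
        small U A \<longrightarrow> (\<forall>a\<in>A. small U (B a)) \<longrightarrow> small U (\<Union>a\<in>A. B a))"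

lemma small_nat_iff: "small TYPE(nat) A \<longleftrightarrow> finite A"
  unfolding small_def
  by (metis finite_lesspoll_infinite infinite_UNIV_nat infinite_le_lepoll lesspoll_def
      lepoll_antisym)

lemma universe_nat: "universe TYPE(nat)"
  by (simp add: universe_def small_nat_iff)


section \<open>Categories, functors, natural transformations\<close>

record ('o, 'm) cat =
  Obj :: "'o set"
  Arr :: "'m set"
  Dom :: "'m \<Rightarrow> 'o"
  Cod :: "'m \<Rightarrow> 'o"
  Id :: "'o \<Rightarrow> 'm"
  Comp :: "'m \<Rightarrow> 'm \<Rightarrow> 'm" (infixr "\<odot>\<index>" 70)

definition hom :: "('o, 'm) cat \<Rightarrow> 'o \<Rightarrow> 'o \<Rightarrow> 'm set" where
  "hom C X Y = {f \<in> Arr C. Dom C f = X \<and> Cod C f = Y}"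

locale category =
  fixes C :: "('o, 'm) cat" (structure)
  assumes Dom_closed: "f \<in> Arr C \<Longrightarrow> Dom C f \<in> Obj C"
    and Cod_closed: "f \<in> Arr C \<Longrightarrow> Cod C f \<in> Obj C"
    and Id_hom: "X \<in> Obj C \<Longrightarrow> Id C X \<in> hom C X X"
    and Comp_hom: "f \<in> hom C X Y \<Longrightarrow> g \<in> hom C Y Z \<Longrightarrow> g \<odot> f \<in> hom C X Z"
    and Id_right: "f \<in> hom C X Y \<Longrightarrow> f \<odot> Id C X = f"
    and Id_left: "f \<in> hom C X Y \<Longrightarrow> Id C Y \<odot> f = f"
    and assoc: "f \<in> hom C W X \<Longrightarrow> g \<in> hom C X Y \<Longrightarrow> h \<in> hom C Y Z \<Longrightarrow>
      (h \<odot> g) \<odot> f = h \<odot> (g \<odot> f)"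

record ('o, 'm, 'p, 'n) func =
  fobj :: "'o \<Rightarrow> 'p"
  farr :: "'m \<Rightarrow> 'n"

text \<open>
  Functors and natural transformations are extensional functions on the relevant
  carriers, so that HOL equality of them is the intended equality.
\<close>

locale Functor = A: category A + B: category B
  for A :: "('o, 'm) cat" and B :: "('p, 'n) cat" +
  fixes F :: "('o, 'm, 'p, 'n) func"
  assumes fobj_ext: "fobj F \<in> extensional (Obj A)"
    and farr_ext: "farr F \<in> extensional (Arr A)"
    and fobj_closed: "X \<in> Obj A \<Longrightarrow> fobj F X \<in> Obj B"
    and farr_hom: "f \<in> hom A X Y \<Longrightarrow> farr F f \<in> hom B (fobj F X) (fobj F Y)"
    and farr_Id: "X \<in> Obj A \<Longrightarrow> farr F (Id A X) = Id B (fobj F X)"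
    and farr_Comp: "f \<in> hom A X Y \<Longrightarrow> g \<in> hom A Y Z \<Longrightarrow>
      farr F (g \<odot>\<^bsub>A\<^esub> f) = farr F g \<odot>\<^bsub>B\<^esub> farr F f"

definition func_id :: "('o, 'm) cat \<Rightarrow> ('o, 'm, 'o, 'm) func" where
  "func_id A = \<lparr>fobj = (\<lambda>X\<in>Obj A. X), farr = (\<lambda>f\<in>Arr A. f)\<rparr>"

definition func_comp ::
  "('o, 'm) cat \<Rightarrow> ('p, 'n, 'q, 'k) func \<Rightarrow> ('o, 'm, 'p, 'n) func \<Rightarrow> ('o, 'm, 'q, 'k) func" where
  "func_comp A G F =
     \<lparr>fobj = compose (Obj A) (fobj G) (fobj F), farr = compose (Arr A) (farr G) (farr F)\<rparr>"

locale nat_trans = F: Functor A B F + G: Functor A B G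
  for A :: "('o, 'm) cat" and B :: "('p, 'n) cat" and F G +
  fixes \<alpha> :: "'o \<Rightarrow> 'n"
  assumes component_ext: "\<alpha> \<in> extensional (Obj A)"
    and component_hom: "X \<in> Obj A \<Longrightarrow> \<alpha> X \<in> hom B (fobj F X) (fobj G X)"
    and naturality: "f \<in> hom A X Y \<Longrightarrow> \<alpha> Y \<odot>\<^bsub>B\<^esub> farr F f = farr G f \<odot>\<^bsub>B\<^esub> \<alpha> X"

definition locally_small :: "'u itself \<Rightarrow> ('o, 'm) cat \<Rightarrow> bool" where
  "locally_small U C \<longleftrightarrow> (\<forall>X\<in>Obj C. \<forall>Y\<in>Obj C. small U (hom C X Y))"

definition small_category :: "'u itself \<Rightarrow> ('o, 'm) cat \<Rightarrow> bool" where
  "small_category U J \<longleftrightarrow> category J \<and> small U (Obj J) \<and> small U (Arr J)"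


section \<open>The category of diagrams\<close>

type_synonym ('i, 'j, 'o, 'm) diagram = "('i, 'j) cat \<times> ('i, 'j, 'o, 'm) func"

type_synonym ('i, 'j, 'i2, 'j2, 'm) diagram_mor = "('i, 'j, 'i2, 'j2) func \<times> ('i \<Rightarrow> 'm)"

definition diag_hom ::
  "('o, 'm) cat \<Rightarrow> ('i, 'j, 'o, 'm) diagram \<Rightarrow> ('i2, 'j2, 'o, 'm) diagram \<Rightarrow>
   ('i, 'j, 'i2, 'j2, 'm) diagram_mor set" where
  "diag_hom C = (\<lambda>(J, D) (J', D').
     {(R, \<rho>). Functor J J' R \<and> nat_trans J C D (func_comp J D' R) \<rho>})"

definition diag_id ::
  "('o, 'm) cat \<Rightarrow> ('i, 'j, 'o, 'm) diagram \<Rightarrow> ('i, 'j, 'i, 'j, 'm) diagram_mor" where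
  "diag_id C = (\<lambda>(J, D). (func_id J, \<lambda>j\<in>Obj J. Id C (fobj D j)))"

text \<open>\<open>diag_comp C J (S, \<sigma>) (R, \<rho>)\<close> is \<open>(S, \<sigma>) \<circ> (R, \<rho>)\<close>, where \<open>J\<close> is the domain of \<open>R\<close>.\<close>

definition diag_comp ::
  "('o, 'm) cat \<Rightarrow> ('i, 'j) cat \<Rightarrow> ('i2, 'j2, 'i3, 'j3, 'm) diagram_mor \<Rightarrow>
   ('i, 'j, 'i2, 'j2, 'm) diagram_mor \<Rightarrow> ('i, 'j, 'i3, 'j3, 'm) diagram_mor" where
  "diag_comp C J = (\<lambda>(S, \<sigma>) (R, \<rho>).
     (func_comp J S R, \<lambda>j\<in>Obj J. \<sigma> (fobj R j) \<odot>\<^bsub>C\<^esub> \<rho> j))"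

text \<open>
  Isomorphism in \<open>Diag(C)\<close>.  It is stated for diagrams over possibly different index
  types because the Grothendieck construction of categories over \<open>'u\<close> lives over
  \<open>'u \<times> 'u\<close> rather than over \<open>'u\<close>.
\<close>

definition diag_iso ::
  "('o, 'm) cat \<Rightarrow> ('i, 'j, 'o, 'm) diagram \<Rightarrow> ('i2, 'j2, 'o, 'm) diagram \<Rightarrow> bool" where
  "diag_iso C \<D> \<D>' \<longleftrightarrow>
     (\<exists>\<Phi> \<in> diag_hom C \<D> \<D>'. \<exists>\<Psi> \<in> diag_hom C \<D>' \<D>.
        diag_comp C (fst \<D>) \<Psi> \<Phi> = diag_id C \<D> \<and>
        diag_comp C (fst \<D>') \<Phi> \<Psi> = diag_id C \<D>')"

text \<open>
  The category \<open>Diag(C)\<close> itself, with small index categories carried by subsets of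
  \<open>'u\<close> (up to isomorphism, every small category is of this form).  An arrow carries its
  source and target: it is a triple \<open>(\<D>, (R, \<rho>), \<D>')\<close>.
\<close>

type_synonym ('u, 'o, 'm) sdiagram = "('u, 'u, 'o, 'm) diagram"

type_synonym ('u, 'o, 'm) sdiagram_arr =
  "('u, 'o, 'm) sdiagram \<times> ('u, 'u, 'u, 'u, 'm) diagram_mor \<times> ('u, 'o, 'm) sdiagram"

definition small_diagrams :: "('o, 'm) cat \<Rightarrow> ('u, 'o, 'm) sdiagram set" where
  "small_diagrams C = {(J, D). small_category TYPE('u) J \<and> Functor J C D}"

definition Diag :: "('o, 'm) cat \<Rightarrow> (('u, 'o, 'm) sdiagram, ('u, 'o, 'm) sdiagram_arr) cat" where
  "Diag C =
     \<lparr>Obj = small_diagrams C,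
      Arr = {(\<D>, \<Phi>, \<D>'). \<D> \<in> small_diagrams C \<and> \<D>' \<in> small_diagrams C \<and> \<Phi> \<in> diag_hom C \<D> \<D>'},
      Dom = (\<lambda>(\<D>, \<Phi>, \<D>'). \<D>),
      Cod = (\<lambda>(\<D>, \<Phi>, \<D>'). \<D>'),
      Id = (\<lambda>\<D>. (\<D>, diag_id C \<D>, \<D>)),
      Comp = (\<lambda>(_, \<Psi>, \<D>'') (\<D>, \<Phi>, _). (\<D>, diag_comp C (fst \<D>) \<Psi> \<Phi>, \<D>''))\<rparr>"


section \<open>The Grothendieck construction and the multiplication\<close>

text \<open>
  \<open>P\<close> and \<open>T\<close> are the actions on objects and on arrows of a functor from \<open>I\<close> to \<open>Cat\<close>.
  The arrow \<open>(i, f) : (I, X) \<rightarrow> (I', X')\<close> is again stored with its source and target.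
\<close>

definition grothendieck ::
  "('i, 'k) cat \<Rightarrow> ('i \<Rightarrow> ('x, 'y) cat) \<Rightarrow> ('k \<Rightarrow> ('x, 'y, 'x, 'y) func) \<Rightarrow>
   ('i \<times> 'x, ('i \<times> 'x) \<times> ('k \<times> 'y) \<times> ('i \<times> 'x)) cat" where
  "grothendieck \<I> P T =
     \<lparr>Obj = {(I, X). I \<in> Obj \<I> \<and> X \<in> Obj (P I)},
      Arr = {((I, X), (i, f), (I', X')).
               I \<in> Obj \<I> \<and> X \<in> Obj (P I) \<and> I' \<in> Obj \<I> \<and> X' \<in> Obj (P I') \<and>
               i \<in> hom \<I> I I' \<and> f \<in> hom (P I') (fobj (T i) X) X'},
      Dom = (\<lambda>(a, _, b). a),
      Cod = (\<lambda>(a, _, b). b),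
      Id = (\<lambda>(I, X). ((I, X), (Id \<I> I, Id (P I) X), (I, X))),
      Comp = (\<lambda>(_, (i', f'), (I'', X'')) (a, (i, f), _).
                (a, (i' \<odot>\<^bsub>\<I>\<^esub> i, f' \<odot>\<^bsub>P I''\<^esub> farr (T i') f), (I'', X'')))\<rparr>"

text \<open>
  The components \<open>E\<^sub>0 I\<close>, \<open>E\<^sub>1 I\<close>, \<open>E\<^sub>0 i\<close>, \<open>E\<^sub>1 i\<close> of a functor \<open>E\<close> from \<open>I\<close> to \<open>Diag(C)\<close>.
\<close>

type_synonym ('u, 'o, 'm) diag_func =
  "('u, 'u, ('u, 'o, 'm) sdiagram, ('u, 'o, 'm) sdiagram_arr) func"

definition E0_obj :: "('u, 'o, 'm) diag_func \<Rightarrow> 'u \<Rightarrow> ('u, 'u) cat" where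
  "E0_obj E I = fst (fobj E I)"

definition E1_obj :: "('u, 'o, 'm) diag_func \<Rightarrow> 'u \<Rightarrow> ('u, 'u, 'o, 'm) func" where
  "E1_obj E I = snd (fobj E I)"

definition E0_arr :: "('u, 'o, 'm) diag_func \<Rightarrow> 'u \<Rightarrow> ('u, 'u, 'u, 'u) func" where
  "E0_arr E i = (case farr E i of (_, (R, \<rho>), _) \<Rightarrow> R)"

definition E1_arr :: "('u, 'o, 'm) diag_func \<Rightarrow> 'u \<Rightarrow> 'u \<Rightarrow> 'm" where
  "E1_arr E i = (case farr E i of (_, (R, \<rho>), _) \<Rightarrow> \<rho>)"

definition mu ::
  "('o, 'm) cat \<Rightarrow> ('u, ('u, 'o, 'm) sdiagram, ('u, 'o, 'm) sdiagram_arr) sdiagram \<Rightarrow>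
   ('u \<times> 'u, ('u \<times> 'u) \<times> ('u \<times> 'u) \<times> ('u \<times> 'u), 'o, 'm) diagram" where
  "mu C = (\<lambda>(\<I>, E).
     let G = grothendieck \<I> (E0_obj E) (E0_arr E) in
     (G, \<lparr>fobj = (\<lambda>(I, X) \<in> Obj G. fobj (E1_obj E I) X),
          farr = (\<lambda>((I, X), (i, f), (I', X')) \<in> Arr G.
                    farr (E1_obj E I') f \<odot>\<^bsub>C\<^esub> E1_arr E i X)\<rparr>))"


section \<open>Colimits and partial colimits\<close>

definition is_cocone ::
  "('o, 'm) cat \<Rightarrow> ('i, 'j, 'o, 'm) diagram \<Rightarrow> 'o \<Rightarrow> ('i \<Rightarrow> 'm) \<Rightarrow> bool" where
  "is_cocone C = (\<lambda>(J, D) a \<iota>.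
     Functor J C D \<and> a \<in> Obj C \<and>
     (\<forall>j\<in>Obj J. \<iota> j \<in> hom C (fobj D j) a) \<and>
     (\<forall>f\<in>Arr J. \<iota> (Cod J f) \<odot>\<^bsub>C\<^esub> farr D f = \<iota> (Dom J f)))"

definition is_colimit ::
  "('o, 'm) cat \<Rightarrow> ('i, 'j, 'o, 'm) diagram \<Rightarrow> 'o \<Rightarrow> ('i \<Rightarrow> 'm) \<Rightarrow> bool" where
  "is_colimit C \<D> a \<iota> \<longleftrightarrow>
     is_cocone C \<D> a \<iota> \<and>
     (\<forall>b \<kappa>. is_cocone C \<D> b \<kappa> \<longrightarrow>
        (\<exists>!u. u \<in> hom C a b \<and> (\<forall>j\<in>Obj (fst \<D>). u \<odot>\<^bsub>C\<^esub> \<iota> j = \<kappa> j)))"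

definition cocomplete :: "'u itself \<Rightarrow> ('o, 'm) cat \<Rightarrow> bool" where
  "cocomplete _ C \<longleftrightarrow>
     (\<forall>\<D> \<in> (small_diagrams C :: ('u, 'o, 'm) sdiagram set). \<exists>a \<iota>. is_colimit C \<D> a \<iota>)"

text \<open>A choice, for every small diagram, of a colimit object and a colimiting cocone.\<close>

type_synonym ('u, 'o, 'm) choice = "('u, 'o, 'm) sdiagram \<Rightarrow> 'o \<times> ('u \<Rightarrow> 'm)"

definition colimit_choice :: "('o, 'm) cat \<Rightarrow> ('u, 'o, 'm) choice \<Rightarrow> bool" where
  "colimit_choice C c \<longleftrightarrow> (\<forall>\<D> \<in> small_diagrams C. is_colimit C \<D> (fst (c \<D>)) (snd (c \<D>)))"

definition colim_functor ::
  "('o, 'm) cat \<Rightarrow> ('u, 'o, 'm) choice \<Rightarrow>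
   (('u, 'o, 'm) sdiagram, ('u, 'o, 'm) sdiagram_arr, 'o, 'm) func" where
  "colim_functor C c =
     \<lparr>fobj = (\<lambda>\<D> \<in> Obj (Diag C). fst (c \<D>)),
      farr = (\<lambda>(\<D>, (R, \<rho>), \<D>') \<in> Arr (Diag C).
                THE u. u \<in> hom C (fst (c \<D>)) (fst (c \<D>')) \<and>
                  (\<forall>j\<in>Obj (fst \<D>).
                     u \<odot>\<^bsub>C\<^esub> snd (c \<D>) j = snd (c \<D>') (fobj R j) \<odot>\<^bsub>C\<^esub> \<rho> j))\<rparr>"

definition colim_push ::
  "('o, 'm) cat \<Rightarrow> ('u, 'o, 'm) choice \<Rightarrow>
   ('u, ('u, 'o, 'm) sdiagram, ('u, 'o, 'm) sdiagram_arr) sdiagram \<Rightarrow> ('u, 'o, 'm) sdiagram" where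
  "colim_push C c = (\<lambda>(\<I>, E). (\<I>, func_comp \<I> (colim_functor C c) E))"

definition partial_evaluation ::
  "('o, 'm) cat \<Rightarrow> ('u, 'o, 'm) choice \<Rightarrow>
   ('u, ('u, 'o, 'm) sdiagram, ('u, 'o, 'm) sdiagram_arr) sdiagram \<Rightarrow>
   ('u, 'o, 'm) sdiagram \<Rightarrow> ('u, 'o, 'm) sdiagram \<Rightarrow> bool" where
  "partial_evaluation C c \<E> \<D> \<D>' \<longleftrightarrow>
     \<E> \<in> Obj (Diag (Diag C)) \<and> diag_iso C (mu C \<E>) \<D> \<and> diag_iso C (colim_push C c \<E>) \<D>'"

text \<open>\<open>partial_colimit C c \<D> \<D>'\<close>: \<open>\<D>'\<close> is a partial colimit of \<open>\<D>\<close>.\<close>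

definition partial_colimit ::
  "('o, 'm) cat \<Rightarrow> ('u, 'o, 'm) choice \<Rightarrow>
   ('u, 'o, 'm) sdiagram \<Rightarrow> ('u, 'o, 'm) sdiagram \<Rightarrow> bool" where
  "partial_colimit C c \<D> \<D>' \<longleftrightarrow> (\<exists>\<E>. partial_evaluation C c \<E> \<D> \<D>')"


section \<open>Split opfibrations\<close>

definition opcartesian ::
  "('i, 'j) cat \<Rightarrow> ('k, 'l) cat \<Rightarrow> ('i, 'j, 'k, 'l) func \<Rightarrow> 'j \<Rightarrow> bool" where
  "opcartesian J K F f \<longleftrightarrow> f \<in> Arr J \<and>
     (\<forall>Z. \<forall>g \<in> hom J (Dom J f) Z. \<forall>h \<in> hom K (fobj F (Cod J f)) (fobj F Z).
        h \<odot>\<^bsub>K\<^esub> farr F f = farr F g \<longrightarrow>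
        (\<exists>!h'. h' \<in> hom J (Cod J f) Z \<and> farr F h' = h \<and> h' \<odot>\<^bsub>J\<^esub> f = g))"

text \<open>
  \<open>\<chi> X k\<close> is the chosen opcartesian lift, starting at \<open>X\<close>, of an arrow \<open>k\<close> out of \<open>F X\<close>;
  the lifts are required to be strictly functorial in \<open>k\<close>.
\<close>

definition is_splitting ::
  "('i, 'j) cat \<Rightarrow> ('k, 'l) cat \<Rightarrow> ('i, 'j, 'k, 'l) func \<Rightarrow> ('i \<Rightarrow> 'l \<Rightarrow> 'j) \<Rightarrow> bool" where
  "is_splitting J K F \<chi> \<longleftrightarrow>
     (\<forall>X\<in>Obj J. \<forall>Y. \<forall>k\<in>hom K (fobj F X) Y.
        \<chi> X k \<in> Arr J \<and> Dom J (\<chi> X k) = X \<and> farr F (\<chi> X k) = k \<and> opcartesian J K F (\<chi> X k)) \<and>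
     (\<forall>X\<in>Obj J. \<chi> X (Id K (fobj F X)) = Id J X) \<and>
     (\<forall>X\<in>Obj J. \<forall>Y Z. \<forall>k\<in>hom K (fobj F X) Y. \<forall>l\<in>hom K Y Z.
        \<chi> X (l \<odot>\<^bsub>K\<^esub> k) = \<chi> (Cod J (\<chi> X k)) l \<odot>\<^bsub>J\<^esub> \<chi> X k)"

definition split_opfibration ::
  "('i, 'j) cat \<Rightarrow> ('k, 'l) cat \<Rightarrow> ('i, 'j, 'k, 'l) func \<Rightarrow> bool" where
  "split_opfibration J K F \<longleftrightarrow> Functor J K F \<and> (\<exists>\<chi>. is_splitting J K F \<chi>)"


section \<open>Pointwise left Kan extensions\<close>

definition is_left_kan ::
  "('i, 'j) cat \<Rightarrow> ('k, 'l) cat \<Rightarrow> ('o, 'm) cat \<Rightarrow> ('i, 'j, 'k, 'l) func \<Rightarrow>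
   ('i, 'j, 'o, 'm) func \<Rightarrow> ('k, 'l, 'o, 'm) func \<Rightarrow> ('i \<Rightarrow> 'm) \<Rightarrow> bool" where
  "is_left_kan J K C F D L \<eta> \<longleftrightarrow>
     Functor J K F \<and> Functor K C L \<and> nat_trans J C D (func_comp J L F) \<eta> \<and>
     (\<forall>G \<gamma>. Functor K C G \<longrightarrow> nat_trans J C D (func_comp J G F) \<gamma> \<longrightarrow>
        (\<exists>!\<alpha>. nat_trans K C L G \<alpha> \<and> (\<forall>j\<in>Obj J. \<alpha> (fobj F j) \<odot>\<^bsub>C\<^esub> \<eta> j = \<gamma> j)))"

text \<open>The comma category \<open>F \<down> k\<close>, with arrows stored together with their source and target.\<close>

definition comma ::
  "('i, 'j) cat \<Rightarrow> ('k, 'l) cat \<Rightarrow> ('i, 'j, 'k, 'l) func \<Rightarrow> 'k \<Rightarrow>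
   ('i \<times> 'l, ('i \<times> 'l) \<times> 'j \<times> ('i \<times> 'l)) cat" where
  "comma J K F k =
     \<lparr>Obj = {(j, h). j \<in> Obj J \<and> h \<in> hom K (fobj F j) k},
      Arr = {((j, h), f, (j', h')).
               j \<in> Obj J \<and> h \<in> hom K (fobj F j) k \<and> j' \<in> Obj J \<and> h' \<in> hom K (fobj F j') k \<and>
               f \<in> hom J j j' \<and> h' \<odot>\<^bsub>K\<^esub> farr F f = h},
      Dom = (\<lambda>(a, f, b). a),
      Cod = (\<lambda>(a, f, b). b),
      Id = (\<lambda>(j, h). ((j, h), Id J j, (j, h))),
      Comp = (\<lambda>(_, g, b) (a, f, _). (a, g \<odot>\<^bsub>J\<^esub> f, b))\<rparr>"

definition comma_diagram ::
  "('i, 'j) cat \<Rightarrow> ('k, 'l) cat \<Rightarrow> ('i, 'j, 'k, 'l) func \<Rightarrow> ('i, 'j, 'o, 'm) func \<Rightarrow> 'k \<Rightarrow>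
   ('i \<times> 'l, ('i \<times> 'l) \<times> 'j \<times> ('i \<times> 'l), 'o, 'm) diagram" where
  "comma_diagram J K F D k =
     (comma J K F k,
      \<lparr>fobj = (\<lambda>(j, h) \<in> Obj (comma J K F k). fobj D j),
       farr = (\<lambda>(a, f, b) \<in> Arr (comma J K F k). farr D f)\<rparr>)"

text \<open>
  A left Kan extension \<open>(L, \<eta>)\<close> is pointwise when each \<open>L k\<close>, with the cocone of
  composites of \<open>\<eta> j : D j \<rightarrow> L (F j)\<close> and \<open>L h : L (F j) \<rightarrow> L k\<close>, is the colimit of \<open>D\<close>
  over \<open>F \<down> k\<close>.
\<close>

definition is_pointwise_left_kan ::
  "('i, 'j) cat \<Rightarrow> ('k, 'l) cat \<Rightarrow> ('o, 'm) cat \<Rightarrow> ('i, 'j, 'k, 'l) func \<Rightarrow>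
   ('i, 'j, 'o, 'm) func \<Rightarrow> ('k, 'l, 'o, 'm) func \<Rightarrow> ('i \<Rightarrow> 'm) \<Rightarrow> bool" where
  "is_pointwise_left_kan J K C F D L \<eta> \<longleftrightarrow>
     is_left_kan J K C F D L \<eta> \<and>
     (\<forall>k\<in>Obj K. is_colimit C (comma_diagram J K F D k) (fobj L k)
        (\<lambda>(j, h). farr L h \<odot>\<^bsub>C\<^esub> \<eta> j))"

end

(*
  For a split opfibration F : J \<rightarrow> K the fibre over k is final in the comma category F \<down> k,
  so the pointwise left Kan extension of D along F is computed by the colimits of D over
  the fibres of F.  A functor E : I \<rightarrow> Diag(C) and its projection from the Grothendieck
  construction to I are of this kind: the fibre of the projection over i is E_0 i, hence the
  left Kan extension of mu(E) along it is c_* E.  Conversely a split opfibration J \<rightarrow> K is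
  isomorphic to the Grothendieck construction of its fibres, on which K acts strictly
  functorially by transport along the chosen lifts.  Split opfibrations whose fibrewise
  colimits form a given diagram are invariant under isomorphism in Diag(C).
*)

theory Submission
  imports Defs
begin

text \<open>Both directions pass through \<open>fibrewise_colimit\<close>, which mentions neither
  comma categories nor competing functors on the base. The tool for leaving a fibre is always the
  same: a chosen lift turns an arrow of the base into an arrow of the total category, along which
  naturality of the unit moves an equation from one fibre to the next. The splitting, as opposed to
  a mere choice of opcartesian lifts, is forced by strictness. An object of Diag(Diag(C)) is an
  honest functor, and transport between fibres preserves identities and composites on the nose
  because the chosen lifts do. The diagram \<open>mu C (\<I>, E)\<close> lives on pairs and is only
  isomorphic to \<open>D\<close>. The opfibration therefore cannot be the projection itself; it is
  the index functor of the composite from \<open>D\<close> through \<open>mu C (\<I>, E)\<close> and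
  \<open>colim_push C c (\<I>, E)\<close> to \<open>D'\<close>. Isomorphism in Diag(C) involves
  isomorphisms, not equivalences, of index categories, so the lifts can be carried along without
  losing their strict laws.\<close>

lemma ex1_conj_cong:
  assumes "\<exists>!u. P u \<and> A u" "\<And>u. P u \<Longrightarrow> A u \<longleftrightarrow> B u"
  shows "\<exists>!u. P u \<and> B u"
proof -
  from assms(1) obtain u where u: "P u \<and> A u" "\<forall>v. P v \<and> A v \<longrightarrow> v = u"
    by (rule ex1E)
  show ?thesis
  proof (rule ex1I)
    show "P u \<and> B u" using u(1) assms(2) by blast
    show "v = u" if "P v \<and> B v" for v using u(2) that assms(2) by blast
  qed
qed

lemma ex1_conjE:
  assumes "\<exists>!u. P u \<and> Q u"
  obtains u where "P u" "Q u" "\<And>w. P w \<Longrightarrow> Q w \<Longrightarrow> w = u"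
proof -
  from assms obtain u where *: "P u \<and> Q u" "\<forall>w. P w \<and> Q w \<longrightarrow> w = u" by (rule ex1E)
  show thesis
    by (rule that[of u]) (use * in blast)+
qed

section \<open>Categories and functors\<close>

lemma hom_iff: "f \<in> hom C X Y \<longleftrightarrow> f \<in> Arr C \<and> Dom C f = X \<and> Cod C f = Y"
  by (simp add: hom_def)

context category
begin

lemma Comp_closed [simp]:
  assumes "f \<in> Arr C" "g \<in> Arr C" "Cod C f = Dom C g"
  shows "g \<odot> f \<in> Arr C" "Dom C (g \<odot> f) = Dom C f" "Cod C (g \<odot> f) = Cod C g"
  using Comp_hom[of f "Dom C f" "Cod C f" g "Cod C g"] assms by (auto simp: hom_iff)

lemma Comp_assoc:
  assumes "f \<in> Arr C" "g \<in> Arr C" "h \<in> Arr C" "Cod C f = Dom C g" "Cod C g = Dom C h"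
  shows "(h \<odot> g) \<odot> f = h \<odot> (g \<odot> f)"
  using assms by (intro assoc) (auto simp: hom_iff)

lemma Id_closed [simp]:
  assumes "X \<in> Obj C"
  shows "Id C X \<in> Arr C" "Dom C (Id C X) = X" "Cod C (Id C X) = X"
  using Id_hom[OF assms] by (auto simp: hom_iff)

lemma Comp_Id [simp]: "f \<in> Arr C \<Longrightarrow> Dom C f = X \<Longrightarrow> f \<odot> Id C X = f"
  using Id_right by (auto simp: hom_iff)

lemma Id_Comp [simp]: "f \<in> Arr C \<Longrightarrow> Cod C f = X \<Longrightarrow> Id C X \<odot> f = f"
  using Id_left by (auto simp: hom_iff)

lemma arr_hom: "f \<in> Arr C \<Longrightarrow> f \<in> hom C (Dom C f) (Cod C f)"
  by (simp add: hom_iff)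

lemma hom_Obj: "f \<in> hom C X Y \<Longrightarrow> X \<in> Obj C \<and> Y \<in> Obj C"
  using Dom_closed Cod_closed by (auto simp: hom_iff)

end

context Functor
begin

lemma farr_closed [simp]:
  assumes "f \<in> Arr A"
  shows "farr F f \<in> Arr B" "Dom B (farr F f) = fobj F (Dom A f)"
    "Cod B (farr F f) = fobj F (Cod A f)"
  using farr_hom[OF A.arr_hom[OF assms]] by (auto simp: hom_iff)

lemma farr_Comp':
  assumes "f \<in> Arr A" "g \<in> Arr A" "Cod A f = Dom A g"
  shows "farr F (g \<odot>\<^bsub>A\<^esub> f) = farr F g \<odot>\<^bsub>B\<^esub> farr F f"
  using assms by (intro farr_Comp) (auto simp: hom_iff)

end

lemma func_eqI:
  assumes "Functor A B F" "Functor A B' G"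
    and "\<And>X. X \<in> Obj A \<Longrightarrow> fobj F X = fobj G X"
    and "\<And>f. f \<in> Arr A \<Longrightarrow> farr F f = farr G f"
  shows "F = (G :: ('o, 'm, 'p, 'n) func)"
proof -
  have "fobj F = fobj G"
    by (rule extensionalityI[OF Functor.fobj_ext[OF assms(1)] Functor.fobj_ext[OF assms(2)] assms(3)])
  moreover have "farr F = farr G"
    by (rule extensionalityI[OF Functor.farr_ext[OF assms(1)] Functor.farr_ext[OF assms(2)] assms(4)])
  ultimately show ?thesis by simp
qed

lemma fobj_func_comp [simp]: "X \<in> Obj A \<Longrightarrow> fobj (func_comp A G F) X = fobj G (fobj F X)"
  and farr_func_comp [simp]: "f \<in> Arr A \<Longrightarrow> farr (func_comp A G F) f = farr G (farr F f)"
  by (simp_all add: func_comp_def compose_def)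

lemma fobj_func_id [simp]: "X \<in> Obj A \<Longrightarrow> fobj (func_id A) X = X"
  and farr_func_id [simp]: "f \<in> Arr A \<Longrightarrow> farr (func_id A) f = f"
  by (simp_all add: func_id_def)

lemma Functor_func_id:
  assumes "category A"
  shows "Functor A A (func_id A)"
proof -
  interpret category A by fact
  show ?thesis
    by unfold_locales (auto simp: func_id_def hom_iff Dom_closed Cod_closed)
qed

lemma Functor_func_comp:
  assumes "Functor A B F" "Functor B C G"
  shows "Functor A C (func_comp A G F)"
proof -
  interpret F: Functor A B F by fact
  interpret G: Functor B C G by fact
  show ?thesis
    by unfold_locales
      (auto simp: func_comp_def compose_def hom_iff F.A.Dom_closed F.A.Cod_closed F.fobj_closed
        G.fobj_closed F.farr_Id G.farr_Id F.farr_Comp' G.farr_Comp')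
qed

lemma func_comp_assoc:
  assumes "Functor A B F" "Functor B C G"
  shows "func_comp A H (func_comp A G F) = func_comp A (func_comp B H G) F"
proof -
  interpret F: Functor A B F by fact
  show ?thesis
    by (auto simp: func_comp_def compose_def F.fobj_closed intro!: restrict_ext)
qed

lemma func_comp_id_right: 
  assumes "Functor A B F" shows "func_comp A F (func_id A) = F"
  using assms by (intro func_eqI[of A B _ B] Functor_func_comp[OF Functor_func_id])
     (auto simp: Functor_def)

lemma func_comp_id_left: 
  assumes "Functor A B F" shows "func_comp A (func_id B) F = F"
proof -
  interpret Functor A B F by fact
  show ?thesis
    by (intro func_eqI[of A B _ B] Functor_func_comp[OF assms] Functor_func_id)
      (auto simp: Functor_axioms B.category_axioms fobj_closed)
qed

text \<open>With a left inverse on arrows, \<open>R\<close> is faithful, so the laws for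
  \<open>R'\<close> can be tested after applying \<open>R\<close>, where they become equations of
  \<open>B\<close>. This spares a direct computation of vertical parts of composites when
  \<open>decompose\<close> is shown to be a functor.\<close>

lemma Functor_inverse:
  assumes "Functor A B R"
    and "fobj R' \<in> extensional (Obj B)" "farr R' \<in> extensional (Arr B)"
    and obj: "\<And>X. X \<in> Obj B \<Longrightarrow> fobj R' X \<in> Obj A \<and> fobj R (fobj R' X) = X"
    and arr: "\<And>f. f \<in> Arr B \<Longrightarrow>
      farr R' f \<in> hom A (fobj R' (Dom B f)) (fobj R' (Cod B f)) \<and> farr R (farr R' f) = f"
    and inj: "\<And>f. f \<in> Arr A \<Longrightarrow> farr R' (farr R f) = f"
  shows "Functor B A R'"
proof -
  interpret R: Functor A B R by fact
  show ?thesis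
  proof (unfold_locales, goal_cases)
    case (5 X)
    have "farr R (Id A (fobj R' X)) = Id B X" using 5 obj R.farr_Id by auto
    then show ?case using inj[of "Id A (fobj R' X)"] obj[OF 5] by simp
  next
    case (6 f X Y g Z)
    then have fg: "f \<in> Arr B" "g \<in> Arr B" "Cod B f = Dom B g" by (auto simp: hom_iff)
    let ?gf = "farr R' g \<odot>\<^bsub>A\<^esub> farr R' f"
    have a: "farr R' f \<in> Arr A" "farr R' g \<in> Arr A" "Cod A (farr R' f) = Dom A (farr R' g)"
      using arr fg by (auto simp: hom_iff)
    have "farr R ?gf = g \<odot>\<^bsub>B\<^esub> f"
      using R.farr_Comp'[OF a] arr fg by auto
    then show ?case using inj[of ?gf] a by simp
  qed (use assms in \<open>auto simp: hom_iff\<close>)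
qed

section \<open>Diagrams\<close>

context nat_trans
begin

lemma naturality':
  assumes "f \<in> Arr A"
  shows "\<alpha> (Cod A f) \<odot>\<^bsub>B\<^esub> farr F f = farr G f \<odot>\<^bsub>B\<^esub> \<alpha> (Dom A f)"
  by (rule naturality) (simp add: hom_iff assms)

end

lemma nat_transI:
  assumes "Functor A B F" "Functor A B G" "\<alpha> \<in> extensional (Obj A)"
    and "\<And>X. X \<in> Obj A \<Longrightarrow> \<alpha> X \<in> hom B (fobj F X) (fobj G X)"
    and "\<And>f. f \<in> Arr A \<Longrightarrow>
      \<alpha> (Cod A f) \<odot>\<^bsub>B\<^esub> farr F f = farr G f \<odot>\<^bsub>B\<^esub> \<alpha> (Dom A f)"
  shows "nat_trans A B F G \<alpha>"
  using assms by (auto simp: nat_trans_def nat_trans_axioms_def hom_iff)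

lemma diag_hom_iff:
  "(R, \<rho>) \<in> diag_hom C (J, D) (J', D') \<longleftrightarrow>
    Functor J J' R \<and> nat_trans J C D (func_comp J D' R) \<rho>"
  by (simp add: diag_hom_def)

lemma diag_homI:
  assumes "Functor J J' R" "Functor J C D" "Functor J' C D'" "\<rho> \<in> extensional (Obj J)"
    and "\<And>j. j \<in> Obj J \<Longrightarrow> \<rho> j \<in> hom C (fobj D j) (fobj D' (fobj R j))"
    and "\<And>f. f \<in> Arr J \<Longrightarrow>
      \<rho> (Cod J f) \<odot>\<^bsub>C\<^esub> farr D f = farr D' (farr R f) \<odot>\<^bsub>C\<^esub> \<rho> (Dom J f)"
  shows "(R, \<rho>) \<in> diag_hom C (J, D) (J', D')"
  using assms by (auto simp: diag_hom_iff intro!: nat_transI Functor_func_comp)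

lemma diag_homD:
  assumes "(R, \<rho>) \<in> diag_hom C (J, D) (J', D')"
  shows "Functor J J' R" "Functor J C D" "\<rho> \<in> extensional (Obj J)"
    and "\<And>j. j \<in> Obj J \<Longrightarrow> \<rho> j \<in> hom C (fobj D j) (fobj D' (fobj R j))"
    and "\<And>f. f \<in> Arr J \<Longrightarrow>
      \<rho> (Cod J f) \<odot>\<^bsub>C\<^esub> farr D f = farr D' (farr R f) \<odot>\<^bsub>C\<^esub> \<rho> (Dom J f)"
proof -
  interpret R: Functor J J' R using assms by (simp add: diag_hom_iff)
  interpret \<rho>: nat_trans J C D "func_comp J D' R" \<rho> using assms by (simp add: diag_hom_iff)
  show "Functor J J' R" "Functor J C D" "\<rho> \<in> extensional (Obj J)"
    by (rule R.Functor_axioms \<rho>.F.Functor_axioms \<rho>.component_ext)+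
  show "\<rho> j \<in> hom C (fobj D j) (fobj D' (fobj R j))" if "j \<in> Obj J" for j
    using \<rho>.component_hom[OF that] that by simp
  show "\<rho> (Cod J f) \<odot>\<^bsub>C\<^esub> farr D f = farr D' (farr R f) \<odot>\<^bsub>C\<^esub> \<rho> (Dom J f)"
    if "f \<in> Arr J" for f
    using \<rho>.naturality'[OF that] that by simp
qed

lemma diag_comp_simp:
  "diag_comp C J (S, \<sigma>) (R, \<rho>) = (func_comp J S R, \<lambda>j\<in>Obj J. \<sigma> (fobj R j) \<odot>\<^bsub>C\<^esub> \<rho> j)"
  by (simp add: diag_comp_def)

lemma diag_comp_hom:
  assumes "Functor J3 C D3"
    and "\<Phi> \<in> diag_hom C (J1, D1) (J2, D2)" "\<Psi> \<in> diag_hom C (J2, D2) (J3, D3)"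
  shows "diag_comp C J1 \<Psi> \<Phi> \<in> diag_hom C (J1, D1) (J3, D3)"
proof -
  obtain R \<rho> where \<Phi>: "\<Phi> = (R, \<rho>)" by (cases \<Phi>)
  obtain S \<sigma> where \<Psi>: "\<Psi> = (S, \<sigma>)" by (cases \<Psi>)
  note r = diag_homD[OF assms(2)[unfolded \<Phi>]] and s = diag_homD[OF assms(3)[unfolded \<Psi>]]
  interpret D3: Functor J3 C D3 by fact
  interpret R: Functor J1 J2 R by (rule r)
  interpret S: Functor J2 J3 S by (rule s)
  interpret D1: Functor J1 C D1 by (rule r)
  interpret D2: Functor J2 C D2 by (rule s)
  have r': "\<rho> j \<in> Arr C \<and> Dom C (\<rho> j) = fobj D1 j \<and> Cod C (\<rho> j) = fobj D2 (fobj R j)"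
    if "j \<in> Obj J1" for j using r(4)[OF that] by (simp add: hom_iff)
  have s': "\<sigma> j \<in> Arr C \<and> Dom C (\<sigma> j) = fobj D2 j \<and> Cod C (\<sigma> j) = fobj D3 (fobj S j)"
    if "j \<in> Obj J2" for j using s(4)[OF that] by (simp add: hom_iff)
  note [simp] = r' s' R.fobj_closed R.A.Dom_closed R.A.Cod_closed
  show ?thesis unfolding \<Phi> \<Psi> diag_comp_simp
  proof (rule diag_homI)
    show "Functor J1 J3 (func_comp J1 S R)"
      by (rule Functor_func_comp[OF r(1) s(1)])
    fix f assume f: "f \<in> Arr J1"
    let ?X = "Dom J1 f" and ?Y = "Cod J1 f"
    have "(\<sigma> (fobj R ?Y) \<odot>\<^bsub>C\<^esub> \<rho> ?Y) \<odot>\<^bsub>C\<^esub> farr D1 f =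
      (\<sigma> (fobj R ?Y) \<odot>\<^bsub>C\<^esub> farr D2 (farr R f)) \<odot>\<^bsub>C\<^esub> \<rho> ?X"
      using f r(5)[OF f] by (simp add: D3.B.Comp_assoc)
    also have "\<sigma> (fobj R ?Y) \<odot>\<^bsub>C\<^esub> farr D2 (farr R f) =
      farr D3 (farr S (farr R f)) \<odot>\<^bsub>C\<^esub> \<sigma> (fobj R ?X)"
      using s(5)[of "farr R f"] f by simp
    finally show "(\<lambda>j\<in>Obj J1. \<sigma> (fobj R j) \<odot>\<^bsub>C\<^esub> \<rho> j) ?Y \<odot>\<^bsub>C\<^esub> farr D1 f =
      farr D3 (farr (func_comp J1 S R) f) \<odot>\<^bsub>C\<^esub> (\<lambda>j\<in>Obj J1. \<sigma> (fobj R j) \<odot>\<^bsub>C\<^esub> \<rho> j) ?X"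
      using f by (simp add: D3.B.Comp_assoc)
  qed (use r(2) assms(1) in \<open>auto simp: hom_iff\<close>)
qed

lemma diag_id_hom:
  assumes "Functor J C D"
  shows "diag_id C (J, D) \<in> diag_hom C (J, D) (J, D)"
proof -
  interpret Functor J C D by fact
  show ?thesis unfolding diag_id_def prod.case
    by (rule diag_homI)
      (auto simp: hom_iff fobj_closed A.Dom_closed A.Cod_closed Functor_axioms A.category_axioms
         Functor_func_id)
qed

lemma diag_comp_assoc:
  assumes "\<Phi> \<in> diag_hom C (J1, D1) (J2, D2)" "\<Psi> \<in> diag_hom C (J2, D2) (J3, D3)"
    "\<Theta> \<in> diag_hom C (J3, D3) (J4, D4)"
  shows "diag_comp C J1 (diag_comp C J2 \<Theta> \<Psi>) \<Phi> = diag_comp C J1 \<Theta> (diag_comp C J1 \<Psi> \<Phi>)"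
proof -
  obtain R \<rho> where \<Phi>: "\<Phi> = (R, \<rho>)" by (cases \<Phi>)
  obtain S \<sigma> where \<Psi>: "\<Psi> = (S, \<sigma>)" by (cases \<Psi>)
  obtain T \<tau> where \<Theta>: "\<Theta> = (T, \<tau>)" by (cases \<Theta>)
  note r = diag_homD[OF assms(1)[unfolded \<Phi>]] and s = diag_homD[OF assms(2)[unfolded \<Psi>]]
    and t = diag_homD[OF assms(3)[unfolded \<Theta>]]
  interpret R: Functor J1 J2 R by (rule r)
  interpret S: Functor J2 J3 S by (rule s)
  interpret D1: Functor J1 C D1 by (rule r)
  have "(\<tau> (fobj S (fobj R j)) \<odot>\<^bsub>C\<^esub> \<sigma> (fobj R j)) \<odot>\<^bsub>C\<^esub> \<rho> j =
    \<tau> (fobj S (fobj R j)) \<odot>\<^bsub>C\<^esub> \<sigma> (fobj R j) \<odot>\<^bsub>C\<^esub> \<rho> j" if "j \<in> Obj J1" for j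
    using r(4)[OF that] s(4)[OF R.fobj_closed[OF that]]
      t(4)[OF S.fobj_closed[OF R.fobj_closed[OF that]]]
    by (intro D1.B.assoc)
  then show ?thesis
    by (auto simp: \<Phi> \<Psi> \<Theta> diag_comp_simp func_comp_assoc[OF r(1) s(1)] R.fobj_closed
        intro!: restrict_ext)
qed

lemma diag_comp_id:
  assumes "Functor J' C D'" "\<Phi> \<in> diag_hom C (J, D) (J', D')"
  shows "diag_comp C J \<Phi> (diag_id C (J, D)) = \<Phi>"
    and "diag_comp C J (diag_id C (J', D')) \<Phi> = \<Phi>"
proof -
  obtain R \<rho> where \<Phi>: "\<Phi> = (R, \<rho>)" by (cases \<Phi>)
  note r = diag_homD[OF assms(2)[unfolded \<Phi>]]
  interpret R: Functor J J' R by (rule r)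
  interpret D: Functor J C D by (rule r)
  have "\<rho> = (\<lambda>j\<in>Obj J. \<rho> j)" using r(3) by (simp add: extensional_restrict)
  moreover have "\<rho> j \<odot>\<^bsub>C\<^esub> Id C (fobj D j) = \<rho> j" 
     "Id C (fobj D' (fobj R j)) \<odot>\<^bsub>C\<^esub> \<rho> j = \<rho> j" if "j \<in> Obj J" for j
    using r(4)[OF that] by (auto simp: hom_iff)
  ultimately show "diag_comp C J \<Phi> (diag_id C (J, D)) = \<Phi>" 
    "diag_comp C J (diag_id C (J', D')) \<Phi> = \<Phi>"
    by (auto simp: \<Phi> diag_comp_simp diag_id_def func_comp_id_right[OF r(1)] 
       func_comp_id_left[OF r(1)] R.fobj_closed cong: restrict_cong)
qed

section \<open>The category Diag(C)\<close>

lemma Diag_simps [simp]: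
  "Obj (Diag C) = small_diagrams C"
  "Dom (Diag C) (\<D>, \<Phi>, \<D>') = \<D>" "Cod (Diag C) (\<D>, \<Phi>, \<D>') = \<D>'"
  "Id (Diag C) \<D> = (\<D>, diag_id C \<D>, \<D>)"
  "Comp (Diag C) (\<A>, \<Psi>, \<D>'') (\<D>, \<Phi>, \<B>) = (\<D>, diag_comp C (fst \<D>) \<Psi> \<Phi>, \<D>'')"
  by (simp_all add: Diag_def)

lemma Diag_hom_iff:
  "a \<in> hom (Diag C) \<D> \<D>' \<longleftrightarrow> \<D> \<in> small_diagrams C \<and> \<D>' \<in> small_diagrams C \<and>
    (\<exists>\<Phi>\<in>diag_hom C \<D> \<D>'. a = (\<D>, \<Phi>, \<D>'))"
  by (auto simp: hom_iff Diag_def)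

lemma small_diagramsD:
  assumes "(J, D) \<in> small_diagrams C"
  shows "small_category TYPE('u) J" "Functor J C (D :: ('u, 'u, 'o, 'm) func)"
  using assms by (auto simp: small_diagrams_def)

lemma category_Diag: "category (Diag C :: (('u, 'o, 'm) sdiagram, _) cat)"
proof (unfold_locales, goal_cases)
  case (3 X)
  then show ?case by (cases X) (auto simp: Diag_hom_iff dest: small_diagramsD intro: diag_id_hom)
next
  case (4 f X Y g Z)
  then obtain \<Phi> \<Psi> where "f = (X, \<Phi>, Y)" "g = (Y, \<Psi>, Z)"
    "\<Phi> \<in> diag_hom C X Y" "\<Psi> \<in> diag_hom C Y Z" "X \<in> small_diagrams C" "Z \<in> small_diagrams C"
    by (auto simp: Diag_hom_iff)
  then show ?case using diag_comp_hom[of "fst Z" C "snd Z" \<Phi> "fst X" "snd X" "fst Y" "snd Y" \<Psi>]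
    by (cases Z) (auto simp: Diag_hom_iff dest: small_diagramsD)
next
  case (5 f X Y)
  then show ?case
    using diag_comp_id(1)[of "fst Y" C "snd Y" _ "fst X" "snd X"]
    by (cases Y) (auto simp: Diag_hom_iff dest: small_diagramsD)
next
  case (6 f X Y)
  then show ?case
    using diag_comp_id(2)[of "fst Y" C "snd Y" _ "fst X" "snd X"]
    by (cases Y) (auto simp: Diag_hom_iff dest: small_diagramsD)
next
  case (7 f W X g Y h Z)
  then show ?case
    using diag_comp_assoc[of _ C "fst W" "snd W" "fst X" "snd X" _ "fst Y" "snd Y" _ "fst Z" "snd Z"]
    by (auto simp: Diag_hom_iff)
qed (auto simp: Diag_def)

section \<open>Isomorphisms in Diag(C)\<close>

lemma diag_comp_eq_idD:
  assumes "Functor J J' R" "diag_comp C J (R', \<rho>') (R, \<rho>) = diag_id C (J, D)"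
  shows "j \<in> Obj J \<Longrightarrow> fobj R' (fobj R j) = j"
    and "f \<in> Arr J \<Longrightarrow> farr R' (farr R f) = f"
    and "j \<in> Obj J \<Longrightarrow> \<rho>' (fobj R j) \<odot>\<^bsub>C\<^esub> \<rho> j = Id C (fobj D j)"
proof -
  interpret Functor J J' R by fact
  have 1: "func_comp J R' R = func_id J"
    and 2: "(\<lambda>j\<in>Obj J. \<rho>' (fobj R j) \<odot>\<^bsub>C\<^esub> \<rho> j) = (\<lambda>j\<in>Obj J. Id C (fobj D j))"
    using assms(2) by (auto simp: diag_comp_simp diag_id_def)
  show "fobj R' (fobj R j) = j" if "j \<in> Obj J"
    using arg_cong[OF 1, of "\<lambda>F. fobj F j"] that by simp
  show "farr R' (farr R f) = f" if "f \<in> Arr J"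
    using arg_cong[OF 1, of "\<lambda>F. farr F f"] that by simp
  show "\<rho>' (fobj R j) \<odot>\<^bsub>C\<^esub> \<rho> j = Id C (fobj D j)" if "j \<in> Obj J"
    using fun_cong[OF 2, of j] that by simp
qed

locale diag_isomorphism =
  fixes C :: "('o, 'm) cat" and J :: "('i, 'j) cat" and D and J' :: "('i2, 'j2) cat" and D'
    and R \<rho> R' \<rho>'
  assumes hom: "(R, \<rho>) \<in> diag_hom C (J, D) (J', D')"
    and inv_hom: "(R', \<rho>') \<in> diag_hom C (J', D') (J, D)"
    and inv_left: "diag_comp C J (R', \<rho>') (R, \<rho>) = diag_id C (J, D)"
    and inv_right: "diag_comp C J' (R, \<rho>) (R', \<rho>') = diag_id C (J', D')"
begin

sublocale R: Functor J J' R using diag_homD[OF hom] by simp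
sublocale R': Functor J' J R' using diag_homD[OF inv_hom] by simp
sublocale D: Functor J C D using diag_homD[OF hom] by simp
sublocale D': Functor J' C D' using diag_homD[OF inv_hom] by simp

lemmas R'_R [simp] = diag_comp_eq_idD(1,2)[OF R.Functor_axioms inv_left]
lemmas R_R' [simp] = diag_comp_eq_idD(1,2)[OF R'.Functor_axioms inv_right]
lemmas \<rho>'_\<rho> = diag_comp_eq_idD(3)[OF R.Functor_axioms inv_left]
lemmas \<rho>_\<rho>' = diag_comp_eq_idD(3)[OF R'.Functor_axioms inv_right]

lemma \<rho>_closed [simp]:
  assumes "j \<in> Obj J"
  shows "\<rho> j \<in> Arr C" "Dom C (\<rho> j) = fobj D j" "Cod C (\<rho> j) = fobj D' (fobj R j)"
  using diag_homD(4)[OF hom assms] by (auto simp: hom_iff)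

lemma \<rho>'_closed [simp]:
  assumes "j \<in> Obj J'"
  shows "\<rho>' j \<in> Arr C" "Dom C (\<rho>' j) = fobj D' j" "Cod C (\<rho>' j) = fobj D (fobj R' j)"
  using diag_homD(4)[OF inv_hom assms] by (auto simp: hom_iff)

end

lemma diag_isoE:
  assumes "diag_iso C (J, D) (J', D')"
  obtains R \<rho> R' \<rho>' where "diag_isomorphism C J D J' D' R \<rho> R' \<rho>'"
  using assms unfolding diag_iso_def by (auto simp: diag_isomorphism_def)

text \<open>Pointwise inverses of a natural transformation are automatically natural, so only arrows
  \<open>\<sigma> j\<close> are asked for. They are indexed by \<open>J\<close>, while the inverse
  morphism needs a family on \<open>J'\<close>; hence the reindexing along \<open>R'\<close> in the
  proof.\<close>

lemma diag_isoI:
  assumes hom: "(R, \<rho>) \<in> diag_hom C (J, D) (J', D')"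
    and "Functor J' C D'" "Functor J' J R'"
    and inv: "\<And>j. j \<in> Obj J \<Longrightarrow> fobj R' (fobj R j) = j" "\<And>f. f \<in> Arr J \<Longrightarrow> farr R' (farr R f) = f"
      "\<And>j. j \<in> Obj J' \<Longrightarrow> fobj R (fobj R' j) = j" "\<And>f. f \<in> Arr J' \<Longrightarrow> farr R (farr R' f) = f"
    and \<sigma>: "\<And>j. j \<in> Obj J \<Longrightarrow> \<sigma> j \<in> hom C (fobj D' (fobj R j)) (fobj D j) \<and>
      \<sigma> j \<odot>\<^bsub>C\<^esub> \<rho> j = Id C (fobj D j) \<and> \<rho> j \<odot>\<^bsub>C\<^esub> \<sigma> j = Id C (fobj D' (fobj R j))"
  shows "diag_iso C (J, D) (J', D')"
proof -
  note r = diag_homD[OF hom]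
  interpret R: Functor J J' R by (rule r)
  interpret R': Functor J' J R' by fact
  interpret D: Functor J C D by (rule r)
  interpret D': Functor J' C D' by fact
  have [simp]: "\<rho> j \<in> Arr C" "Dom C (\<rho> j) = fobj D j" "Cod C (\<rho> j) = fobj D' (fobj R j)"
    "\<sigma> j \<in> Arr C" "Dom C (\<sigma> j) = fobj D' (fobj R j)" "Cod C (\<sigma> j) = fobj D j"
    if "j \<in> Obj J" for j using r(4)[OF that] \<sigma>[OF that] by (auto simp: hom_iff)
  define \<rho>' where "\<rho>' = (\<lambda>j\<in>Obj J'. \<sigma> (fobj R' j))"
  note [simp] = inv R.fobj_closed R'.fobj_closed R.A.Dom_closed R.A.Cod_closed R.B.Dom_closed R.B.Cod_closed
  have hom': "(R', \<rho>') \<in> diag_hom C (J', D') (J, D)"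
  proof (rule diag_homI)
    fix f assume f: "f \<in> Arr J'"
    let ?X = "fobj R' (Dom J' f)" and ?Y = "fobj R' (Cod J' f)"
    \<comment> \<open>The square of \<open>\<rho>\<close> at \<open>farr R' f\<close>; composing
      with the inverses on both sides turns it into the square of \<open>\<rho>'\<close> at
      \<open>f\<close>.\<close>
    have "\<rho> ?Y \<odot>\<^bsub>C\<^esub> farr D (farr R' f) = farr D' f \<odot>\<^bsub>C\<^esub> \<rho> ?X"
      using r(5)[of "farr R' f"] f by simp
    then have "(\<sigma> ?Y \<odot>\<^bsub>C\<^esub> \<rho> ?Y) \<odot>\<^bsub>C\<^esub> farr D (farr R' f) \<odot>\<^bsub>C\<^esub> \<sigma> ?X =
      \<sigma> ?Y \<odot>\<^bsub>C\<^esub> farr D' f \<odot>\<^bsub>C\<^esub> \<rho> ?X \<odot>\<^bsub>C\<^esub> \<sigma> ?X"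
      using f by (simp add: D.B.Comp_assoc flip: D.B.Comp_assoc[of "\<sigma> ?X" "farr D (farr R' f)" "\<rho> ?Y"])
    then show "\<rho>' (Cod J' f) \<odot>\<^bsub>C\<^esub> farr D' f = farr D (farr R' f) \<odot>\<^bsub>C\<^esub> \<rho>' (Dom J' f)"
      using f \<sigma> by (simp add: \<rho>'_def)
  qed (use assms(2,3) r(2) in \<open>auto simp: \<rho>'_def hom_iff\<close>)
  have "diag_comp C J (R', \<rho>') (R, \<rho>) = diag_id C (J, D)"
    "diag_comp C J' (R, \<rho>) (R', \<rho>') = diag_id C (J', D')"
    using \<sigma> by (auto simp: diag_comp_simp diag_id_def \<rho>'_def R.A.category_axioms R.B.category_axioms
      intro!: restrict_ext
        func_eqI[OF Functor_func_comp[OF r(1) \<open>Functor J' J R'\<close>] Functor_func_id]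
        func_eqI[OF Functor_func_comp[OF \<open>Functor J' J R'\<close> r(1)] Functor_func_id])
  then show ?thesis
    unfolding diag_iso_def using hom hom' by auto
qed

section \<open>Colimits\<close>

lemma is_cocone_iff:
  "is_cocone C (J, D) a \<iota> \<longleftrightarrow>
     Functor J C D \<and> a \<in> Obj C \<and>
     (\<forall>j\<in>Obj J. \<iota> j \<in> hom C (fobj D j) a) \<and>
     (\<forall>f\<in>Arr J. \<iota> (Cod J f) \<odot>\<^bsub>C\<^esub> farr D f = \<iota> (Dom J f))"
  by (simp add: is_cocone_def)

lemma cocone_comp:
  assumes "is_cocone C (J, D) a \<iota>" "u \<in> hom C a b"
  shows "is_cocone C (J, D) b (\<lambda>j. u \<odot>\<^bsub>C\<^esub> \<iota> j)"
proof -
  interpret D: Functor J C D using assms(1) by (simp add: is_cocone_iff)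
  show ?thesis
    using assms D.B.hom_Obj[OF assms(2)] 
    by (auto simp: is_cocone_iff hom_iff D.B.Comp_assoc D.A.Dom_closed D.A.Cod_closed)
qed

lemma colimit_cocone: "is_colimit C \<D> a \<iota> \<Longrightarrow> is_cocone C \<D> a \<iota>"
  by (simp add: is_colimit_def)

lemma colimit_factor:
  assumes "is_colimit C (J, D) a \<iota>" "is_cocone C (J, D) b \<kappa>"
  shows "\<exists>!u. u \<in> hom C a b \<and> (\<forall>j\<in>Obj J. u \<odot>\<^bsub>C\<^esub> \<iota> j = \<kappa> j)"
  by (rule assms(1)[unfolded is_colimit_def fst_conv, THEN conjunct2, rule_format, OF assms(2)])

lemma colimit_cancel:
  assumes "is_colimit C (J, D) a \<iota>" "u \<in> hom C a b" "v \<in> hom C a b"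
    and "\<And>j. j \<in> Obj J \<Longrightarrow> u \<odot>\<^bsub>C\<^esub> \<iota> j = v \<odot>\<^bsub>C\<^esub> \<iota> j"
  shows "u = v"
proof -
  have "is_cocone C (J, D) b (\<lambda>j. u \<odot>\<^bsub>C\<^esub> \<iota> j)"
    by (rule cocone_comp[OF colimit_cocone[OF assms(1)] assms(2)])
  then have "\<exists>!w. w \<in> hom C a b \<and> (\<forall>j\<in>Obj J. w \<odot>\<^bsub>C\<^esub> \<iota> j = u \<odot>\<^bsub>C\<^esub> \<iota> j)"
    by (rule colimit_factor[OF assms(1)])
  then show ?thesis
  proof (rule alt_ex1E)
    fix w assume "\<forall>x y. (x \<in> hom C a b \<and> (\<forall>j\<in>Obj J. x \<odot>\<^bsub>C\<^esub> \<iota> j = u \<odot>\<^bsub>C\<^esub> \<iota> j)) \<and>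
      (y \<in> hom C a b \<and> (\<forall>j\<in>Obj J. y \<odot>\<^bsub>C\<^esub> \<iota> j = u \<odot>\<^bsub>C\<^esub> \<iota> j)) \<longrightarrow> x = y"
    from this[rule_format, of u v] assms(2-) show ?thesis by simp
  qed
qed

text \<open>The inverse is the factorisation in the other direction; both round trips fix the
  coprojections, which can be cancelled.\<close>

lemma colimit_unique:
  assumes "is_colimit C (J, D) a \<iota>" "is_colimit C (J, D) b \<kappa>"
    and u: "u \<in> hom C a b" "\<And>j. j \<in> Obj J \<Longrightarrow> u \<odot>\<^bsub>C\<^esub> \<iota> j = \<kappa> j"
  shows "\<exists>v \<in> hom C b a. v \<odot>\<^bsub>C\<^esub> u = Id C a \<and> u \<odot>\<^bsub>C\<^esub> v = Id C b"
proof -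
  have a: "is_cocone C (J, D) a \<iota>" and b: "is_cocone C (J, D) b \<kappa>"
    using assms(1,2) by (simp_all add: colimit_cocone)
  interpret D: Functor J C D using a by (simp add: is_cocone_iff)
  obtain v where v: "v \<in> hom C b a" "\<And>j. j \<in> Obj J \<Longrightarrow> v \<odot>\<^bsub>C\<^esub> \<kappa> j = \<iota> j"
    using ex1_implies_ex[OF colimit_factor[OF assms(2) a]] by auto
  have h: "\<iota> j \<in> hom C (fobj D j) a" "\<kappa> j \<in> hom C (fobj D j) b" if "j \<in> Obj J" for j
    using a b that by (auto simp: is_cocone_iff)
  have "a \<in> Obj C" "b \<in> Obj C" using a b by (auto simp: is_cocone_iff)
  have "v \<odot>\<^bsub>C\<^esub> u = Id C a"
    by (rule colimit_cancel[OF assms(1) D.B.Comp_hom[OF u(1) v(1)] D.B.Id_hom])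
      (use \<open>a \<in> Obj C\<close> u v h in \<open>auto simp: D.B.assoc[OF h(1) u(1) v(1)] D.B.Id_left[OF h(1)]\<close>)
  moreover have "u \<odot>\<^bsub>C\<^esub> v = Id C b"
    by (rule colimit_cancel[OF assms(2) D.B.Comp_hom[OF v(1) u(1)] D.B.Id_hom])
      (use \<open>b \<in> Obj C\<close> u v h in \<open>auto simp: D.B.assoc[OF h(2) v(1) u(1)] D.B.Id_left[OF h(2)]\<close>)
  ultimately show ?thesis using v by auto
qed

section \<open>Fibres\<close>

text \<open>Arrows are selected by their image alone: if \<open>k\<close> is an object, lying over
  \<open>Id K k\<close> already places both endpoints over \<open>k\<close>.\<close>

definition fibre :: "('i, 'j) cat \<Rightarrow> ('k, 'l) cat \<Rightarrow> ('i, 'j, 'k, 'l) func \<Rightarrow> 'k \<Rightarrow> ('i, 'j) cat" where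
  "fibre J K F k =
     \<lparr>Obj = {X \<in> Obj J. fobj F X = k}, Arr = {f \<in> Arr J. farr F f = Id K k},
      Dom = Dom J, Cod = Cod J, Id = Id J, Comp = Comp J\<rparr>"

definition fibre_diagram ::
  "('i, 'j) cat \<Rightarrow> ('k, 'l) cat \<Rightarrow> ('i, 'j, 'k, 'l) func \<Rightarrow> ('i, 'j, 'o, 'm) func \<Rightarrow> 'k \<Rightarrow>
   ('i, 'j, 'o, 'm) diagram" where
  "fibre_diagram J K F D k =
     (fibre J K F k,
      \<lparr>fobj = restrict (fobj D) (Obj (fibre J K F k)), farr = restrict (farr D) (Arr (fibre J K F k))\<rparr>)"

text \<open>One family \<open>\<eta>\<close> on all of \<open>J\<close> is read on each fibre
  separately. Compatibility of \<open>\<eta>\<close> with arrows of \<open>J\<close> that are not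
  vertical is no part of this notion; it enters the lemmas as membership of
  \<open>(F, \<eta>)\<close> in \<open>diag_hom C (J, D) (K, L)\<close>.\<close>

definition fibrewise_colimit ::
  "('i, 'j) cat \<Rightarrow> ('k, 'l) cat \<Rightarrow> ('o, 'm) cat \<Rightarrow> ('i, 'j, 'k, 'l) func \<Rightarrow>
   ('i, 'j, 'o, 'm) func \<Rightarrow> ('k, 'l, 'o, 'm) func \<Rightarrow> ('i \<Rightarrow> 'm) \<Rightarrow> bool" where
  "fibrewise_colimit J K C F D L \<eta> \<longleftrightarrow>
     (\<forall>k\<in>Obj K. is_colimit C (fibre_diagram J K F D k) (fobj L k) \<eta>)"

lemma fibre_simps [simp]:
  "X \<in> Obj (fibre J K F k) \<longleftrightarrow> X \<in> Obj J \<and> fobj F X = k"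
  "f \<in> Arr (fibre J K F k) \<longleftrightarrow> f \<in> Arr J \<and> farr F f = Id K k"
  "Dom (fibre J K F k) = Dom J" "Cod (fibre J K F k) = Cod J"
  "Id (fibre J K F k) = Id J" "Comp (fibre J K F k) = Comp J"
  by (simp_all add: fibre_def)

lemma fst_fibre_diagram [simp]: "fst (fibre_diagram J K F D k) = fibre J K F k"
  by (simp add: fibre_diagram_def)

lemma fibre_colimit_iff:
  "is_colimit C (fibre_diagram J K F D k) a \<eta> \<longleftrightarrow>
    is_cocone C (fibre_diagram J K F D k) a \<eta> \<and>
    (\<forall>b \<kappa>. is_cocone C (fibre_diagram J K F D k) b \<kappa> \<longrightarrow>
      (\<exists>!u. u \<in> hom C a b \<and> (\<forall>j\<in>Obj J. fobj F j = k \<longrightarrow> u \<odot>\<^bsub>C\<^esub> \<eta> j = \<kappa> j)))"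
  by (simp add: is_colimit_def Ball_def imp_conjL)

lemma fibre_colimit_factor:
  assumes "is_colimit C (fibre_diagram J K F D k) a \<eta>" "is_cocone C (fibre_diagram J K F D k) b \<kappa>"
  shows "\<exists>!u. u \<in> hom C a b \<and> (\<forall>j\<in>Obj J. fobj F j = k \<longrightarrow> u \<odot>\<^bsub>C\<^esub> \<eta> j = \<kappa> j)"
  by (rule fibre_colimit_iff[THEN iffD1, OF assms(1), THEN conjunct2, rule_format, OF assms(2)])

text \<open>Projections instead of tuple patterns let the simplifier work with objects and arrows
  that are plain variables.\<close>

lemma comma_simps:
  "x \<in> Obj (comma J K F k) \<longleftrightarrow> fst x \<in> Obj J \<and> snd x \<in> hom K (fobj F (fst x)) k"
  "f \<in> Arr (comma J K F k) \<longleftrightarrow> fst f \<in> Obj (comma J K F k) \<and> snd (snd f) \<in> Obj (comma J K F k) \<and>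
    fst (snd f) \<in> hom J (fst (fst f)) (fst (snd (snd f))) \<and>
    snd (snd (snd f)) \<odot>\<^bsub>K\<^esub> farr F (fst (snd f)) = snd (fst f)"
  "Dom (comma J K F k) f = fst f" "Cod (comma J K F k) f = snd (snd f)"
  "Id (comma J K F k) x = (x, Id J (fst x), x)"
  "Comp (comma J K F k) g f = (fst f, fst (snd g) \<odot>\<^bsub>J\<^esub> fst (snd f), snd (snd g))"
  by (cases x; cases f; auto simp: comma_def case_prod_beta)+

context Functor
begin

lemma vertical_fobj:
  assumes "f \<in> Arr A" "farr F f = Id B k" "k \<in> Obj B"
  shows "fobj F (Dom A f) = k" "fobj F (Cod A f) = k"
  using farr_closed[OF assms(1)] B.Id_closed[OF assms(3)] assms(2) by auto

lemma category_fibre: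
  assumes "k \<in> Obj B"
  shows "category (fibre A B F k)"
  by unfold_locales
    (use assms in \<open>auto simp: hom_iff A.Dom_closed A.Cod_closed vertical_fobj farr_Id farr_Comp'
      A.Comp_assoc\<close>)

lemma Functor_fibre_diagram:
  assumes "Functor A C D" "k \<in> Obj B"
  shows "Functor (fst (fibre_diagram A B F D k)) C (snd (fibre_diagram A B F D k))"
proof -
  interpret D: Functor A C D by fact
  interpret fibre: category "fibre A B F k" by (rule category_fibre) fact
  show ?thesis unfolding fibre_diagram_def fst_conv snd_conv
    by unfold_locales
      (use assms(2) in \<open>auto simp: hom_iff D.fobj_closed A.Dom_closed A.Cod_closed vertical_fobj D.farr_Id
         D.farr_Comp' farr_Id farr_Comp'\<close>)
qed

lemma fibre_cocone_iff:
  assumes "Functor A C D" "k \<in> Obj B"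
  shows "is_cocone C (fibre_diagram A B F D k) b \<kappa> \<longleftrightarrow> b \<in> Obj C \<and>
    (\<forall>j\<in>Obj A. fobj F j = k \<longrightarrow> \<kappa> j \<in> hom C (fobj D j) b) \<and>
    (\<forall>f\<in>Arr A. farr F f = Id B k \<longrightarrow> \<kappa> (Cod A f) \<odot>\<^bsub>C\<^esub> farr D f = \<kappa> (Dom A f))"
  using Functor_fibre_diagram[OF assms] unfolding fibre_diagram_def
  by (auto simp: is_cocone_iff)

text \<open>\<open>is_cocone\<close> includes functoriality of the diagram, so the comma category
  has to be a category, and \<open>comma_diagram\<close> a functor on it, before cocones over it can
  be unpacked.\<close>

lemma Functor_comma_diagram:
  assumes "Functor A C D" "k \<in> Obj B"
  shows "Functor (fst (comma_diagram A B F D k)) C (snd (comma_diagram A B F D k))"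
proof -
  interpret D: Functor A C D by fact
  \<comment> \<open>Pasting of two commuting triangles over \<open>k\<close>.\<close>
  have comp: "snd (snd (snd g)) \<odot>\<^bsub>B\<^esub> farr F (fst (snd g) \<odot>\<^bsub>A\<^esub> fst (snd f)) = snd (fst f)"
    if "f \<in> Arr (comma A B F k)" "g \<in> Arr (comma A B F k)" "snd (snd f) = fst g" for f g
  proof -
    have f: "fst (snd f) \<in> hom A (fst (fst f)) (fst (fst g))"
        "fst (snd g) \<in> hom A (fst (fst g)) (fst (snd (snd g)))"
      and *: "snd (snd (snd g)) \<odot>\<^bsub>B\<^esub> farr F (fst (snd g)) = snd (fst g)"
        "snd (fst g) \<odot>\<^bsub>B\<^esub> farr F (fst (snd f)) = snd (fst f)"
      and c: "snd (snd (snd g)) \<in> hom B (fobj F (fst (snd (snd g)))) k"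
      using that by (simp_all add: comma_simps)
    show ?thesis
      unfolding farr_Comp[OF f] B.assoc[OF farr_hom[OF f(1)] farr_hom[OF f(2)] c, symmetric] * ..
  qed
  interpret comma: category "comma A B F k"
  proof (unfold_locales, goal_cases)
    case (1 f)
    then show ?case by (simp add: comma_simps(2-))
  next
    case (2 f)
    then show ?case by (simp add: comma_simps(2-))
  next
    case (3 X)
    then show ?case by (simp add: hom_iff comma_simps farr_Id)
  next
    case (4 f X Y g Z)
    then have fg: "f \<in> Arr (comma A B F k)" "g \<in> Arr (comma A B F k)" "snd (snd f) = fst g"
      and XZ: "fst f = X" "snd (snd g) = Z"
      by (simp_all add: hom_iff comma_simps(3,4))
    then show ?case using comp[OF fg] by (simp add: hom_iff comma_simps)
  next
    case (5 f X Y)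
    then show ?case by (simp add: hom_iff comma_simps prod_eq_iff)
  next
    case (6 f X Y)
    then show ?case by (simp add: hom_iff comma_simps prod_eq_iff)
  next
    case (7 f W X g Y h Z)
    then show ?case by (auto simp: hom_iff comma_simps A.Comp_assoc)
  qed
  have eq: "snd (comma_diagram A B F D k) =
    \<lparr>fobj = \<lambda>x\<in>Obj (comma A B F k). fobj D (fst x),
     farr = \<lambda>f\<in>Arr (comma A B F k). farr D (fst (snd f))\<rparr>"
    by (auto simp: comma_diagram_def intro!: restrict_ext)
  show ?thesis unfolding eq unfolding comma_diagram_def fst_conv
  proof (unfold_locales, goal_cases)
    case (4 f X Y)
    then have f: "f \<in> Arr (comma A B F k)" and XY: "fst f = X" "snd (snd f) = Y"
      by (simp_all add: hom_iff comma_simps(3,4))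
    then have "X \<in> Obj (comma A B F k)" "Y \<in> Obj (comma A B F k)"
        "fst (snd f) \<in> hom A (fst X) (fst Y)"
      by (simp_all add: comma_simps(2))
    with f XY show ?case using D.farr_hom by simp
  next
    case (5 X)
    then have "fst X \<in> Obj A" by (simp add: comma_simps(1))
    moreover have "(X, Id A (fst X), X) \<in> Arr (comma A B F k)"
      using comma.Id_closed(1)[OF 5] by (simp only: comma_simps(5))
    ultimately show ?case using 5 by (simp add: comma_simps(5) D.farr_Id)
  next
    case (6 f X Y g Z)
    then have fg: "f \<in> Arr (comma A B F k)" "g \<in> Arr (comma A B F k)"
      "g \<odot>\<^bsub>comma A B F k\<^esub> f \<in> Arr (comma A B F k)"
      and Y: "snd (snd f) = Y" "fst g = Y"
      using comma.Comp_hom[OF 6] by (simp_all add: hom_iff comma_simps(3,4))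
    then have "fst (snd f) \<in> hom A (fst (fst f)) (fst Y)" "fst (snd g) \<in> hom A (fst Y) (fst (snd (snd g)))"
      by (simp_all add: comma_simps(2))
    then have "farr D (fst (snd (g \<odot>\<^bsub>comma A B F k\<^esub> f))) =
        farr D (fst (snd g)) \<odot>\<^bsub>C\<^esub> farr D (fst (snd f))"
      unfolding comma_simps(6) fst_conv snd_conv by (rule D.farr_Comp)
    with fg show ?case by simp
  qed (simp_all add: comma_simps(1) D.fobj_closed)
qed

text \<open>An arrow of \<open>F \<down> k\<close> is determined by its underlying arrow
  \<open>f\<close> and the second component \<open>h\<close> of its target, since the second
  component of its source is then forced. Quantifying over such pairs removes the tuples of
  \<open>comma\<close>.\<close>

lemma comma_cocone_iff:
  assumes "Functor A C D" "k \<in> Obj B"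
  shows "is_cocone C (comma_diagram A B F D k) b \<kappa> \<longleftrightarrow> b \<in> Obj C \<and>
    (\<forall>j\<in>Obj A. \<forall>h\<in>hom B (fobj F j) k. \<kappa> (j, h) \<in> hom C (fobj D j) b) \<and>
    (\<forall>f\<in>Arr A. \<forall>h\<in>hom B (fobj F (Cod A f)) k.
       \<kappa> (Cod A f, h) \<odot>\<^bsub>C\<^esub> farr D f = \<kappa> (Dom A f, h \<odot>\<^bsub>B\<^esub> farr F f))"
    (is "?l \<longleftrightarrow> ?r")
proof -
  have "Functor (comma A B F k) C (snd (comma_diagram A B F D k))"
    using Functor_comma_diagram[OF assms] by (simp add: comma_diagram_def)
  then have "?l \<longleftrightarrow> b \<in> Obj C \<and>
      (\<forall>x\<in>Obj (comma A B F k). \<kappa> x \<in> hom C (fobj D (fst x)) b) \<and>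
      (\<forall>(x, f, y)\<in>Arr (comma A B F k). \<kappa> y \<odot>\<^bsub>C\<^esub> farr D f = \<kappa> x)"
    by (simp add: comma_diagram_def is_cocone_iff case_prod_beta comma_simps(3,4))
  also have "(\<forall>x\<in>Obj (comma A B F k). \<kappa> x \<in> hom C (fobj D (fst x)) b) \<longleftrightarrow>
      (\<forall>j\<in>Obj A. \<forall>h\<in>hom B (fobj F j) k. \<kappa> (j, h) \<in> hom C (fobj D j) b)"
    by (simp add: Ball_def comma_simps(1) imp_conjL)
  also have "(\<forall>(x, f, y)\<in>Arr (comma A B F k). \<kappa> y \<odot>\<^bsub>C\<^esub> farr D f = \<kappa> x) \<longleftrightarrow>
      (\<forall>f\<in>Arr A. \<forall>h\<in>hom B (fobj F (Cod A f)) k.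
        \<kappa> (Cod A f, h) \<odot>\<^bsub>C\<^esub> farr D f = \<kappa> (Dom A f, h \<odot>\<^bsub>B\<^esub> farr F f))"
    (is "?P \<longleftrightarrow> ?Q")
  proof
    show ?Q if ?P
    proof (intro ballI)
      fix f h assume "f \<in> Arr A" "h \<in> hom B (fobj F (Cod A f)) k"
      then have "((Dom A f, h \<odot>\<^bsub>B\<^esub> farr F f), f, (Cod A f, h)) \<in> Arr (comma A B F k)"
        by (simp add: comma_simps hom_iff A.Dom_closed A.Cod_closed)
      then show "\<kappa> (Cod A f, h) \<odot>\<^bsub>C\<^esub> farr D f = \<kappa> (Dom A f, h \<odot>\<^bsub>B\<^esub> farr F f)"
        using that by blast
    qed
    show ?P if ?Q
    proof clarify
      fix j h f j' h' assume "((j, h), f, (j', h')) \<in> Arr (comma A B F k)"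
      then have "f \<in> Arr A" "Dom A f = j" "Cod A f = j'" "h' \<in> hom B (fobj F (Cod A f)) k"
        "h' \<odot>\<^bsub>B\<^esub> farr F f = h"
        by (auto simp: comma_simps hom_iff)
      then show "\<kappa> (j', h') \<odot>\<^bsub>C\<^esub> farr D f = \<kappa> (j, h)" using that by blast
    qed
  qed
  finally show ?thesis .
qed

end

text \<open>At a vertical arrow the naturality square of \<open>\<eta>\<close> contains the image
  under \<open>L\<close> of \<open>Id K k\<close>, an identity, and so collapses to the triangle of
  a cocone.\<close>

lemma fibre_cocone:
  assumes hom: "(F, \<eta>) \<in> diag_hom C (J, D) (K, L)" and "Functor K C L" and k: "k \<in> Obj K"
  shows "is_cocone C (fibre_diagram J K F D k) (fobj L k) \<eta>"
proof -
  note d = diag_homD[OF hom]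
  interpret F: Functor J K F by (rule d)
  interpret D: Functor J C D by (rule d)
  interpret L: Functor K C L by fact
  show ?thesis
    unfolding F.fibre_cocone_iff[OF D.Functor_axioms k]
  proof (intro conjI ballI impI)
    show "fobj L k \<in> Obj C" using k by (rule L.fobj_closed)
    show "\<eta> j \<in> hom C (fobj D j) (fobj L k)" if "j \<in> Obj J" "fobj F j = k" for j
      using d(4)[OF that(1)] that(2) by simp
    show "\<eta> (Cod J f) \<odot>\<^bsub>C\<^esub> farr D f = \<eta> (Dom J f)" if "f \<in> Arr J" "farr F f = Id K k" for f
      using d(5)[OF that(1)] d(4)[OF F.A.Dom_closed[OF that(1)]] F.vertical_fobj[OF that k] that k
      by (simp add: L.farr_Id hom_iff)
  qed
qed

section \<open>Split opfibrations\<close>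

locale split_opfib = Functor J K F
  for J :: "('i, 'j) cat" and K :: "('k, 'l) cat" and F :: "('i, 'j, 'k, 'l) func" +
  fixes \<chi> :: "'i \<Rightarrow> 'l \<Rightarrow> 'j"
  assumes splitting: "is_splitting J K F \<chi>"
begin

lemma lift_closed [simp]:
  assumes "X \<in> Obj J" "k \<in> Arr K" "Dom K k = fobj F X"
  shows "\<chi> X k \<in> Arr J" "Dom J (\<chi> X k) = X" "farr F (\<chi> X k) = k" "opcartesian J K F (\<chi> X k)"
    "fobj F (Cod J (\<chi> X k)) = Cod K k" "Cod J (\<chi> X k) \<in> Obj J"
proof -
  show 1: "\<chi> X k \<in> Arr J" "Dom J (\<chi> X k) = X" "farr F (\<chi> X k) = k" "opcartesian J K F (\<chi> X k)"
    using splitting assms unfolding is_splitting_def by (auto simp: hom_iff)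
  show "fobj F (Cod J (\<chi> X k)) = Cod K k" "Cod J (\<chi> X k) \<in> Obj J"
    using farr_closed[OF 1(1)] 1 by (auto simp: A.Cod_closed)
qed

lemma lift_Id [simp]: "X \<in> Obj J \<Longrightarrow> \<chi> X (Id K (fobj F X)) = Id J X"
  using splitting unfolding is_splitting_def by auto

lemma lift_Comp:
  assumes "X \<in> Obj J" "k \<in> Arr K" "Dom K k = fobj F X" "l \<in> Arr K" "Dom K l = Cod K k"
  shows "\<chi> X (l \<odot>\<^bsub>K\<^esub> k) = \<chi> (Cod J (\<chi> X k)) l \<odot>\<^bsub>J\<^esub> \<chi> X k"
  using splitting assms unfolding is_splitting_def by (auto simp: hom_iff)

text \<open>The uniqueness half of opcartesianness: a chosen lift behaves as an epimorphism for
  arrows with equal image in \<open>K\<close>.\<close>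

lemma lift_cancel:
  assumes "X \<in> Obj J" "k \<in> Arr K" "Dom K k = fobj F X"
    and "v \<in> Arr J" "w \<in> Arr J" "Dom J v = Cod J (\<chi> X k)" "Dom J w = Cod J (\<chi> X k)"
    and "farr F v = farr F w" "v \<odot>\<^bsub>J\<^esub> \<chi> X k = w \<odot>\<^bsub>J\<^esub> \<chi> X k"
  shows "v = w"
proof -
  let ?f = "\<chi> X k"
  have f: "?f \<in> Arr J" "opcartesian J K F ?f" using assms by auto
  have "Cod J v = Cod J w" using A.Comp_closed(3)[of ?f v] A.Comp_closed(3)[of ?f w] f assms by simp
  then have "v \<odot>\<^bsub>J\<^esub> ?f \<in> hom J (Dom J ?f) (Cod J v)" "farr F v \<in> hom K (fobj F (Cod J ?f)) (fobj F (Cod J v))"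
    "farr F v \<odot>\<^bsub>K\<^esub> farr F ?f = farr F (v \<odot>\<^bsub>J\<^esub> ?f)"
    using f assms by (auto simp: hom_iff farr_Comp' simp del: lift_closed)
  then have "\<exists>!h'. h' \<in> hom J (Cod J ?f) (Cod J v) \<and> farr F h' = farr F v \<and> h' \<odot>\<^bsub>J\<^esub> ?f = v \<odot>\<^bsub>J\<^esub> ?f"
    using f(2) unfolding opcartesian_def by blast
  then show ?thesis using assms \<open>Cod J v = Cod J w\<close> by (auto simp: hom_iff)
qed

text \<open>The vertical part of \<open>g\<close>, so that \<open>g\<close> is its composite with the lift of \<open>F g\<close>.\<close>

definition vertical :: "'j \<Rightarrow> 'j" where
  "vertical g = (THE v. v \<in> hom J (Cod J (\<chi> (Dom J g) (farr F g))) (Cod J g) \<and>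
     farr F v = Id K (fobj F (Cod J g)) \<and> v \<odot>\<^bsub>J\<^esub> \<chi> (Dom J g) (farr F g) = g)"

text \<open>The lift of \<open>farr F g\<close> is opcartesian; its property applied to
  \<open>g\<close> and to the identity of \<open>fobj F (Cod J g)\<close> gives existence and
  uniqueness, so the \<open>THE\<close> denotes.\<close>

lemma vertical [simp]:
  assumes "g \<in> Arr J"
  shows "vertical g \<in> Arr J" "Dom J (vertical g) = Cod J (\<chi> (Dom J g) (farr F g))"
    "Cod J (vertical g) = Cod J g" "farr F (vertical g) = Id K (fobj F (Cod J g))"
    "vertical g \<odot>\<^bsub>J\<^esub> \<chi> (Dom J g) (farr F g) = g"
proof -
  let ?f = "\<chi> (Dom J g) (farr F g)"
  have *: "g \<in> hom J (Dom J ?f) (Cod J g)" 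
      "Id K (fobj F (Cod J g)) \<in> hom K (fobj F (Cod J ?f)) (fobj F (Cod J g))"
      "Id K (fobj F (Cod J g)) \<odot>\<^bsub>K\<^esub> farr F ?f = farr F g" "opcartesian J K F ?f"
    using assms by (auto simp: hom_iff A.Dom_closed A.Cod_closed fobj_closed)
  then have "\<exists>!v. v \<in> hom J (Cod J ?f) (Cod J g) \<and> farr F v = Id K (fobj F (Cod J g)) \<and> v \<odot>\<^bsub>J\<^esub> ?f = g"
    unfolding opcartesian_def by blast
  from theI'[OF this] show "vertical g \<in> Arr J" "Dom J (vertical g) = Cod J ?f"
    "Cod J (vertical g) = Cod J g" "farr F (vertical g) = Id K (fobj F (Cod J g))"
    "vertical g \<odot>\<^bsub>J\<^esub> ?f = g"
    unfolding vertical_def by (auto simp: hom_iff)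
qed

text \<open>The form in which vertical parts are computed: transport of arrows between fibres and
  the inverse of \<open>total\<close> both go through it.\<close>

lemma vertical_eqI:
  assumes "X \<in> Obj J" "k \<in> Arr K" "Dom K k = fobj F X"
    and "v \<in> Arr J" "Dom J v = Cod J (\<chi> X k)" "farr F v = Id K (Cod K k)"
    and "v \<odot>\<^bsub>J\<^esub> \<chi> X k = g"
  shows "vertical g = v"
proof -
  have [simp]: "Dom J g = X" "Cod J g = Cod J v" "farr F g = k" "g \<in> Arr J"
    using assms by (auto simp: farr_Comp' simp flip: assms(7))
  have "fobj F (Cod J v) = Cod K k"
    using vertical_fobj(2)[OF assms(4) assms(6)] assms(2) B.Cod_closed by simp
  then have *: "vertical g \<in> Arr J" "Dom J (vertical g) = Cod J (\<chi> X k)"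
    "farr F (vertical g) = farr F v" "vertical g \<odot>\<^bsub>J\<^esub> \<chi> X k = v \<odot>\<^bsub>J\<^esub> \<chi> X k"
    using vertical[of g] assms(6,7) by simp_all
  show ?thesis
    by (rule lift_cancel[OF assms(1-3) *(1) assms(4) *(2) assms(5) *(3,4)])
qed

end

section \<open>Pointwise Kan extensions along split opfibrations\<close>

context split_opfib
begin

text \<open>The lift \<open>\<chi> j h\<close> is an arrow of \<open>F \<down> k\<close> from
  \<open>(j, h)\<close> to an object with second component \<open>Id K k\<close>. Hence a cocone
  over \<open>F \<down> k\<close> is determined by its legs at objects \<open>(j, Id K k)\<close>,
  that is, by a cocone over the fibre, and both cocones admit the same factorisations.\<close>

lemma fibrewise_colimit_imp_pointwise:
  assumes hom: "(F, \<eta>) \<in> diag_hom C (J, D) (K, L)" and L: "Functor K C L"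
    and fib: "fibrewise_colimit J K C F D L \<eta>" and k: "k \<in> Obj K"
  shows "is_colimit C (comma_diagram J K F D k) (fobj L k) (\<lambda>(j, h). farr L h \<odot>\<^bsub>C\<^esub> \<eta> j)"
proof -
  note d = diag_homD[OF hom]
  interpret D: Functor J C D by (rule d)
  interpret L: Functor K C L by fact
  have \<eta> [simp]: "\<eta> j \<in> Arr C" "Dom C (\<eta> j) = fobj D j" "Cod C (\<eta> j) = fobj L (fobj F j)"
    if "j \<in> Obj J" for j using d(4)[OF that] by (auto simp: hom_iff)
  have colim: "is_colimit C (fibre_diagram J K F D k) (fobj L k) \<eta>"
    using fib k by (auto simp: fibrewise_colimit_def)
  show ?thesis unfolding is_colimit_def
  proof (intro conjI allI impI, goal_cases cocone univ)
    case cocone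
    show ?case unfolding comma_cocone_iff[OF D.Functor_axioms k] using k
      by (auto simp: L.fobj_closed hom_iff L.farr_Comp' A.Cod_closed A.Dom_closed D.B.Comp_assoc d(5))
  next
    case (univ b \<kappa>)
    note \<kappa> = univ[unfolded comma_cocone_iff[OF D.Functor_axioms k]]
    have \<kappa>_hom: "\<kappa> (j, h) \<in> hom C (fobj D j) b" if "j \<in> Obj J" "h \<in> hom K (fobj F j) k" for j h
      using \<kappa> that by blast
    have \<kappa>_eq: "\<kappa> (Cod J f, h) \<odot>\<^bsub>C\<^esub> farr D f = \<kappa> (Dom J f, h \<odot>\<^bsub>K\<^esub> farr F f)"
      if "f \<in> Arr J" "h \<in> Arr K" "Dom K h = fobj F (Cod J f)" "Cod K h = k" for f h
      using \<kappa> that by (auto simp: hom_iff)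
    \<comment> \<open>Restriction of the cocone along the inclusion of the fibre, which sends
      \<open>j\<close> to \<open>(j, Id K k)\<close>.\<close>
    have "is_cocone C (fibre_diagram J K F D k) b (\<lambda>j. \<kappa> (j, Id K k))"
      unfolding fibre_cocone_iff[OF D.Functor_axioms k]
      using k \<kappa> \<kappa>_hom[of _ "Id K k"] \<kappa>_eq[of _ "Id K k"]
      by (auto simp: B.Id_hom vertical_fobj)
    then have ex1: "\<exists>!u. u \<in> hom C (fobj L k) b \<and>
        (\<forall>j\<in>Obj J. fobj F j = k \<longrightarrow> u \<odot>\<^bsub>C\<^esub> \<eta> j = \<kappa> (j, Id K k))"
      by (rule fibre_colimit_factor[OF colim])
    \<comment> \<open>The leg at an arbitrary \<open>(j, h)\<close> is reached through
      \<open>\<chi> j h\<close>: naturality of \<open>\<eta>\<close> trades \<open>farr L h\<close>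
      for \<open>D\<close> of the lift, and the cocone \<open>\<kappa>\<close> absorbs the
      lift.\<close>
    have 1: "u \<odot>\<^bsub>C\<^esub> farr L h \<odot>\<^bsub>C\<^esub> \<eta> j = \<kappa> (j, h)"
      if u: "u \<in> hom C (fobj L k) b" "\<forall>j\<in>Obj J. fobj F j = k \<longrightarrow> u \<odot>\<^bsub>C\<^esub> \<eta> j = \<kappa> (j, Id K k)"
        and jh: "j \<in> Obj J" "h \<in> hom K (fobj F j) k" for u j h
    proof -
      have h [simp]: "h \<in> Arr K" "Dom K h = fobj F j" "Cod K h = k" using jh by (auto simp: hom_iff)
      let ?f = "\<chi> j h"
      have "u \<odot>\<^bsub>C\<^esub> farr L h \<odot>\<^bsub>C\<^esub> \<eta> j = u \<odot>\<^bsub>C\<^esub> \<eta> (Cod J ?f) \<odot>\<^bsub>C\<^esub> farr D ?f"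
        using d(5)[of ?f] jh(1) by simp
      also have "\<dots> = (u \<odot>\<^bsub>C\<^esub> \<eta> (Cod J ?f)) \<odot>\<^bsub>C\<^esub> farr D ?f"
        using u(1) jh(1) by (simp add: D.B.Comp_assoc hom_iff)
      also have "u \<odot>\<^bsub>C\<^esub> \<eta> (Cod J ?f) = \<kappa> (Cod J ?f, Id K k)"
        using u(2) jh(1) by simp
      also have "\<kappa> (Cod J ?f, Id K k) \<odot>\<^bsub>C\<^esub> farr D ?f = \<kappa> (j, h)"
        using \<kappa>_eq[of ?f "Id K k"] jh(1) k by simp
      finally show ?thesis .
    qed
    have 2: "u \<odot>\<^bsub>C\<^esub> \<eta> j = \<kappa> (j, Id K k)"
      if "\<forall>x\<in>Obj (comma J K F k). u \<odot>\<^bsub>C\<^esub> (case x of (j, h) \<Rightarrow> farr L h \<odot>\<^bsub>C\<^esub> \<eta> j) = \<kappa> x"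
        "j \<in> Obj J" "fobj F j = k" for u j
      using bspec[OF that(1), of "(j, Id K k)"] that(2,3) k by (simp add: comma_def B.Id_hom L.farr_Id)
    have 3: "x \<in> Obj (comma J K F k) \<longleftrightarrow> fst x \<in> Obj J \<and> snd x \<in> hom K (fobj F (fst x)) k" for x
      by (cases x) (simp add: comma_def)
    have *: "(\<forall>j\<in>Obj J. fobj F j = k \<longrightarrow> u \<odot>\<^bsub>C\<^esub> \<eta> j = \<kappa> (j, Id K k)) \<longleftrightarrow>
        (\<forall>x\<in>Obj (comma J K F k). u \<odot>\<^bsub>C\<^esub> (case x of (j, h) \<Rightarrow> farr L h \<odot>\<^bsub>C\<^esub> \<eta> j) = \<kappa> x)"
      (is "?A u \<longleftrightarrow> ?B u") if u: "u \<in> hom C (fobj L k) b" for u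
    proof
      show "?A u" if "?B u" using 2[OF that] by simp
      show "?B u" if "?A u"
      proof
        fix x assume "x \<in> Obj (comma J K F k)"
        with 1[OF u that, of "fst x" "snd x"] 3[of x]
        show "u \<odot>\<^bsub>C\<^esub> (case x of (j, h) \<Rightarrow> farr L h \<odot>\<^bsub>C\<^esub> \<eta> j) = \<kappa> x"
          by (simp add: case_prod_beta)
      qed
    qed
    show ?case
      unfolding comma_diagram_def fst_conv by (rule ex1_conj_cong[OF ex1 *])
  qed
qed

text \<open>The component at \<open>k\<close> is the map induced by \<open>\<gamma>\<close> on the
  colimit over the fibre. Naturality at \<open>l\<close> is an equation of arrows out of
  \<open>fobj L (Dom K l)\<close>, so it can be tested on \<open>\<eta> j\<close> for
  \<open>j\<close> over \<open>Dom K l\<close>; the lift \<open>\<chi> j l\<close> carries the test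
  to the fibre over \<open>Cod K l\<close>.\<close>

lemma fibrewise_colimit_imp_left_kan:
  assumes hom: "(F, \<eta>) \<in> diag_hom C (J, D) (K, L)" and L: "Functor K C L"
    and fib: "fibrewise_colimit J K C F D L \<eta>"
  shows "is_left_kan J K C F D L \<eta>"
  unfolding is_left_kan_def
proof (intro conjI allI impI)
  note d = diag_homD[OF hom]
  interpret D: Functor J C D by (rule d)
  interpret L: Functor K C L by fact
  have \<eta> [simp]: "\<eta> j \<in> Arr C" "Dom C (\<eta> j) = fobj D j" "Cod C (\<eta> j) = fobj L (fobj F j)"
    if "j \<in> Obj J" for j using d(4)[OF that] by (auto simp: hom_iff)
  show "Functor J K F" "Functor K C L" "nat_trans J C D (func_comp J L F) \<eta>"
    using hom L by (auto simp: diag_hom_iff)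
  fix G \<gamma>
  assume "Functor K C G" "nat_trans J C D (func_comp J G F) \<gamma>"
  then have \<gamma>_hom: "(F, \<gamma>) \<in> diag_hom C (J, D) (K, G)" using Functor_axioms by (simp add: diag_hom_iff)
  note g = diag_homD[OF this]
  interpret G: Functor K C G by fact
  have \<gamma> [simp]: "\<gamma> j \<in> Arr C" "Dom C (\<gamma> j) = fobj D j" "Cod C (\<gamma> j) = fobj G (fobj F j)"
    if "j \<in> Obj J" for j using g(4)[OF that] by (auto simp: hom_iff)
  have ex1: "\<exists>!u. u \<in> hom C (fobj L k) (fobj G k) \<and>
      (\<forall>j\<in>Obj J. fobj F j = k \<longrightarrow> u \<odot>\<^bsub>C\<^esub> \<eta> j = \<gamma> j)" if k: "k \<in> Obj K" for k
  proof -
    have "is_cocone C (fibre_diagram J K F D k) (fobj G k) \<gamma>"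
      by (rule fibre_cocone[OF \<gamma>_hom \<open>Functor K C G\<close> k])
    moreover have "is_colimit C (fibre_diagram J K F D k) (fobj L k) \<eta>"
      using fib k by (simp add: fibrewise_colimit_def)
    ultimately show ?thesis by (rule fibre_colimit_factor[rotated])
  qed
  have uniq: "u = v" if k: "k \<in> Obj K" and "u \<in> hom C (fobj L k) b" "v \<in> hom C (fobj L k) b"
    "\<And>j. j \<in> Obj J \<Longrightarrow> fobj F j = k \<Longrightarrow> u \<odot>\<^bsub>C\<^esub> \<eta> j = v \<odot>\<^bsub>C\<^esub> \<eta> j" for k b u v
  proof (rule colimit_cancel)
    show "is_colimit C (fibre J K F k, snd (fibre_diagram J K F D k)) (fobj L k) \<eta>"
      using fib k by (simp add: fibrewise_colimit_def fibre_diagram_def)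
  qed (use that in auto)
  define \<alpha> where "\<alpha> = (\<lambda>k\<in>Obj K. THE u. u \<in> hom C (fobj L k) (fobj G k) \<and>
      (\<forall>j\<in>Obj J. fobj F j = k \<longrightarrow> u \<odot>\<^bsub>C\<^esub> \<eta> j = \<gamma> j))"
  have \<alpha>_hom: "\<alpha> k \<in> hom C (fobj L k) (fobj G k)"
    and \<alpha>_eq: "\<And>j. j \<in> Obj J \<Longrightarrow> fobj F j = k \<Longrightarrow> \<alpha> k \<odot>\<^bsub>C\<^esub> \<eta> j = \<gamma> j" if "k \<in> Obj K" for k
    using theI'[OF ex1[OF that]] that by (auto simp: \<alpha>_def)
  have [simp]: "\<alpha> k \<in> Arr C" "Dom C (\<alpha> k) = fobj L k" "Cod C (\<alpha> k) = fobj G k" if "k \<in> Obj K" for k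
    using \<alpha>_hom[OF that] by (auto simp: hom_iff)
  have nat: "nat_trans K C L G \<alpha>"
  proof (rule nat_transI)
    fix l assume l: "l \<in> Arr K"
    have kk: "Dom K l \<in> Obj K" "Cod K l \<in> Obj K" using l by (auto simp: B.Dom_closed B.Cod_closed)
    show "\<alpha> (Cod K l) \<odot>\<^bsub>C\<^esub> farr L l = farr G l \<odot>\<^bsub>C\<^esub> \<alpha> (Dom K l)"
    proof (rule uniq)
      fix j assume j: "j \<in> Obj J" "fobj F j = Dom K l"
      let ?f = "\<chi> j l"
      have f: "?f \<in> Arr J" "Dom J ?f = j" "farr F ?f = l" "Cod J ?f \<in> Obj J" "fobj F (Cod J ?f) = Cod K l"
        using j l by auto
      have "(\<alpha> (Cod K l) \<odot>\<^bsub>C\<^esub> farr L l) \<odot>\<^bsub>C\<^esub> \<eta> j = \<alpha> (Cod K l) \<odot>\<^bsub>C\<^esub> farr L l \<odot>\<^bsub>C\<^esub> \<eta> j"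
        using l j kk by (simp add: D.B.Comp_assoc)
      also have "\<dots> = \<alpha> (Cod K l) \<odot>\<^bsub>C\<^esub> \<eta> (Cod J ?f) \<odot>\<^bsub>C\<^esub> farr D ?f"
        using d(5)[of ?f] f by simp
      also have "\<dots> = (\<alpha> (Cod K l) \<odot>\<^bsub>C\<^esub> \<eta> (Cod J ?f)) \<odot>\<^bsub>C\<^esub> farr D ?f"
        using f kk by (simp add: D.B.Comp_assoc)
      also have "\<dots> = \<gamma> (Cod J ?f) \<odot>\<^bsub>C\<^esub> farr D ?f"
        using \<alpha>_eq f kk by simp
      also have "\<dots> = farr G l \<odot>\<^bsub>C\<^esub> \<gamma> j"
        using g(5)[of ?f] f by simp
      also have "\<dots> = farr G l \<odot>\<^bsub>C\<^esub> \<alpha> (Dom K l) \<odot>\<^bsub>C\<^esub> \<eta> j"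
        using \<alpha>_eq j kk by simp
      finally show "(\<alpha> (Cod K l) \<odot>\<^bsub>C\<^esub> farr L l) \<odot>\<^bsub>C\<^esub> \<eta> j = (farr G l \<odot>\<^bsub>C\<^esub> \<alpha> (Dom K l)) \<odot>\<^bsub>C\<^esub> \<eta> j"
        using l j kk by (simp add: D.B.Comp_assoc)
    qed (use l kk in \<open>auto simp: hom_iff\<close>)
  qed (use L \<open>Functor K C G\<close> \<alpha>_hom in \<open>auto simp: \<alpha>_def\<close>)
  show "\<exists>!\<alpha>. nat_trans K C L G \<alpha> \<and> (\<forall>j\<in>Obj J. \<alpha> (fobj F j) \<odot>\<^bsub>C\<^esub> \<eta> j = \<gamma> j)"
  proof (rule ex1I[of _ \<alpha>])
    show "nat_trans K C L G \<alpha> \<and> (\<forall>j\<in>Obj J. \<alpha> (fobj F j) \<odot>\<^bsub>C\<^esub> \<eta> j = \<gamma> j)"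
      using nat \<alpha>_eq fobj_closed by auto
    fix \<beta> assume \<beta>: "nat_trans K C L G \<beta> \<and> (\<forall>j\<in>Obj J. \<beta> (fobj F j) \<odot>\<^bsub>C\<^esub> \<eta> j = \<gamma> j)"
    show "\<beta> = \<alpha>"
    proof (rule extensionalityI[of _ "Obj K"])
      \<comment> \<open>This covers objects with an empty fibre as well: there
        \<open>fobj L k\<close> is initial, and \<open>uniq\<close> leaves no equation to
        check.\<close>
      fix k assume k: "k \<in> Obj K"
      show "\<beta> k = \<alpha> k"
        by (rule uniq[OF k _ \<alpha>_hom[OF k]]) 
          (use \<beta> k \<alpha>_eq in \<open>auto dest: nat_trans.component_hom\<close>)
    qed (use \<beta> nat in \<open>auto dest: nat_trans.component_ext\<close>)
  qed
qed

text \<open>The fibre over \<open>k\<close> is final in the comma category \<open>F \<down> k\<close>: its inclusion has a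
  left adjoint, which sends \<open>(j, h)\<close> to the codomain of the lift of \<open>h\<close>.\<close>

lemma pointwise_imp_fibrewise_colimit:
  assumes kan: "is_pointwise_left_kan J K C F D L \<eta>"
  shows "fibrewise_colimit J K C F D L \<eta>"
  unfolding fibrewise_colimit_def
proof
  fix k assume k: "k \<in> Obj K"
  have L: "Functor K C L" and hom: "(F, \<eta>) \<in> diag_hom C (J, D) (K, L)"
    using kan Functor_axioms by (auto simp: is_pointwise_left_kan_def is_left_kan_def diag_hom_iff)
  note d = diag_homD[OF hom]
  interpret D: Functor J C D by (rule d)
  interpret L: Functor K C L by fact
  have \<eta> [simp]: "\<eta> j \<in> Arr C" "Dom C (\<eta> j) = fobj D j" "Cod C (\<eta> j) = fobj L (fobj F j)"
    if "j \<in> Obj J" for j using d(4)[OF that] by (auto simp: hom_iff)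
  have colim: "is_colimit C (comma_diagram J K F D k) (fobj L k) (\<lambda>(j, h). farr L h \<odot>\<^bsub>C\<^esub> \<eta> j)"
    using kan k by (auto simp: is_pointwise_left_kan_def)
  show "is_colimit C (fibre_diagram J K F D k) (fobj L k) \<eta>"
    unfolding fibre_colimit_iff
  proof (intro conjI allI impI)
    show "is_cocone C (fibre_diagram J K F D k) (fobj L k) \<eta>"
      by (rule fibre_cocone[OF hom L k])
    fix b \<kappa> assume "is_cocone C (fibre_diagram J K F D k) b \<kappa>"
    note \<kappa> = this[unfolded fibre_cocone_iff[OF D.Functor_axioms k]]
    have \<kappa>_closed [simp]: "\<kappa> j \<in> Arr C" "Dom C (\<kappa> j) = fobj D j" "Cod C (\<kappa> j) = b"
      if "j \<in> Obj J" "fobj F j = k" for j using \<kappa> that by (auto simp: hom_iff)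
    have \<kappa>_eq: "\<kappa> (Cod J f) \<odot>\<^bsub>C\<^esub> farr D f = \<kappa> (Dom J f)" if "f \<in> Arr J" "farr F f = Id K k" for f
      using \<kappa> that by auto
    \<comment> \<open>The fibre cocone extended to \<open>F \<down> k\<close> along the left
      adjoint: each \<open>(j, h)\<close> enters the fibre through its lift.\<close>
    define \<kappa>' where "\<kappa>' = (\<lambda>(j, h). \<kappa> (Cod J (\<chi> j h)) \<odot>\<^bsub>C\<^esub> farr D (\<chi> j h))"
    have "is_cocone C (comma_diagram J K F D k) b \<kappa>'"
      unfolding comma_cocone_iff[OF D.Functor_axioms k]
    proof (intro conjI ballI)
      show "b \<in> Obj C" using \<kappa> by simp
      show "\<kappa>' (j, h) \<in> hom C (fobj D j) b" if "j \<in> Obj J" "h \<in> hom K (fobj F j) k" for j h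
        using that by (auto simp: \<kappa>'_def hom_iff)
      fix f h assume fh: "f \<in> Arr J" "h \<in> hom K (fobj F (Cod J f)) k"
      then have h [simp]: "h \<in> Arr K" "Dom K h = fobj F (Cod J f)" "Cod K h = k" by (auto simp: hom_iff)
      note [simp] = A.Cod_closed A.Dom_closed
      let ?l = "\<chi> (Cod J f) h"
      \<comment> \<open>Compares the lift of \<open>h\<close> at the codomain of \<open>f\<close>,
        precomposed with \<open>f\<close>, with the lift of the composite at the domain of
        \<open>f\<close>. Both lie over the same arrow, so they differ by the vertical part of
        \<open>g\<close>, an arrow of the fibre over \<open>k\<close>, which \<open>\<kappa>\<close>
        absorbs.\<close>
      define g where "g = ?l \<odot>\<^bsub>J\<^esub> f"
      have g [simp]: "g \<in> Arr J" "farr F g = h \<odot>\<^bsub>K\<^esub> farr F f" "Dom J g = Dom J f" "Cod J g = Cod J ?l"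
        using fh by (auto simp: g_def farr_Comp')
      have "\<kappa> (Cod J ?l) \<odot>\<^bsub>C\<^esub> farr D g = \<kappa> (Cod J ?l) \<odot>\<^bsub>C\<^esub> farr D (vertical g \<odot>\<^bsub>J\<^esub> \<chi> (Dom J g) (farr F g))"
        by (simp only: vertical(5)[OF g(1)])
      also have "\<dots> = (\<kappa> (Cod J (vertical g)) \<odot>\<^bsub>C\<^esub> farr D (vertical g)) \<odot>\<^bsub>C\<^esub> farr D (\<chi> (Dom J g) (farr F g))"
        using fh by (simp add: D.farr_Comp' D.B.Comp_assoc)
      also have "\<dots> = \<kappa>' (Dom J f, h \<odot>\<^bsub>K\<^esub> farr F f)"
        using fh by (subst \<kappa>_eq) (auto simp: \<kappa>'_def)
      finally show "\<kappa>' (Cod J f, h) \<odot>\<^bsub>C\<^esub> farr D f = \<kappa>' (Dom J f, h \<odot>\<^bsub>K\<^esub> farr F f)"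
        using fh by (simp add: \<kappa>'_def g_def D.farr_Comp' D.B.Comp_assoc)
    qed
    then have ex1: "\<exists>!u. u \<in> hom C (fobj L k) b \<and> (\<forall>(j, h)\<in>Obj (comma J K F k).
      u \<odot>\<^bsub>C\<^esub> farr L h \<odot>\<^bsub>C\<^esub> \<eta> j = \<kappa>' (j, h))"
      using colimit_factor[OF colim[unfolded comma_diagram_def]]
      by (simp add: comma_diagram_def case_prod_beta)
    \<comment> \<open>From left to right take \<open>h\<close> to be \<open>Id K k\<close>, whose
      chosen lift is an identity; conversely use naturality of \<open>\<eta>\<close> at the lift of
      \<open>h\<close>.\<close>
    have "(\<forall>(j, h)\<in>Obj (comma J K F k). u \<odot>\<^bsub>C\<^esub> farr L h \<odot>\<^bsub>C\<^esub> \<eta> j = \<kappa>' (j, h)) \<longleftrightarrow>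
      (\<forall>j\<in>Obj J. fobj F j = k \<longrightarrow> u \<odot>\<^bsub>C\<^esub> \<eta> j = \<kappa> j)" if u: "u \<in> hom C (fobj L k) b" for u
    proof (intro iffI ballI impI)
      fix j assume a: "\<forall>(j, h)\<in>Obj (comma J K F k). u \<odot>\<^bsub>C\<^esub> farr L h \<odot>\<^bsub>C\<^esub> \<eta> j = \<kappa>' (j, h)"
        and j: "j \<in> Obj J" "fobj F j = k"
      then have "(j, Id K k) \<in> Obj (comma J K F k)" "\<kappa>' (j, Id K k) = \<kappa> j"
        using k lift_Id[OF j(1)] by (auto simp: comma_simps B.Id_hom \<kappa>'_def D.farr_Id)
      then show "u \<odot>\<^bsub>C\<^esub> \<eta> j = \<kappa> j"
        using bspec[OF a, of "(j, Id K k)"] j k by (simp add: L.farr_Id)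
    next
      fix x assume a: "\<forall>j\<in>Obj J. fobj F j = k \<longrightarrow> u \<odot>\<^bsub>C\<^esub> \<eta> j = \<kappa> j" and "x \<in> Obj (comma J K F k)"
      then obtain j h where x: "x = (j, h)" "j \<in> Obj J" "h \<in> Arr K" "Dom K h = fobj F j" "Cod K h = k"
        by (auto simp: comma_def hom_iff)
      have "u \<odot>\<^bsub>C\<^esub> farr L h \<odot>\<^bsub>C\<^esub> \<eta> j = (u \<odot>\<^bsub>C\<^esub> \<eta> (Cod J (\<chi> j h))) \<odot>\<^bsub>C\<^esub> farr D (\<chi> j h)"
        using d(5)[of "\<chi> j h"] x u by (simp add: D.B.Comp_assoc hom_iff)
      then show "case x of (j, h) \<Rightarrow> u \<odot>\<^bsub>C\<^esub> farr L h \<odot>\<^bsub>C\<^esub> \<eta> j = \<kappa>' (j, h)"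
        using x a by (simp add: \<kappa>'_def)
    qed
    then show "\<exists>!u. u \<in> hom C (fobj L k) b \<and> (\<forall>j\<in>Obj J. fobj F j = k \<longrightarrow> u \<odot>\<^bsub>C\<^esub> \<eta> j = \<kappa> j)"
      by (rule ex1_conj_cong[OF ex1])
  qed
qed

end

section \<open>The Grothendieck construction\<close>

text \<open>A strict functor from \<open>\<I>\<close> to Cat, given by its two actions. The
  equations in \<open>T_Id\<close> and \<open>T_Comp\<close> are the intended ones because functors
  are extensional.\<close>

locale strict_indexed = I: category \<I>
  for \<I> :: "('i, 'k) cat" and P :: "'i \<Rightarrow> ('x, 'y) cat" and T :: "'k \<Rightarrow> ('x, 'y, 'x, 'y) func" +
  assumes P_category: "i \<in> Obj \<I> \<Longrightarrow> category (P i)"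
    and T_Functor: "l \<in> hom \<I> i i' \<Longrightarrow> Functor (P i) (P i') (T l)"
    and T_Id: "i \<in> Obj \<I> \<Longrightarrow> T (Id \<I> i) = func_id (P i)"
    and T_Comp: "l \<in> hom \<I> i i' \<Longrightarrow> l' \<in> hom \<I> i' i'' \<Longrightarrow>
      T (l' \<odot>\<^bsub>\<I>\<^esub> l) = func_comp (P i) (T l') (T l)"

abbreviation arr_base :: "'a \<times> ('k \<times> 'y) \<times> 'b \<Rightarrow> 'k" where
  "arr_base a \<equiv> fst (fst (snd a))"

abbreviation arr_fibre :: "'a \<times> ('k \<times> 'y) \<times> 'b \<Rightarrow> 'y" where
  "arr_fibre a \<equiv> snd (fst (snd a))"

lemma grothendieck_simps:
  "x \<in> Obj (grothendieck \<I> P T) \<longleftrightarrow> fst x \<in> Obj \<I> \<and> snd x \<in> Obj (P (fst x))"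
  "a \<in> Arr (grothendieck \<I> P T) \<longleftrightarrow>
    fst a \<in> Obj (grothendieck \<I> P T) \<and> snd (snd a) \<in> Obj (grothendieck \<I> P T) \<and>
    arr_base a \<in> hom \<I> (fst (fst a)) (fst (snd (snd a))) \<and>
    arr_fibre a \<in> hom (P (fst (snd (snd a)))) (fobj (T (arr_base a)) (snd (fst a))) (snd (snd (snd a)))"
  "Dom (grothendieck \<I> P T) a = fst a" "Cod (grothendieck \<I> P T) a = snd (snd a)"
  "Id (grothendieck \<I> P T) x = (x, (Id \<I> (fst x), Id (P (fst x)) (snd x)), x)"
  "Comp (grothendieck \<I> P T) b a =
    (fst a, (arr_base b \<odot>\<^bsub>\<I>\<^esub> arr_base a,
      arr_fibre b \<odot>\<^bsub>P (fst (snd (snd b)))\<^esub> farr (T (arr_base b)) (arr_fibre a)), snd (snd b))"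
  by (cases x; cases a; cases b; auto simp: grothendieck_def)+

definition grothendieck_proj where
  "grothendieck_proj \<I> P T =
    \<lparr>fobj = (\<lambda>x\<in>Obj (grothendieck \<I> P T). fst x),
     farr = (\<lambda>a\<in>Arr (grothendieck \<I> P T). arr_base a)\<rparr>"

text \<open>The canonical cleavage: the lift of \<open>k\<close> moves the fibre object by
  \<open>T k\<close> and has an identity as its fibre component.\<close>

definition grothendieck_lift where
  "grothendieck_lift \<I> P T x k =
    (let y = (Cod \<I> k, fobj (T k) (snd x)) in (x, (k, Id (P (fst y)) (snd y)), y))"

context strict_indexed
begin

abbreviation G where "G \<equiv> grothendieck \<I> P T"

lemma T_Id_simps [simp]:
  assumes "i \<in> Obj \<I>"
  shows "X \<in> Obj (P i) \<Longrightarrow> fobj (T (Id \<I> i)) X = X" "f \<in> Arr (P i) \<Longrightarrow> farr (T (Id \<I> i)) f = f"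
  using assms by (simp_all add: T_Id)

lemma T_Comp_simps:
  assumes "l \<in> hom \<I> i i'" "l' \<in> hom \<I> i' i''"
  shows "X \<in> Obj (P i) \<Longrightarrow> fobj (T (l' \<odot>\<^bsub>\<I>\<^esub> l)) X = fobj (T l') (fobj (T l) X)"
    "f \<in> Arr (P i) \<Longrightarrow> farr (T (l' \<odot>\<^bsub>\<I>\<^esub> l)) f = farr (T l') (farr (T l) f)"
  using T_Comp[OF assms] by simp_all

lemma category_grothendieck: "category G"
proof (unfold_locales, goal_cases)
  case (1 f)
  then show ?case by (simp add: grothendieck_simps(2-))
next
  case (2 f)
  then show ?case by (simp add: grothendieck_simps(2-))
next
  case (3 x)
  then interpret P: category "P (fst x)" by (intro P_category) (simp add: grothendieck_simps)
  from 3 show ?case by (simp add: hom_iff grothendieck_simps)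
next
  case (4 a X Y b Z)
  then have a: "arr_base a \<in> hom \<I> (fst X) (fst Y)"
      "arr_fibre a \<in> hom (P (fst Y)) (fobj (T (arr_base a)) (snd X)) (snd Y)" "fst a = X"
    and b: "arr_base b \<in> hom \<I> (fst Y) (fst Z)"
      "arr_fibre b \<in> hom (P (fst Z)) (fobj (T (arr_base b)) (snd Y)) (snd Z)" "snd (snd b) = Z"
    and XZ: "X \<in> Obj G" "Z \<in> Obj G" "snd X \<in> Obj (P (fst X))"
    by (auto simp: hom_iff[of _ G] grothendieck_simps(2-4)) (simp add: grothendieck_simps(1))
  interpret Tb: Functor "P (fst Y)" "P (fst Z)" "T (arr_base b)" by (rule T_Functor[OF b(1)])
  show ?case
    using XZ a b I.Comp_hom[OF a(1) b(1)] Tb.B.Comp_hom[OF Tb.farr_hom[OF a(2)] b(2)]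
    by (simp add: hom_iff[of _ G] grothendieck_simps(2-) T_Comp_simps[OF a(1) b(1)])
next
  case (5 a X Y)
  then have a: "arr_base a \<in> hom \<I> (fst X) (fst Y)"
      "arr_fibre a \<in> hom (P (fst Y)) (fobj (T (arr_base a)) (snd X)) (snd Y)" "fst a = X" "snd (snd a) = Y"
    and X: "snd X \<in> Obj (P (fst X))"
    by (auto simp: hom_iff[of _ G] grothendieck_simps(2-4)) (simp add: grothendieck_simps(1))
  interpret Ta: Functor "P (fst X)" "P (fst Y)" "T (arr_base a)" by (rule T_Functor[OF a(1)])
  show ?case
    using a(3,4) I.Id_right[OF a(1)] Ta.B.Id_right[OF a(2)] Ta.farr_Id[OF X]
    by (simp add: grothendieck_simps(5,6) prod_eq_iff)
next
  case (6 a X Y)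
  then have a: "arr_base a \<in> hom \<I> (fst X) (fst Y)"
      "arr_fibre a \<in> hom (P (fst Y)) (fobj (T (arr_base a)) (snd X)) (snd Y)" "fst a = X" "snd (snd a) = Y"
    and Y: "fst Y \<in> Obj \<I>"
    by (auto simp: hom_iff[of _ G] grothendieck_simps(2-4)) (simp add: grothendieck_simps(1))
  interpret P: category "P (fst Y)" by (rule P_category[OF Y])
  have "arr_fibre a \<in> Arr (P (fst Y))" using a(2) by (simp add: hom_iff)
  then show ?case
    using a(3,4) I.Id_left[OF a(1)] P.Id_left[OF a(2)] Y
    by (simp add: grothendieck_simps(5,6) prod_eq_iff)
next
  \<comment> \<open>Associativity needs strictness twice: the functor of \<open>d\<close> preserves
    the composite formed in the fibre, and \<open>T\<close> preserves the composite of the base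
    arrows of \<open>b\<close> and \<open>d\<close>.\<close>
  case (7 a W X b Y d Z)
  then have a: "arr_base a \<in> hom \<I> (fst W) (fst X)"
      "arr_fibre a \<in> hom (P (fst X)) (fobj (T (arr_base a)) (snd W)) (snd X)"
    and b: "arr_base b \<in> hom \<I> (fst X) (fst Y)"
      "arr_fibre b \<in> hom (P (fst Y)) (fobj (T (arr_base b)) (snd X)) (snd Y)" "snd (snd b) = Y"
    and d: "arr_base d \<in> hom \<I> (fst Y) (fst Z)"
      "arr_fibre d \<in> hom (P (fst Z)) (fobj (T (arr_base d)) (snd Y)) (snd Z)" "snd (snd d) = Z"
    by (auto simp: hom_iff[of _ G] grothendieck_simps(2-4))
  interpret Tb: Functor "P (fst X)" "P (fst Y)" "T (arr_base b)" by (rule T_Functor[OF b(1)])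
  interpret Td: Functor "P (fst Y)" "P (fst Z)" "T (arr_base d)" by (rule T_Functor[OF d(1)])
  have "arr_fibre a \<in> Arr (P (fst X))" using a(2) by (simp add: hom_iff)
  then have eq: "farr (T (arr_base d \<odot>\<^bsub>\<I>\<^esub> arr_base b)) (arr_fibre a) =
      farr (T (arr_base d)) (farr (T (arr_base b)) (arr_fibre a))"
    by (rule T_Comp_simps(2)[OF b(1) d(1)])
  note h = Tb.farr_hom[OF a(2)]
  show ?case
    using b(3) d(3) I.assoc[OF a(1) b(1) d(1)]
    by (simp add: grothendieck_simps(6) eq Td.farr_Comp[OF h b(2)]
      Td.B.assoc[OF Td.farr_hom[OF h] Td.farr_hom[OF b(2)] d(2)])
qed

sublocale G: category G by (rule category_grothendieck)

lemma Functor_grothendieck_proj: "Functor G \<I> (grothendieck_proj \<I> P T)"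
proof (unfold_locales, goal_cases)
  case (4 f X Y)
  then have f: "f \<in> Arr G" "X \<in> Obj G" "Y \<in> Obj G" using G.hom_Obj[OF 4] by (auto simp: hom_iff)
  from 4 have "arr_base f \<in> hom \<I> (fst X) (fst Y)"
    by (auto simp: hom_iff[of _ G] grothendieck_simps(2-4))
  with f show ?case by (simp add: grothendieck_proj_def)
next
  case (6 f X Y g Z)
  then have "f \<in> Arr G" "g \<in> Arr G" "g \<odot>\<^bsub>G\<^esub> f \<in> Arr G"
    using G.Comp_hom[OF 6] by (auto simp: hom_iff)
  then show ?case by (simp add: grothendieck_proj_def) (simp add: grothendieck_simps(6))
next
  case (5 X)
  then show ?case using G.Id_closed(1)[OF 5]
    by (simp add: grothendieck_proj_def) (simp add: grothendieck_simps(5))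
qed (auto simp: grothendieck_proj_def grothendieck_simps(1))

sublocale \<pi>: Functor G \<I> "grothendieck_proj \<I> P T" by (rule Functor_grothendieck_proj)

lemma proj_simps [simp]:
  "x \<in> Obj G \<Longrightarrow> fobj (grothendieck_proj \<I> P T) x = fst x"
  "a \<in> Arr G \<Longrightarrow> farr (grothendieck_proj \<I> P T) a = arr_base a"
  by (simp_all add: grothendieck_proj_def)

text \<open>Precomposition with a lift leaves fibre components unchanged, because \<open>T h\<close>
  preserves the identity that the lift carries. A factorisation of \<open>g\<close> over
  \<open>h\<close> must therefore have base \<open>h\<close> and the fibre component of
  \<open>g\<close>, and this is well typed since \<open>T\<close> turns the composite of
  \<open>k\<close> and \<open>h\<close> into the composite of \<open>T k\<close> and
  \<open>T h\<close>. The strict laws of the lifts are those of \<open>T\<close>.\<close>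

lemma is_splitting_grothendieck:
  "is_splitting G \<I> (grothendieck_proj \<I> P T) (grothendieck_lift \<I> P T)"
proof -
  have lift: "grothendieck_lift \<I> P T x k =
      (x, (k, Id (P i) (fobj (T k) (snd x))), (i, fobj (T k) (snd x)))"
    if "k \<in> hom \<I> (fst x) i" for x k i
    using that by (auto simp: grothendieck_lift_def hom_iff)
  have lift_Arr: "grothendieck_lift \<I> P T x k \<in> Arr G"
    if "x \<in> Obj G" "k \<in> hom \<I> (fst x) i" for x k i
  proof -
    interpret Tk: Functor "P (fst x)" "P i" "T k" by (rule T_Functor[OF that(2)])
    show ?thesis
      using that I.hom_Obj[OF that(2)] Tk.fobj_closed[of "snd x"] Tk.B.Id_hom
      by (simp add: lift[OF that(2)] grothendieck_simps)
  qed
  have opc: "opcartesian G \<I> (grothendieck_proj \<I> P T) (grothendieck_lift \<I> P T x k)"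
    if x: "x \<in> Obj G" and k: "k \<in> hom \<I> (fst x) i" for x k i
    unfolding opcartesian_def
  proof (intro conjI allI ballI impI)
    interpret Tk: Functor "P (fst x)" "P i" "T k" by (rule T_Functor[OF k])
    let ?y = "(i, fobj (T k) (snd x))" and ?f = "grothendieck_lift \<I> P T x k"
    have X: "snd x \<in> Obj (P (fst x))" using x by (simp add: grothendieck_simps(1))
    have f: "?f \<in> Arr G" "Dom G ?f = x" "Cod G ?f = ?y"
      using lift_Arr[OF x k] by (auto simp: grothendieck_simps(3,4) lift[OF k])
    then have y: "?y \<in> Obj G" using G.Cod_closed[of ?f] by simp
    show "?f \<in> Arr G" by (rule f)
    fix z g h
    assume g: "g \<in> hom G (Dom G ?f) z"
      and h: "h \<in> hom \<I> (fobj (grothendieck_proj \<I> P T) (Cod G ?f)) (fobj (grothendieck_proj \<I> P T) z)"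
      and eq: "h \<odot>\<^bsub>\<I>\<^esub> farr (grothendieck_proj \<I> P T) ?f = farr (grothendieck_proj \<I> P T) g"
    from g have g': "g \<in> Arr G" "fst g = x" "snd (snd g) = z" and z: "z \<in> Obj G"
      using G.hom_Obj[OF g] f(2) by (auto simp: hom_iff grothendieck_simps(3,4))
    have h': "h \<in> hom \<I> i (fst z)" using h f(3) y z by simp
    have hk: "arr_base g = h \<odot>\<^bsub>\<I>\<^esub> k" using eq f(1) g'(1) by (simp add: lift[OF k])
    have gf: "arr_fibre g \<in> hom (P (fst z)) (fobj (T h) (fobj (T k) (snd x))) (snd z)"
      using g' unfolding grothendieck_simps(2) by (simp add: hk T_Comp_simps[OF k h'] X)
    interpret Th: Functor "P i" "P (fst z)" "T h" by (rule T_Functor[OF h'])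
    have comp: "v \<odot>\<^bsub>G\<^esub> ?f = (x, (arr_base v \<odot>\<^bsub>\<I>\<^esub> k, arr_fibre v), z)"
      if "snd (snd v) = z" "arr_base v = h"
        "arr_fibre v \<in> hom (P (fst z)) (fobj (T h) (fobj (T k) (snd x))) (snd z)" for v
      using that Th.B.Id_right[OF that(3)]
      by (simp add: grothendieck_simps(6) lift[OF k] Th.farr_Id Tk.fobj_closed X)
    let ?h = "(?y, (h, arr_fibre g), z)"
    show "\<exists>!h'. h' \<in> hom G (Cod G ?f) z \<and> farr (grothendieck_proj \<I> P T) h' = h \<and> h' \<odot>\<^bsub>G\<^esub> ?f = g"
    proof (rule ex1I)
      have h_Arr: "?h \<in> Arr G" using y z h' gf by (simp add: grothendieck_simps(2))
      then show "?h \<in> hom G (Cod G ?f) z \<and> farr (grothendieck_proj \<I> P T) ?h = h \<and> ?h \<odot>\<^bsub>G\<^esub> ?f = g"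
        using comp[of ?h] gf g' hk f(3)
        by (simp add: hom_iff[of _ G] grothendieck_simps(3,4) prod_eq_iff)
    next
      fix v assume v: "v \<in> hom G (Cod G ?f) z \<and> farr (grothendieck_proj \<I> P T) v = h \<and> v \<odot>\<^bsub>G\<^esub> ?f = g"
      then have v': "v \<in> Arr G" "fst v = ?y" "snd (snd v) = z" "arr_base v = h"
        using f(3) by (auto simp: hom_iff[of _ G] grothendieck_simps(3,4))
      then have "arr_fibre v \<in> hom (P (fst z)) (fobj (T h) (fobj (T k) (snd x))) (snd z)"
        unfolding grothendieck_simps(2) by simp
      from comp[OF v'(3,4) this] v have "arr_fibre v = arr_fibre g" by auto
      with v' show "v = ?h" by (simp add: prod_eq_iff)
    qed
  qed
  show ?thesis unfolding is_splitting_def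
  proof (intro conjI ballI allI)
    fix x assume x: "x \<in> Obj G"
    then have X: "fst x \<in> Obj \<I>" "snd x \<in> Obj (P (fst x))" by (simp_all add: grothendieck_simps(1))
    show "grothendieck_lift \<I> P T x (Id \<I> (fobj (grothendieck_proj \<I> P T) x)) = Id G x"
      using x lift[OF I.Id_hom[OF X(1)]] X by (simp add: grothendieck_simps(5))
    fix i k assume k: "k \<in> hom \<I> (fobj (grothendieck_proj \<I> P T) x) i"
    then have k: "k \<in> hom \<I> (fst x) i" using x by simp
    interpret Tk: Functor "P (fst x)" "P i" "T k" by (rule T_Functor[OF k])
    show "grothendieck_lift \<I> P T x k \<in> Arr G" "Dom G (grothendieck_lift \<I> P T x k) = x"
      "farr (grothendieck_proj \<I> P T) (grothendieck_lift \<I> P T x k) = k"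
      "opcartesian G \<I> (grothendieck_proj \<I> P T) (grothendieck_lift \<I> P T x k)"
      using lift_Arr[OF x k] opc[OF x k] by (simp_all add: lift[OF k] grothendieck_simps(3))
    fix j l assume l: "l \<in> hom \<I> i j"
    interpret Tl: Functor "P i" "P j" "T l" by (rule T_Functor[OF l])
    have 1: "l \<in> hom \<I> (fst (Cod G (grothendieck_lift \<I> P T x k))) j"
      using l by (simp add: lift[OF k] grothendieck_simps(4))
    have Y: "fobj (T k) (snd x) \<in> Obj (P i)" using X by (simp add: Tk.fobj_closed)
    show "grothendieck_lift \<I> P T x (l \<odot>\<^bsub>\<I>\<^esub> k) =
      grothendieck_lift \<I> P T (Cod G (grothendieck_lift \<I> P T x k)) l \<odot>\<^bsub>G\<^esub> grothendieck_lift \<I> P T x k"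
      unfolding lift[OF 1] lift[OF I.Comp_hom[OF k l]]
      using Tl.fobj_closed[OF Y] Tl.farr_Id[OF Y]
      by (simp add: lift[OF k] grothendieck_simps(4,6) T_Comp_simps[OF k l] X)
  qed
qed

end

section \<open>Invariance under isomorphism\<close>

locale inverse_functors = R: Functor J J' R + R': Functor J' J R'
  for J :: "('i, 'j) cat" and J' :: "('i2, 'j2) cat" and R R' +
  assumes inv_fobj [simp]: "X \<in> Obj J \<Longrightarrow> fobj R' (fobj R X) = X"
      "Y \<in> Obj J' \<Longrightarrow> fobj R (fobj R' Y) = Y"
    and inv_farr [simp]: "f \<in> Arr J \<Longrightarrow> farr R' (farr R f) = f"
      "g \<in> Arr J' \<Longrightarrow> farr R (farr R' g) = g"

context diag_isomorphism
begin

lemma inverse_functors: "inverse_functors J J' R R'"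
  by unfold_locales auto

end

text \<open>Lifts are computed in \<open>G\<close> and carried back by \<open>R\<close>. Since the
  inverses are strict, the equations of a splitting survive as equations; a conjugation by
  equivalences would not give this.\<close>

lemma split_opfibration_conjugate:
  assumes "inverse_functors G J R R'" "inverse_functors I K S S'" "split_opfibration G I \<pi>"
  shows "split_opfibration J K (func_comp J S (func_comp J \<pi> R'))"
proof -
  interpret R: inverse_functors G J R R' by fact
  interpret S: inverse_functors I K S S' by fact
  from assms(3) obtain \<chi> where "Functor G I \<pi>" "is_splitting G I \<pi> \<chi>"
    unfolding split_opfibration_def by auto
  then interpret \<pi>: split_opfib G I \<pi> \<chi> by (simp add: split_opfib_def split_opfib_axioms_def)
  let ?F = "func_comp J S (func_comp J \<pi> R')"
  interpret F: Functor J K ?F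
    by (intro Functor_func_comp[of J I] Functor_func_comp[of J G] R.R'.Functor_axioms
      S.R.Functor_axioms \<pi>.Functor_axioms)
  have F [simp]: "X \<in> Obj J \<Longrightarrow> fobj ?F X = fobj S (fobj \<pi> (fobj R' X))"
    "f \<in> Arr J \<Longrightarrow> farr ?F f = farr S (farr \<pi> (farr R' f))" for X f
    by simp_all
  define lift where "lift = (\<lambda>X k. farr R (\<chi> (fobj R' X) (farr S' k)))"
  have Dom_S': "Dom I (farr S' k) = fobj \<pi> (fobj R' X)"
    if "X \<in> Obj J" "k \<in> Arr K" "Dom K k = fobj ?F X" for X k
    using that by (simp add: R.R'.fobj_closed \<pi>.fobj_closed)
  have lift: "lift X k \<in> Arr J" "Dom J (lift X k) = X" "farr ?F (lift X k) = k"
      "Cod J (lift X k) = fobj R (Cod G (\<chi> (fobj R' X) (farr S' k)))"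
    if "X \<in> Obj J" "k \<in> Arr K" "Dom K k = fobj ?F X" for X k
    using Dom_S'[OF that] that by (simp_all add: lift_def R.R'.fobj_closed del: F(1))
  have opc: "opcartesian J K ?F (lift X k)"
    if X: "X \<in> Obj J" and k: "k \<in> Arr K" and d: "Dom K k = fobj ?F X" for X k
    unfolding opcartesian_def
  proof (intro conjI allI ballI impI)
    note l = lift[OF X k d]
    let ?f = "\<chi> (fobj R' X) (farr S' k)"
    have f: "?f \<in> Arr G" "opcartesian G I \<pi> ?f" "Dom G ?f = fobj R' X" "farr \<pi> ?f = farr S' k"
      using X k Dom_S'[OF X k d] by (simp_all add: R.R'.fobj_closed del: F(1))
    have C: "Cod G ?f \<in> Obj G" using f(1) by (rule R.R.A.Cod_closed)
    show "lift X k \<in> Arr J" by (rule l)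
    fix Z g h
    assume g: "g \<in> hom J (Dom J (lift X k)) Z" and h: "h \<in> hom K (fobj ?F (Cod J (lift X k))) (fobj ?F Z)"
      and eq: "h \<odot>\<^bsub>K\<^esub> farr ?F (lift X k) = farr ?F g"
    have g': "g \<in> Arr J" "Dom J g = X" "Cod J g = Z" "Z \<in> Obj J"
      using g l(2) R.R.B.hom_Obj[OF g] by (auto simp: hom_iff)
    have h': "h \<in> Arr K" "Dom K h = fobj S (fobj \<pi> (Cod G ?f))" "Cod K h = fobj S (fobj \<pi> (fobj R' Z))"
      using h g'(4) C by (simp_all add: hom_iff l(4) R.R.fobj_closed)
    \<comment> \<open>The factorisation problem for \<open>lift X k\<close> is moved to
      \<open>G\<close> by \<open>R'\<close> and \<open>S'\<close>, solved there because
      \<open>?f\<close> is opcartesian, and the solution is moved back by \<open>R\<close>.\<close>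
    have "Cod K k = Dom K h"
      using h F.farr_closed(3)[OF l(1), unfolded l(3)] by (simp only: hom_iff)
    then have "farr S' h \<odot>\<^bsub>I\<^esub> farr S' k = farr S' (h \<odot>\<^bsub>K\<^esub> k)"
      by (rule S.R'.farr_Comp'[OF k h'(1), symmetric])
    also have "\<dots> = farr S' (farr ?F g)" using eq l(3) by simp
    also have "\<dots> = farr \<pi> (farr R' g)" using g'(1) by simp
    finally have "farr S' h \<odot>\<^bsub>I\<^esub> farr \<pi> ?f = farr \<pi> (farr R' g)" using f(4) by simp
    moreover have "farr R' g \<in> hom G (Dom G ?f) (fobj R' Z)" using g' f(3) by (simp add: hom_iff)
    moreover have "farr S' h \<in> hom I (fobj \<pi> (Cod G ?f)) (fobj \<pi> (fobj R' Z))"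
      using h' C g'(4) by (simp add: hom_iff \<pi>.fobj_closed R.R'.fobj_closed)
    ultimately have "\<exists>!h'. h' \<in> hom G (Cod G ?f) (fobj R' Z) \<and> farr \<pi> h' = farr S' h \<and>
        h' \<odot>\<^bsub>G\<^esub> ?f = farr R' g"
      using f(2)[unfolded opcartesian_def] by simp
    then obtain v where v: "v \<in> hom G (Cod G ?f) (fobj R' Z)"
        "farr \<pi> v = farr S' h \<and> v \<odot>\<^bsub>G\<^esub> ?f = farr R' g"
      and uniq: "\<And>w. w \<in> hom G (Cod G ?f) (fobj R' Z) \<Longrightarrow>
        farr \<pi> w = farr S' h \<and> w \<odot>\<^bsub>G\<^esub> ?f = farr R' g \<Longrightarrow> w = v"
      by (rule ex1_conjE) (rule that)
    have v': "v \<in> Arr G" "Dom G v = Cod G ?f" "Cod G v = fobj R' Z" using v(1) by (auto simp: hom_iff)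
    show "\<exists>!w. w \<in> hom J (Cod J (lift X k)) Z \<and> farr ?F w = h \<and> w \<odot>\<^bsub>J\<^esub> lift X k = g"
    proof (rule ex1I)
      have "farr R v \<odot>\<^bsub>J\<^esub> lift X k = farr R (v \<odot>\<^bsub>G\<^esub> ?f)"
        using v' f(1) by (simp add: lift_def R.R.farr_Comp')
      then show "farr R v \<in> hom J (Cod J (lift X k)) Z \<and> farr ?F (farr R v) = h \<and>
          farr R v \<odot>\<^bsub>J\<^esub> lift X k = g"
        using v' v(2) g' h' by (simp add: hom_iff l(4))
    next
      fix w assume w: "w \<in> hom J (Cod J (lift X k)) Z \<and> farr ?F w = h \<and> w \<odot>\<^bsub>J\<^esub> lift X k = g"
      then have w': "w \<in> Arr J" "Dom J w = fobj R (Cod G ?f)" "Cod J w = Z" by (auto simp: hom_iff l(4))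
      have "farr R' w = v"
      proof (rule uniq, rule_tac [2] conjI)
        show "farr R' w \<in> hom G (Cod G ?f) (fobj R' Z)" using w' C by (simp add: hom_iff)
        have "farr S' h = farr S' (farr S (farr \<pi> (farr R' w)))" using w w'(1) by simp
        then show "farr \<pi> (farr R' w) = farr S' h" using w' by simp
        have "farr R' g = farr R' w \<odot>\<^bsub>G\<^esub> farr R' (lift X k)"
          using w w' l(1,4) by (auto simp: R.R'.farr_Comp')
        then show "farr R' w \<odot>\<^bsub>G\<^esub> ?f = farr R' g" using f(1) by (simp add: lift_def)
      qed
      then show "w = farr R v" using w'(1) by auto
    qed
  qed
  have "is_splitting J K ?F lift" unfolding is_splitting_def
  proof (intro conjI ballI allI)
    fix X assume X: "X \<in> Obj J"
    show "lift X (Id K (fobj ?F X)) = Id J X"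
      using X by (simp add: lift_def S.R'.farr_Id S.R.fobj_closed \<pi>.fobj_closed R.R'.fobj_closed R.R.farr_Id)
    fix Y k assume "k \<in> hom K (fobj ?F X) Y"
    then have k: "k \<in> Arr K" "Dom K k = fobj ?F X" "Cod K k = Y" by (simp_all add: hom_iff del: F)
    show "lift X k \<in> Arr J" "Dom J (lift X k) = X" "farr ?F (lift X k) = k" "opcartesian J K ?F (lift X k)"
      using lift[OF X k(1,2)] opc[OF X k(1,2)] by auto
    fix Z l assume "l \<in> hom K Y Z"
    then have l: "l \<in> Arr K" "Dom K l = Y" by (simp_all add: hom_iff)
    have *: "fobj R' X \<in> Obj G" "farr S' k \<in> Arr I" "Dom I (farr S' k) = fobj \<pi> (fobj R' X)"
      "farr S' l \<in> Arr I" "Dom I (farr S' l) = Cod I (farr S' k)"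
      using Dom_S'[OF X k(1,2)] X k l by (simp_all add: R.R'.fobj_closed del: F)
    let ?Y = "Cod G (\<chi> (fobj R' X) (farr S' k))"
    have Y: "?Y \<in> Obj G" "fobj \<pi> ?Y = Cod I (farr S' k)" using *(1-3) by auto
    have "lift X (l \<odot>\<^bsub>K\<^esub> k) = farr R (\<chi> ?Y (farr S' l) \<odot>\<^bsub>G\<^esub> \<chi> (fobj R' X) (farr S' k))"
      using k l unfolding lift_def by (simp add: S.R'.farr_Comp' \<pi>.lift_Comp[OF *])
    also have "\<dots> = lift (Cod J (lift X k)) l \<odot>\<^bsub>J\<^esub> lift X k"
      unfolding lift(4)[OF X k(1,2)] using * Y
      by (simp add: lift_def R.R.farr_Comp')
    finally show "lift X (l \<odot>\<^bsub>K\<^esub> k) = lift (Cod J (lift X k)) l \<odot>\<^bsub>J\<^esub> lift X k" .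
  qed
  then show ?thesis using F.Functor_axioms by (auto simp: split_opfibration_def)
qed

text \<open>By the form of \<open>F\<close>, the functor \<open>R'\<close> restricts to an
  isomorphism from the fibre of \<open>F\<close> over \<open>k\<close> to the fibre of
  \<open>\<pi>\<close> over \<open>fobj S' k\<close>. Cocones are carried across by composing with
  \<open>\<rho>\<close>, factorisations by composing with \<open>\<sigma>\<close> or
  \<open>\<sigma>'\<close>, and all of these components are invertible.\<close>

lemma fibrewise_colimit_conjugate:
  assumes "diag_isomorphism C G M J D R \<rho> R' \<rho>'" "diag_isomorphism C I N K L S \<sigma> S' \<sigma>'"
    and hom: "(\<pi>, \<zeta>) \<in> diag_hom C (G, M) (I, N)" and colim: "fibrewise_colimit G I C \<pi> M N \<zeta>"
    and F: "(F, \<eta>) = diag_comp C J (S, \<sigma>) (diag_comp C J (\<pi>, \<zeta>) (R', \<rho>'))"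
  shows "fibrewise_colimit J K C F D L \<eta>"
  unfolding fibrewise_colimit_def
proof
  interpret R: diag_isomorphism C G M J D R \<rho> R' \<rho>' by fact
  interpret S: diag_isomorphism C I N K L S \<sigma> S' \<sigma>' by fact
  note d = diag_homD[OF hom]
  interpret \<pi>: Functor G I \<pi> by (rule d)
  have \<zeta>: "\<zeta> x \<in> Arr C" "Dom C (\<zeta> x) = fobj M x" "Cod C (\<zeta> x) = fobj N (fobj \<pi> x)"
    if "x \<in> Obj G" for x using d(4)[OF that] by (auto simp: hom_iff)
  have F_hom: "(F, \<eta>) \<in> diag_hom C (J, D) (K, L)"
    unfolding F using diag_comp_hom[OF S.D'.Functor_axioms diag_comp_hom[OF S.D.Functor_axioms R.inv_hom hom] S.hom] .
  note f = diag_homD[OF F_hom]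
  interpret F: Functor J K F by (rule f)
  have F_fobj: "fobj F j = fobj S (fobj \<pi> (fobj R' j))"
    and \<eta>: "\<eta> j = \<sigma> (fobj \<pi> (fobj R' j)) \<odot>\<^bsub>C\<^esub> \<zeta> (fobj R' j) \<odot>\<^bsub>C\<^esub> \<rho>' j" if "j \<in> Obj J" for j
    using F that by (auto simp: diag_comp_simp)
  have F_farr: "farr F g = farr S (farr \<pi> (farr R' g))" if "g \<in> Arr J" for g
    using F that by (auto simp: diag_comp_simp)
  fix k assume k: "k \<in> Obj K"
  let ?i = "fobj S' k"
  have i: "?i \<in> Obj I" "fobj S ?i = k" using k by (simp_all add: S.R'.fobj_closed)
  show "is_colimit C (fibre_diagram J K F D k) (fobj L k) \<eta>"
    unfolding fibre_colimit_iff
  proof (intro conjI allI impI)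
    show "is_cocone C (fibre_diagram J K F D k) (fobj L k) \<eta>"
      by (rule fibre_cocone[OF F_hom S.D'.Functor_axioms k])
    fix b \<kappa> assume "is_cocone C (fibre_diagram J K F D k) b \<kappa>"
    note \<kappa> = this[unfolded F.fibre_cocone_iff[OF R.D'.Functor_axioms k]]
    define \<kappa>' where "\<kappa>' x = \<kappa> (fobj R x) \<odot>\<^bsub>C\<^esub> \<rho> x" for x
    have fib: "fobj R x \<in> Obj J" "fobj F (fobj R x) = k" "\<kappa> (fobj R x) \<in> hom C (fobj D (fobj R x)) b"
      if "x \<in> Obj G" "fobj \<pi> x = ?i" for x
    proof -
      show 1: "fobj R x \<in> Obj J" "fobj F (fobj R x) = k"
        using that i R.R.fobj_closed by (auto simp: F_fobj)
      with \<kappa> show "\<kappa> (fobj R x) \<in> hom C (fobj D (fobj R x)) b" by blast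
    qed
    have \<kappa>_closed: "\<kappa> (fobj R x) \<in> Arr C" "Dom C (\<kappa> (fobj R x)) = fobj D (fobj R x)" 
       "Cod C (\<kappa> (fobj R x)) = b" if "x \<in> Obj G" "fobj \<pi> x = ?i" for x
      using fib(3)[OF that] by (auto simp: hom_iff)
    have "is_cocone C (fibre_diagram G I \<pi> M ?i) b \<kappa>'"
      unfolding \<pi>.fibre_cocone_iff[OF R.D.Functor_axioms i(1)]
    proof (intro conjI ballI impI)
      show "b \<in> Obj C" using \<kappa> by simp
      show "\<kappa>' x \<in> hom C (fobj M x) b" if "x \<in> Obj G" "fobj \<pi> x = ?i" for x
        using fib[OF that] that by (auto simp: \<kappa>'_def hom_iff)
      fix a assume a: "a \<in> Arr G" "farr \<pi> a = Id I ?i"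
      note v = \<pi>.vertical_fobj[OF a i(1)]
      have o: "Dom G a \<in> Obj G" "Cod G a \<in> Obj G"
        using a(1) by (simp_all add: R.R.A.Dom_closed R.R.A.Cod_closed)
      have "farr F (farr R a) = Id K k"
        using a i by (simp add: F_farr S.R.farr_Id)
      then have "\<kappa> (Cod J (farr R a)) \<odot>\<^bsub>C\<^esub> farr D (farr R a) = \<kappa> (Dom J (farr R a))"
        using \<kappa> R.R.farr_closed(1)[OF a(1)] by blast
      then have "\<kappa> (fobj R (Cod G a)) \<odot>\<^bsub>C\<^esub> farr D (farr R a) = \<kappa> (fobj R (Dom G a))"
        using a by simp
      then have "\<kappa>' (Dom G a) = (\<kappa> (fobj R (Cod G a)) \<odot>\<^bsub>C\<^esub> farr D (farr R a)) \<odot>\<^bsub>C\<^esub> \<rho> (Dom G a)"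
        by (simp add: \<kappa>'_def)
      also have "\<dots> = \<kappa> (fobj R (Cod G a)) \<odot>\<^bsub>C\<^esub> farr D (farr R a) \<odot>\<^bsub>C\<^esub> \<rho> (Dom G a)"
        using o a v \<kappa>_closed by (simp add: R.D.B.Comp_assoc)
      also have "farr D (farr R a) \<odot>\<^bsub>C\<^esub> \<rho> (Dom G a) = \<rho> (Cod G a) \<odot>\<^bsub>C\<^esub> farr M a"
        using diag_homD(5)[OF R.hom a(1)] by simp
      also have "\<kappa> (fobj R (Cod G a)) \<odot>\<^bsub>C\<^esub> \<rho> (Cod G a) \<odot>\<^bsub>C\<^esub> farr M a = \<kappa>' (Cod G a) \<odot>\<^bsub>C\<^esub> farr M a"
        using o a v \<kappa>_closed by (simp add: \<kappa>'_def R.D.B.Comp_assoc)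
      finally show "\<kappa>' (Cod G a) \<odot>\<^bsub>C\<^esub> farr M a = \<kappa>' (Dom G a)" by simp
    qed
    moreover have "is_colimit C (fibre_diagram G I \<pi> M ?i) (fobj N ?i) \<zeta>"
      using colim i(1) by (simp add: fibrewise_colimit_def)
    ultimately have "\<exists>!u. u \<in> hom C (fobj N ?i) b \<and>
        (\<forall>x\<in>Obj G. fobj \<pi> x = ?i \<longrightarrow> u \<odot>\<^bsub>C\<^esub> \<zeta> x = \<kappa>' x)"
      by (rule fibre_colimit_factor[rotated])
    then obtain u where u: "u \<in> hom C (fobj N ?i) b"
        "\<forall>x\<in>Obj G. fobj \<pi> x = ?i \<longrightarrow> u \<odot>\<^bsub>C\<^esub> \<zeta> x = \<kappa>' x"
      and uniq: "\<And>w. w \<in> hom C (fobj N ?i) b \<Longrightarrow>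
        \<forall>x\<in>Obj G. fobj \<pi> x = ?i \<longrightarrow> w \<odot>\<^bsub>C\<^esub> \<zeta> x = \<kappa>' x \<Longrightarrow> w = u"
      by (rule ex1_conjE) (rule that)
    have u': "u \<in> Arr C" "Dom C u = fobj N ?i" "Cod C u = b" using u(1) by (auto simp: hom_iff)
    show "\<exists>!w. w \<in> hom C (fobj L k) b \<and> (\<forall>j\<in>Obj J. fobj F j = k \<longrightarrow> w \<odot>\<^bsub>C\<^esub> \<eta> j = \<kappa> j)"
    proof (rule ex1I)
      \<comment> \<open>The factorisation found over \<open>fobj S' k\<close>, precomposed with the
        component of \<open>\<sigma>'\<close> that leads from \<open>fobj L k\<close> to the colimit
        object there.\<close>
      show "u \<odot>\<^bsub>C\<^esub> \<sigma>' k \<in> hom C (fobj L k) b \<and>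
        (\<forall>j\<in>Obj J. fobj F j = k \<longrightarrow> (u \<odot>\<^bsub>C\<^esub> \<sigma>' k) \<odot>\<^bsub>C\<^esub> \<eta> j = \<kappa> j)"
      proof (intro conjI ballI impI)
        show "u \<odot>\<^bsub>C\<^esub> \<sigma>' k \<in> hom C (fobj L k) b" using u' k by (simp add: hom_iff)
        fix j assume j: "j \<in> Obj J" "fobj F j = k"
        let ?x = "fobj R' j"
        have x: "?x \<in> Obj G" "fobj R ?x = j" "fobj \<pi> ?x = ?i"
          using j by (auto simp: R.R'.fobj_closed F_fobj \<pi>.fobj_closed)
        have "(u \<odot>\<^bsub>C\<^esub> \<sigma>' k) \<odot>\<^bsub>C\<^esub> \<eta> j = u \<odot>\<^bsub>C\<^esub> (\<sigma>' k \<odot>\<^bsub>C\<^esub> \<sigma> ?i) \<odot>\<^bsub>C\<^esub> \<zeta> ?x \<odot>\<^bsub>C\<^esub> \<rho>' j"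
          using j k x i u' \<zeta>[OF x(1)] by (simp add: \<eta> R.D.B.Comp_assoc)
        also have "\<sigma>' k \<odot>\<^bsub>C\<^esub> \<sigma> ?i = Id C (fobj N ?i)"
          using S.\<rho>'_\<rho>[OF i(1)] i by simp
        also have "u \<odot>\<^bsub>C\<^esub> Id C (fobj N ?i) \<odot>\<^bsub>C\<^esub> \<zeta> ?x \<odot>\<^bsub>C\<^esub> \<rho>' j = (u \<odot>\<^bsub>C\<^esub> \<zeta> ?x) \<odot>\<^bsub>C\<^esub> \<rho>' j"
          using j x i u' \<zeta>[OF x(1)] by (simp add: R.D.B.Comp_assoc)
        also have "\<dots> = \<kappa> j \<odot>\<^bsub>C\<^esub> \<rho> ?x \<odot>\<^bsub>C\<^esub> \<rho>' j"
          using u(2)[rule_format, OF x(1,3)] \<kappa>_closed[OF x(1,3)] x j by (simp add: \<kappa>'_def R.D.B.Comp_assoc)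
        also have "\<dots> = \<kappa> j"
          using R.\<rho>_\<rho>'[OF j(1)] \<kappa>_closed[OF x(1,3)] x by simp
        finally show "(u \<odot>\<^bsub>C\<^esub> \<sigma>' k) \<odot>\<^bsub>C\<^esub> \<eta> j = \<kappa> j" .
      qed
    next
      fix w assume w: "w \<in> hom C (fobj L k) b \<and> (\<forall>j\<in>Obj J. fobj F j = k \<longrightarrow> w \<odot>\<^bsub>C\<^esub> \<eta> j = \<kappa> j)"
      then have w': "w \<in> Arr C" "Dom C w = fobj L k" "Cod C w = b" by (auto simp: hom_iff)
      have "w \<odot>\<^bsub>C\<^esub> \<sigma> ?i = u"
      proof (rule uniq; (intro ballI impI)?)
        show "w \<odot>\<^bsub>C\<^esub> \<sigma> ?i \<in> hom C (fobj N ?i) b" using w' i by (simp add: hom_iff)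
        fix x assume x: "x \<in> Obj G" "fobj \<pi> x = ?i"
        have "\<kappa> (fobj R x) = w \<odot>\<^bsub>C\<^esub> \<eta> (fobj R x)" using w fib(1,2)[OF x] by simp
        then have "\<kappa>' x = (w \<odot>\<^bsub>C\<^esub> \<sigma> ?i \<odot>\<^bsub>C\<^esub> \<zeta> x \<odot>\<^bsub>C\<^esub> \<rho>' (fobj R x)) \<odot>\<^bsub>C\<^esub> \<rho> x"
          using x fib(1)[OF x] by (simp add: \<eta> \<kappa>'_def)
        also have "\<dots> = (w \<odot>\<^bsub>C\<^esub> \<sigma> ?i) \<odot>\<^bsub>C\<^esub> \<zeta> x \<odot>\<^bsub>C\<^esub> \<rho>' (fobj R x) \<odot>\<^bsub>C\<^esub> \<rho> x"
          using x fib(1)[OF x] w' i \<zeta>[OF x(1)] by (simp add: R.D.B.Comp_assoc)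
        also have "\<dots> = (w \<odot>\<^bsub>C\<^esub> \<sigma> ?i) \<odot>\<^bsub>C\<^esub> \<zeta> x"
          using R.\<rho>'_\<rho>[OF x(1)] \<zeta>[OF x(1)] by simp
        finally show "(w \<odot>\<^bsub>C\<^esub> \<sigma> ?i) \<odot>\<^bsub>C\<^esub> \<zeta> x = \<kappa>' x" by simp
      qed
      then have "u \<odot>\<^bsub>C\<^esub> \<sigma>' k = w \<odot>\<^bsub>C\<^esub> \<sigma> ?i \<odot>\<^bsub>C\<^esub> \<sigma>' k"
        using w' i k by (auto simp: R.D.B.Comp_assoc)
      also have "\<dots> = w" using S.\<rho>_\<rho>'[OF k] w' by simp
      finally show "w = u \<odot>\<^bsub>C\<^esub> \<sigma>' k" by simp
    qed
  qed
qed

section \<open>The colimit functor\<close>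

lemma small_diagram_colimit:
  assumes "colimit_choice C c" "\<D> \<in> small_diagrams C"
  shows "is_colimit C (fst \<D>, snd \<D>) (fst (c \<D>)) (snd (c \<D>))"
  using assms by (simp add: colimit_choice_def)

lemma choice_cocone:
  assumes "colimit_choice C c" "\<D> \<in> small_diagrams C"
  shows "fst (c \<D>) \<in> Obj C"
    and "j \<in> Obj (fst \<D>) \<Longrightarrow> snd (c \<D>) j \<in> hom C (fobj (snd \<D>) j) (fst (c \<D>))"
    and "f \<in> Arr (fst \<D>) \<Longrightarrow>
      snd (c \<D>) (Cod (fst \<D>) f) \<odot>\<^bsub>C\<^esub> farr (snd \<D>) f = snd (c \<D>) (Dom (fst \<D>) f)"
  using colimit_cocone[OF small_diagram_colimit[OF assms], unfolded is_cocone_iff] by simp_all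

text \<open>Applied to the chosen colimit of the target diagram, this is the cocone whose
  factorisation defines \<open>colim_functor\<close> on arrows. Naturality of \<open>\<rho>\<close>
  shifts an arrow of \<open>J\<close> to its image in \<open>J'\<close>, where
  \<open>\<kappa>\<close> absorbs it.\<close>

lemma induced_cocone:
  assumes hom: "(R, \<rho>) \<in> diag_hom C (J, D) (J', D')" and "is_cocone C (J', D') b \<kappa>"
  shows "is_cocone C (J, D) b (\<lambda>j. \<kappa> (fobj R j) \<odot>\<^bsub>C\<^esub> \<rho> j)"
proof -
  note r = diag_homD[OF hom]
  interpret R: Functor J J' R by (rule r)
  interpret D: Functor J C D by (rule r)
  interpret D': Functor J' C D' using assms(2) by (simp add: is_cocone_iff)
  have \<kappa>: "\<kappa> j \<in> Arr C" "Dom C (\<kappa> j) = fobj D' j" "Cod C (\<kappa> j) = b" if "j \<in> Obj J'" for j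
    using assms(2) that by (auto simp: is_cocone_iff hom_iff)
  have \<rho>: "\<rho> j \<in> Arr C" "Dom C (\<rho> j) = fobj D j" "Cod C (\<rho> j) = fobj D' (fobj R j)"
    if "j \<in> Obj J" for j using r(4)[OF that] by (auto simp: hom_iff)
  show ?thesis unfolding is_cocone_iff
  proof (intro conjI ballI)
    show "b \<in> Obj C" using assms(2) by (simp add: is_cocone_iff)
    show "\<kappa> (fobj R j) \<odot>\<^bsub>C\<^esub> \<rho> j \<in> hom C (fobj D j) b" if "j \<in> Obj J" for j
      using that by (simp add: hom_iff \<kappa> \<rho> R.fobj_closed)
    fix f assume f: "f \<in> Arr J"
    then have o: "Dom J f \<in> Obj J" "Cod J f \<in> Obj J"
      by (simp_all add: R.A.Dom_closed R.A.Cod_closed)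
    have "(\<kappa> (fobj R (Cod J f)) \<odot>\<^bsub>C\<^esub> \<rho> (Cod J f)) \<odot>\<^bsub>C\<^esub> farr D f =
      \<kappa> (fobj R (Cod J f)) \<odot>\<^bsub>C\<^esub> farr D' (farr R f) \<odot>\<^bsub>C\<^esub> \<rho> (Dom J f)"
      using o f by (simp add: D.B.Comp_assoc \<kappa> \<rho> R.fobj_closed r(5))
    also have "\<dots> = (\<kappa> (fobj R (Cod J f)) \<odot>\<^bsub>C\<^esub> farr D' (farr R f)) \<odot>\<^bsub>C\<^esub> \<rho> (Dom J f)"
      using o f by (simp add: D.B.Comp_assoc \<kappa> \<rho> R.fobj_closed)
    finally have eq: "(\<kappa> (fobj R (Cod J f)) \<odot>\<^bsub>C\<^esub> \<rho> (Cod J f)) \<odot>\<^bsub>C\<^esub> farr D f =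
      (\<kappa> (fobj R (Cod J f)) \<odot>\<^bsub>C\<^esub> farr D' (farr R f)) \<odot>\<^bsub>C\<^esub> \<rho> (Dom J f)" .
    have "\<forall>g\<in>Arr J'. \<kappa> (Cod J' g) \<odot>\<^bsub>C\<^esub> farr D' g = \<kappa> (Dom J' g)"
      using assms(2) by (simp add: is_cocone_iff)
    from bspec[OF this R.farr_closed(1)[OF f]]
    have "\<kappa> (fobj R (Cod J f)) \<odot>\<^bsub>C\<^esub> farr D' (farr R f) = \<kappa> (fobj R (Dom J f))"
      using f by simp
    with eq show "(\<kappa> (fobj R (Cod J f)) \<odot>\<^bsub>C\<^esub> \<rho> (Cod J f)) \<odot>\<^bsub>C\<^esub> farr D f =
      \<kappa> (fobj R (Dom J f)) \<odot>\<^bsub>C\<^esub> \<rho> (Dom J f)" by simp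
  qed (rule r)
qed

context
  fixes C :: "('o, 'm) cat" and c :: "('u, 'o, 'm) choice"
  assumes choice: "colimit_choice C c"
begin

lemma colim_functor_fobj: "\<D> \<in> small_diagrams C \<Longrightarrow> fobj (colim_functor C c) \<D> = fst (c \<D>)"
  by (simp add: colim_functor_def)

text \<open>The \<open>THE\<close> in \<open>colim_functor\<close> denotes, being the unique
  factorisation of the cocone from \<open>induced_cocone\<close> through the chosen colimit of the
  source.\<close>

lemma colim_functor_farr:
  assumes \<D>: "\<D> \<in> small_diagrams C" "\<D>' \<in> small_diagrams C" and \<Phi>: "(R, \<rho>) \<in> diag_hom C \<D> \<D>'"
  shows "farr (colim_functor C c) (\<D>, (R, \<rho>), \<D>') \<in> hom C (fst (c \<D>)) (fst (c \<D>'))"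
    and "j \<in> Obj (fst \<D>) \<Longrightarrow> farr (colim_functor C c) (\<D>, (R, \<rho>), \<D>') \<odot>\<^bsub>C\<^esub> snd (c \<D>) j =
      snd (c \<D>') (fobj R j) \<odot>\<^bsub>C\<^esub> \<rho> j"
proof -
  let ?P = "\<lambda>u. u \<in> hom C (fst (c \<D>)) (fst (c \<D>')) \<and>
    (\<forall>j\<in>Obj (fst \<D>). u \<odot>\<^bsub>C\<^esub> snd (c \<D>) j = snd (c \<D>') (fobj R j) \<odot>\<^bsub>C\<^esub> \<rho> j)"
  have "is_cocone C (fst \<D>, snd \<D>) (fst (c \<D>')) (\<lambda>j. snd (c \<D>') (fobj R j) \<odot>\<^bsub>C\<^esub> \<rho> j)"
    using induced_cocone[of R \<rho> C "fst \<D>" "snd \<D>" "fst \<D>'" "snd \<D>'"] \<Phi>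
      colimit_cocone[OF small_diagram_colimit[OF choice \<D>(2)]] by simp
  then have "\<exists>!u. ?P u" by (rule colimit_factor[OF small_diagram_colimit[OF choice \<D>(1)]])
  then have the: "?P (THE u. ?P u)" by (rule theI')
  have "(\<D>, (R, \<rho>), \<D>') \<in> Arr (Diag C)" using assms by (simp add: Diag_def)
  then have eq: "farr (colim_functor C c) (\<D>, (R, \<rho>), \<D>') = (THE u. ?P u)"
    by (simp add: colim_functor_def)
  have *: "?P (farr (colim_functor C c) (\<D>, (R, \<rho>), \<D>'))"
    unfolding eq by (rule the)
  show "farr (colim_functor C c) (\<D>, (R, \<rho>), \<D>') \<in> hom C (fst (c \<D>)) (fst (c \<D>'))"
    using * by (rule conjunct1)
  show "farr (colim_functor C c) (\<D>, (R, \<rho>), \<D>') \<odot>\<^bsub>C\<^esub> snd (c \<D>) j =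
      snd (c \<D>') (fobj R j) \<odot>\<^bsub>C\<^esub> \<rho> j" if "j \<in> Obj (fst \<D>)"
    using conjunct2[OF *] that by (rule bspec)
qed

text \<open>Both functor laws are equations of arrows out of a chosen colimit, hence can be tested
  on its coprojections.\<close>

lemma Functor_colim_functor:
  assumes "category C"
  shows "Functor (Diag C) C (colim_functor C c)"
proof -
  interpret C: category C by fact
  interpret Diag: category "Diag C :: (('u, 'o, 'm) sdiagram, _) cat" by (rule category_Diag)
  have uniq: "u = v" if "\<D> \<in> small_diagrams C" "u \<in> hom C (fst (c \<D>)) b" "v \<in> hom C (fst (c \<D>)) b"
    "\<And>j. j \<in> Obj (fst \<D>) \<Longrightarrow> u \<odot>\<^bsub>C\<^esub> snd (c \<D>) j = v \<odot>\<^bsub>C\<^esub> snd (c \<D>) j" for \<D> u v b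
    by (rule colimit_cancel[OF small_diagram_colimit[OF choice that(1)] that(2-4)])
  show ?thesis
  proof (unfold_locales, goal_cases)
    case (3 \<D>)
    then show ?case using choice_cocone(1)[OF choice] by (simp add: colim_functor_fobj)
  next
    case (4 f \<D> \<D>')
    then obtain R \<rho> where "f = (\<D>, (R, \<rho>), \<D>')" "(R, \<rho>) \<in> diag_hom C \<D> \<D>'"
      "\<D> \<in> small_diagrams C" "\<D>' \<in> small_diagrams C"
      by (auto simp: Diag_hom_iff)
    then show ?case using colim_functor_farr(1)[of \<D> \<D>' R \<rho>] by (simp add: colim_functor_fobj)
  next
    case (5 \<D>)
    then have \<D>: "\<D> \<in> small_diagrams C" by simp
    then have D: "Functor (fst \<D>) C (snd \<D>)" using small_diagramsD(2)[of "fst \<D>" "snd \<D>" C] by simp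
    have h: "diag_id C (fst \<D>, snd \<D>) \<in> diag_hom C \<D> \<D>"
      using diag_id_hom[OF D] by simp
    note u = colim_functor_farr[OF \<D> \<D> h[unfolded diag_id_def prod.case]]
    have "farr (colim_functor C c) (\<D>, diag_id C (fst \<D>, snd \<D>), \<D>) = Id C (fst (c \<D>))"
      unfolding diag_id_def prod.case
      by (rule uniq[OF \<D> u(1) C.Id_hom])
        (use choice_cocone[OF choice \<D>] in \<open>auto simp: u(2) hom_iff\<close>)
    then show ?case using \<D> by (simp add: colim_functor_fobj)
  next
    case (6 f \<D>1 \<D>2 g \<D>3)
    then obtain R \<rho> S \<sigma> where f: "f = (\<D>1, (R, \<rho>), \<D>2)" "(R, \<rho>) \<in> diag_hom C \<D>1 \<D>2"
      and g: "g = (\<D>2, (S, \<sigma>), \<D>3)" "(S, \<sigma>) \<in> diag_hom C \<D>2 \<D>3"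
      and \<D>: "\<D>1 \<in> small_diagrams C" "\<D>2 \<in> small_diagrams C" "\<D>3 \<in> small_diagrams C"
      by (auto simp: Diag_hom_iff)
    have "g \<odot>\<^bsub>Diag C\<^esub> f \<in> hom (Diag C) \<D>1 \<D>3" by (rule Diag.Comp_hom[OF 6])
    then have h: "diag_comp C (fst \<D>1) (S, \<sigma>) (R, \<rho>) \<in> diag_hom C \<D>1 \<D>3"
      by (auto simp: Diag_hom_iff f(1) g(1))
    note r = diag_homD[of R \<rho> C "fst \<D>1" "snd \<D>1" "fst \<D>2" "snd \<D>2", simplified, OF f(2)]
    note s = diag_homD[of S \<sigma> C "fst \<D>2" "snd \<D>2" "fst \<D>3" "snd \<D>3", simplified, OF g(2)]
    interpret R: Functor "fst \<D>1" "fst \<D>2" R by (rule r)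
    interpret S: Functor "fst \<D>2" "fst \<D>3" S by (rule s)
    note u = colim_functor_farr[OF \<D>(1,2) f(2)] and v = colim_functor_farr[OF \<D>(2,3) g(2)]
      and w = colim_functor_farr[OF \<D>(1,3) h[unfolded diag_comp_simp]]
    let ?u = "farr (colim_functor C c) (\<D>1, (R, \<rho>), \<D>2)"
    let ?v = "farr (colim_functor C c) (\<D>2, (S, \<sigma>), \<D>3)"
    have "farr (colim_functor C c) (\<D>1, diag_comp C (fst \<D>1) (S, \<sigma>) (R, \<rho>), \<D>3) = ?v \<odot>\<^bsub>C\<^esub> ?u"
      unfolding diag_comp_simp
    proof (rule uniq[OF \<D>(1) w(1) C.Comp_hom[OF u(1) v(1)]])
      fix j assume j: "j \<in> Obj (fst \<D>1)"
      have Rj: "fobj R j \<in> Obj (fst \<D>2)" "fobj S (fobj R j) \<in> Obj (fst \<D>3)"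
        using j by (simp_all add: R.fobj_closed S.fobj_closed)
      note h1 = choice_cocone(2)[OF choice \<D>(1) j] and h2 = choice_cocone(2)[OF choice \<D>(2) Rj(1)]
        and h3 = choice_cocone(2)[OF choice \<D>(3) Rj(2)]
      have "(?v \<odot>\<^bsub>C\<^esub> ?u) \<odot>\<^bsub>C\<^esub> snd (c \<D>1) j = ?v \<odot>\<^bsub>C\<^esub> snd (c \<D>2) (fobj R j) \<odot>\<^bsub>C\<^esub> \<rho> j"
        by (simp add: C.assoc[OF h1 u(1) v(1)] u(2)[OF j])
      also have "\<dots> = snd (c \<D>3) (fobj S (fobj R j)) \<odot>\<^bsub>C\<^esub> \<sigma> (fobj R j) \<odot>\<^bsub>C\<^esub> \<rho> j"
        using C.assoc[OF r(4)[OF j] h2 v(1)] C.assoc[OF r(4)[OF j] s(4)[OF Rj(1)] h3] v(2)[OF Rj(1)]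
        by simp
      finally show "farr (colim_functor C c) (\<D>1, (func_comp (fst \<D>1) S R,
          \<lambda>j\<in>Obj (fst \<D>1). \<sigma> (fobj R j) \<odot>\<^bsub>C\<^esub> \<rho> j), \<D>3) \<odot>\<^bsub>C\<^esub> snd (c \<D>1) j =
          (?v \<odot>\<^bsub>C\<^esub> ?u) \<odot>\<^bsub>C\<^esub> snd (c \<D>1) j"
        using w(2)[OF j] j by simp
    qed
    then show ?case by (simp add: f(1) g(1))
  qed (simp_all add: colim_functor_def)
qed

end

section \<open>Diagrams of diagrams\<close>

locale diagram_of_diagrams = C: category C + E: Functor \<I> "Diag C" E
  for C :: "('o, 'm) cat" and \<I> :: "('u, 'u) cat" and E :: "('u, 'o, 'm) diag_func"
begin

lemma E_small: "i \<in> Obj \<I> \<Longrightarrow> fobj E i \<in> small_diagrams C"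
  using E.fobj_closed by simp

lemma E1_Functor: "i \<in> Obj \<I> \<Longrightarrow> Functor (E0_obj E i) C (E1_obj E i)"
  using small_diagramsD(2)[of "fst (fobj E i)" "snd (fobj E i)"] E_small
  by (simp add: E0_obj_def E1_obj_def)

lemma E_farr:
  assumes "l \<in> hom \<I> i i'"
  shows "farr E l = (fobj E i, (E0_arr E l, E1_arr E l), fobj E i')"
    and "(E0_arr E l, E1_arr E l) \<in> diag_hom C (E0_obj E i, E1_obj E i) (E0_obj E i', E1_obj E i')"
proof -
  obtain R \<rho> where "farr E l = (fobj E i, (R, \<rho>), fobj E i')" "(R, \<rho>) \<in> diag_hom C (fobj E i) (fobj E i')"
    using E.farr_hom[OF assms] by (auto simp: Diag_hom_iff)
  then show "farr E l = (fobj E i, (E0_arr E l, E1_arr E l), fobj E i')"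
    "(E0_arr E l, E1_arr E l) \<in> diag_hom C (E0_obj E i, E1_obj E i) (E0_obj E i', E1_obj E i')"
    by (simp_all add: E0_arr_def E1_arr_def E0_obj_def E1_obj_def)
qed

lemma E_Id:
  assumes "i \<in> Obj \<I>"
  shows "E0_arr E (Id \<I> i) = func_id (E0_obj E i)"
    and "E1_arr E (Id \<I> i) = (\<lambda>X\<in>Obj (E0_obj E i). Id C (fobj (E1_obj E i) X))"
  using E.farr_Id[OF assms]
  by (simp_all add: E0_arr_def E1_arr_def E0_obj_def E1_obj_def diag_id_def case_prod_beta)

lemma E0_Comp:
  assumes "l \<in> hom \<I> i i'" "l' \<in> hom \<I> i' i''"
  shows "E0_arr E (l' \<odot>\<^bsub>\<I>\<^esub> l) = func_comp (E0_obj E i) (E0_arr E l') (E0_arr E l)"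
proof -
  have "farr E (l' \<odot>\<^bsub>\<I>\<^esub> l) = (fobj E i, diag_comp C (fst (fobj E i)) (E0_arr E l', E1_arr E l')
      (E0_arr E l, E1_arr E l), fobj E i'')"
    using E.farr_Comp[OF assms] E_farr(1)[OF assms(1)] E_farr(1)[OF assms(2)] by simp
  then show ?thesis by (simp add: E0_arr_def[of _ "l' \<odot>\<^bsub>\<I>\<^esub> l"] diag_comp_simp E0_obj_def)
qed

sublocale strict_indexed \<I> "E0_obj E" "E0_arr E"
proof (intro strict_indexed.intro strict_indexed_axioms.intro)
  show "category \<I>" by (rule E.A.category_axioms)
  show "category (E0_obj E i)" if "i \<in> Obj \<I>" for i
    by (rule Functor.axioms(1)[OF E1_Functor[OF that]])
  show "Functor (E0_obj E i) (E0_obj E i') (E0_arr E l)" if "l \<in> hom \<I> i i'" for l i i'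
    by (rule diag_homD(1)[OF E_farr(2)[OF that]])
qed (rule E_Id E0_Comp; assumption)+

lemma mu_eq:
  "mu C (\<I>, E) = (G,
     \<lparr>fobj = (\<lambda>x\<in>Obj G. fobj (E1_obj E (fst x)) (snd x)),
      farr = (\<lambda>a\<in>Arr G. farr (E1_obj E (fst (snd (snd a)))) (arr_fibre a) \<odot>\<^bsub>C\<^esub>
        E1_arr E (arr_base a) (snd (fst a)))\<rparr>)"
  by (simp add: mu_def Let_def case_prod_beta')

lemma mu_simps:
  "fst (mu C (\<I>, E)) = G"
  "x \<in> Obj G \<Longrightarrow> fobj (snd (mu C (\<I>, E))) x = fobj (E1_obj E (fst x)) (snd x)"
  "a \<in> Arr G \<Longrightarrow> farr (snd (mu C (\<I>, E))) a =
    farr (E1_obj E (fst (snd (snd a)))) (arr_fibre a) \<odot>\<^bsub>C\<^esub> E1_arr E (arr_base a) (snd (fst a))"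
  by (simp_all add: mu_eq)

context
  fixes c :: "('u, 'o, 'm) choice"
  assumes choice: "colimit_choice C c"
begin

text \<open>All chosen coprojections gathered into a single family on the Grothendieck construction.
  Up to the isomorphisms with \<open>D\<close> and \<open>D'\<close> it is the unit of the Kan
  extension.\<close>

definition colim_unit where
  "colim_unit = (\<lambda>x\<in>Obj G. snd (c (fobj E (fst x))) (snd x))"

lemma Functor_colim_push: "Functor \<I> C (func_comp \<I> (colim_functor C c) E)"
  by (rule Functor_func_comp[OF E.Functor_axioms Functor_colim_functor[OF choice C.category_axioms]])

lemma colim_push_fobj:
  "i \<in> Obj \<I> \<Longrightarrow> fobj (func_comp \<I> (colim_functor C c) E) i = fst (c (fobj E i))"
  by (simp add: colim_functor_fobj[OF choice] E_small)

lemma colim_push_farr: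
  assumes "l \<in> hom \<I> i i'" "X \<in> Obj (E0_obj E i)"
  shows "farr (func_comp \<I> (colim_functor C c) E) l \<odot>\<^bsub>C\<^esub> snd (c (fobj E i)) X =
    snd (c (fobj E i')) (fobj (E0_arr E l) X) \<odot>\<^bsub>C\<^esub> E1_arr E l X"
proof -
  have i: "i \<in> Obj \<I>" "i' \<in> Obj \<I>" "l \<in> Arr \<I>" using E.A.hom_Obj[OF assms(1)] assms(1) by (auto simp: hom_iff)
  have "(E0_arr E l, E1_arr E l) \<in> diag_hom C (fobj E i) (fobj E i')"
    using E_farr(2)[OF assms(1)] by (simp add: E0_obj_def E1_obj_def)
  from colim_functor_farr(2)[OF choice E_small[OF i(1)] E_small[OF i(2)] this]
  show ?thesis using i assms(2) by (simp add: E_farr(1)[OF assms(1)] E0_obj_def)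
qed

lemma coprojection:
  assumes "i \<in> Obj \<I>"
  shows "X \<in> Obj (E0_obj E i) \<Longrightarrow>
      snd (c (fobj E i)) X \<in> hom C (fobj (E1_obj E i) X) (fst (c (fobj E i)))"
    and "f \<in> Arr (E0_obj E i) \<Longrightarrow>
      snd (c (fobj E i)) (Cod (E0_obj E i) f) \<odot>\<^bsub>C\<^esub> farr (E1_obj E i) f =
      snd (c (fobj E i)) (Dom (E0_obj E i) f)"
  using choice_cocone(2,3)[OF choice E_small[OF assms]] by (simp_all add: E0_obj_def E1_obj_def)

text \<open>On an arrow, \<open>mu\<close> is a fibre part after a base part: the colimit cocone at
  the target absorbs the first, and \<open>colim_push_farr\<close>, the defining equation of the
  induced map, deals with the second. Functoriality of \<open>mu C (\<I>, E)\<close> is assumed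
  here; it will be supplied by the isomorphism with \<open>(J, D)\<close>, since
  \<open>diag_hom\<close> contains it.\<close>

lemma colim_unit_hom:
  assumes "Functor G C (snd (mu C (\<I>, E)))"
  shows "(grothendieck_proj \<I> (E0_obj E) (E0_arr E), colim_unit) \<in>
    diag_hom C (G, snd (mu C (\<I>, E))) (\<I>, func_comp \<I> (colim_functor C c) E)"
proof (rule diag_homI[OF \<pi>.Functor_axioms assms Functor_colim_push])
    show "colim_unit \<in> extensional (Obj G)" by (simp add: colim_unit_def)
    show "colim_unit x \<in> hom C (fobj (snd (mu C (\<I>, E))) x)
      (fobj (func_comp \<I> (colim_functor C c) E) (fobj (grothendieck_proj \<I> (E0_obj E) (E0_arr E)) x))"
      if x: "x \<in> Obj G" for x
    proof -
      have "fst x \<in> Obj \<I>" "snd x \<in> Obj (E0_obj E (fst x))" using x by (simp_all add: grothendieck_simps(1))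
      then show ?thesis
        using coprojection(1)[of "fst x" "snd x"] x colim_push_fobj[of "fst x"]
        by (simp add: colim_unit_def mu_simps del: fobj_func_comp)
    qed
    fix a assume a: "a \<in> Arr G"
    let ?x = "fst a" and ?y = "snd (snd a)" and ?l = "arr_base a" and ?f = "arr_fibre a"
    let ?N = "func_comp \<I> (colim_functor C c) E"
    have xy: "?x \<in> Obj G" "?y \<in> Obj G" using a by (simp_all add: grothendieck_simps(2))
    then have o: "fst ?x \<in> Obj \<I>" "snd ?x \<in> Obj (E0_obj E (fst ?x))"
      "fst ?y \<in> Obj \<I>" "snd ?y \<in> Obj (E0_obj E (fst ?y))" by (simp_all add: grothendieck_simps(1))
    have l: "?l \<in> hom \<I> (fst ?x) (fst ?y)"
      and f: "?f \<in> hom (E0_obj E (fst ?y)) (fobj (E0_arr E ?l) (snd ?x)) (snd ?y)"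
      using a by (simp_all add: grothendieck_simps(2))
    interpret Ey: Functor "E0_obj E (fst ?y)" C "E1_obj E (fst ?y)" by (rule E1_Functor[OF o(3)])
    note t = diag_homD[OF E_farr(2)[OF l]]
    have f': "?f \<in> Arr (E0_obj E (fst ?y))" "Cod (E0_obj E (fst ?y)) ?f = snd ?y"
      "Dom (E0_obj E (fst ?y)) ?f = fobj (E0_arr E ?l) (snd ?x)"
      using f by (auto simp: hom_iff)
    have "colim_unit ?y \<odot>\<^bsub>C\<^esub> farr (snd (mu C (\<I>, E))) a =
      (snd (c (fobj E (fst ?y))) (snd ?y) \<odot>\<^bsub>C\<^esub> farr (E1_obj E (fst ?y)) ?f) \<odot>\<^bsub>C\<^esub> E1_arr E ?l (snd ?x)"
      using C.assoc[OF t(4)[OF o(2)] Ey.farr_hom[OF f] coprojection(1)[OF o(3,4)]] xy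
      by (simp add: mu_simps(3)[OF a] colim_unit_def)
    also have "\<dots> = snd (c (fobj E (fst ?y))) (fobj (E0_arr E ?l) (snd ?x)) \<odot>\<^bsub>C\<^esub> E1_arr E ?l (snd ?x)"
      using coprojection(2)[OF o(3) f'(1)] f'(2,3) by simp
    also have "\<dots> = farr ?N ?l \<odot>\<^bsub>C\<^esub> colim_unit ?x"
      using colim_push_farr[OF l o(2)] xy by (simp add: colim_unit_def)
    finally show "colim_unit (Cod G a) \<odot>\<^bsub>C\<^esub> farr (snd (mu C (\<I>, E))) a =
      farr ?N (farr (grothendieck_proj \<I> (E0_obj E) (E0_arr E)) a) \<odot>\<^bsub>C\<^esub> colim_unit (Dom G a)"
      using a by (simp add: grothendieck_simps(3,4) del: farr_func_comp)
  qed

text \<open>\<open>E\<close> preserves identities, so \<open>E1_arr E (Id \<I> i)\<close> consists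
  of identities and \<open>mu\<close> restricts on the fibre over \<open>i\<close> to
  \<open>E1_obj E i\<close>, along the identification of \<open>X\<close> with \<open>(i, X)\<close>
  and of \<open>f\<close> with the arrow having base \<open>Id \<I> i\<close> and fibre component
  \<open>f\<close>. The chosen colimit of \<open>fobj E i\<close> is then a colimit over the
  fibre.\<close>

lemma fibrewise_colimit_unit:
  assumes M: "Functor G C (snd (mu C (\<I>, E)))"
  shows "fibrewise_colimit G \<I> C (grothendieck_proj \<I> (E0_obj E) (E0_arr E))
    (snd (mu C (\<I>, E))) (func_comp \<I> (colim_functor C c) E) colim_unit"
  unfolding fibrewise_colimit_def
proof
  fix i assume i: "i \<in> Obj \<I>"
  let ?\<pi> = "grothendieck_proj \<I> (E0_obj E) (E0_arr E)" and ?M = "snd (mu C (\<I>, E))"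
  interpret Ei: Functor "E0_obj E i" C "E1_obj E i" by (rule E1_Functor[OF i])
  show "is_colimit C (fibre_diagram G \<I> ?\<pi> ?M i) (fobj (func_comp \<I> (colim_functor C c) E) i) colim_unit"
    unfolding fibre_colimit_iff
  proof (intro conjI allI impI)
    show "is_cocone C (fibre_diagram G \<I> ?\<pi> ?M i) (fobj (func_comp \<I> (colim_functor C c) E) i) colim_unit"
      by (rule fibre_cocone[OF colim_unit_hom[OF M] Functor_colim_push i])
    fix b \<kappa> assume "is_cocone C (fibre_diagram G \<I> ?\<pi> ?M i) b \<kappa>"
    note \<kappa> = this[unfolded \<pi>.fibre_cocone_iff[OF M i]]
    have x: "(i, X) \<in> Obj G" if "X \<in> Obj (E0_obj E i)" for X
      using that i by (simp add: grothendieck_simps(1))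
    have fib: "x \<in> Obj G \<and> fobj ?\<pi> x = i \<longleftrightarrow> (\<exists>X\<in>Obj (E0_obj E i). x = (i, X))" for x
      by (cases x) (auto simp: grothendieck_simps(1) i)
    have "is_cocone C (E0_obj E i, E1_obj E i) b (\<lambda>X. \<kappa> (i, X))"
      unfolding is_cocone_iff
    proof (intro conjI ballI)
      show "b \<in> Obj C" using \<kappa> by simp
      show "\<kappa> (i, X) \<in> hom C (fobj (E1_obj E i) X) b" if "X \<in> Obj (E0_obj E i)" for X
        using \<kappa> x[OF that] by (auto simp: mu_simps(2))
      fix f assume f: "f \<in> Arr (E0_obj E i)"
      let ?X = "Dom (E0_obj E i) f" and ?Y = "Cod (E0_obj E i) f"
      let ?a = "((i, ?X), (Id \<I> i, f), (i, ?Y))"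
      have o: "?X \<in> Obj (E0_obj E i)" "?Y \<in> Obj (E0_obj E i)"
        using f by (simp_all add: Ei.A.Dom_closed Ei.A.Cod_closed)
      have a: "?a \<in> Arr G"
        using x[OF o(1)] x[OF o(2)] f i o by (simp add: grothendieck_simps(2) hom_iff)
      moreover have "farr ?\<pi> ?a = Id \<I> i" using a by simp
      ultimately have "\<kappa> (Cod G ?a) \<odot>\<^bsub>C\<^esub> farr ?M ?a = \<kappa> (Dom G ?a)" using \<kappa> by blast
      moreover have "farr ?M ?a = farr (E1_obj E i) f"
        using mu_simps(3)[OF a] f o by (simp add: E_Id(2)[OF i])
      ultimately show "\<kappa> (i, ?Y) \<odot>\<^bsub>C\<^esub> farr (E1_obj E i) f = \<kappa> (i, ?X)"
        by (simp add: grothendieck_simps(3,4))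
    qed (rule Ei.Functor_axioms)
    moreover have "is_colimit C (E0_obj E i, E1_obj E i) (fst (c (fobj E i))) (snd (c (fobj E i)))"
      using small_diagram_colimit[OF choice E_small[OF i]] by (simp add: E0_obj_def E1_obj_def)
    ultimately have ex1: "\<exists>!u. u \<in> hom C (fst (c (fobj E i))) b \<and>
        (\<forall>X\<in>Obj (E0_obj E i). u \<odot>\<^bsub>C\<^esub> snd (c (fobj E i)) X = \<kappa> (i, X))"
      by (rule colimit_factor[rotated])
    have eq: "(\<forall>X\<in>Obj (E0_obj E i). u \<odot>\<^bsub>C\<^esub> snd (c (fobj E i)) X = \<kappa> (i, X)) \<longleftrightarrow>
      (\<forall>x\<in>Obj G. fobj ?\<pi> x = i \<longrightarrow> u \<odot>\<^bsub>C\<^esub> colim_unit x = \<kappa> x)" (is "?l = ?r") for u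
    proof
      show ?r if ?l
      proof (intro ballI impI)
        fix x assume "x \<in> Obj G" "fobj ?\<pi> x = i"
        then obtain X where "X \<in> Obj (E0_obj E i)" "x = (i, X)" using fib[of x] by blast
        with that \<open>x \<in> Obj G\<close> show "u \<odot>\<^bsub>C\<^esub> colim_unit x = \<kappa> x" by (simp add: colim_unit_def)
      qed
      show ?l if ?r
      proof
        fix X assume X: "X \<in> Obj (E0_obj E i)"
        show "u \<odot>\<^bsub>C\<^esub> snd (c (fobj E i)) X = \<kappa> (i, X)"
          using bspec[OF that x[OF X]] x[OF X] by (simp add: colim_unit_def)
      qed
    qed
    show "\<exists>!u. u \<in> hom C (fobj (func_comp \<I> (colim_functor C c) E) i) b \<and>
        (\<forall>x\<in>Obj G. fobj ?\<pi> x = i \<longrightarrow> u \<odot>\<^bsub>C\<^esub> colim_unit x = \<kappa> x)"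
      unfolding colim_push_fobj[OF i] by (rule ex1_conj_cong[OF ex1 eq])
  qed
qed

end

end

lemma partial_colimit_imp_left_kan:
  assumes "category C" "colimit_choice C c"
    and "partial_colimit C c (J, D) (K, D')"
  shows "\<exists>F \<eta>. split_opfibration J K F \<and> is_pointwise_left_kan J K C F D D' \<eta>"
proof -
  from assms(3) obtain \<I> E where E: "(\<I>, E) \<in> small_diagrams (Diag C)"
    and mu: "diag_iso C (mu C (\<I>, E)) (J, D)"
    and push: "diag_iso C (\<I>, func_comp \<I> (colim_functor C c) E) (K, D')"
    by (auto simp: partial_colimit_def partial_evaluation_def colim_push_def)
  have "Functor \<I> (Diag C) E" by (rule small_diagramsD(2)[OF E])
  then interpret E: diagram_of_diagrams C \<I> E
    using assms(1) by (simp add: diagram_of_diagrams_def)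
  let ?\<pi> = "grothendieck_proj \<I> (E0_obj E) (E0_arr E)" and ?M = "snd (mu C (\<I>, E))"
  have mu_eq: "mu C (\<I>, E) = (E.G, ?M)" by (simp add: prod_eq_iff E.mu_simps(1))
  have "diag_iso C (E.G, ?M) (J, D)" using mu by (simp only: mu_eq[symmetric])
  then obtain R \<rho> R' \<rho>' where R: "diag_isomorphism C E.G ?M J D R \<rho> R' \<rho>'"
    by (rule diag_isoE)
  obtain S \<sigma> S' \<sigma>' where S: "diag_isomorphism C \<I> (func_comp \<I> (colim_functor C c) E) K D' S \<sigma> S' \<sigma>'"
    using push by (rule diag_isoE)
  interpret R: diag_isomorphism C E.G ?M J D R \<rho> R' \<rho>' by (rule R)
  interpret S: diag_isomorphism C \<I> "func_comp \<I> (colim_functor C c) E" K D' S \<sigma> S' \<sigma>' by (rule S)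
  let ?\<zeta> = "E.colim_unit c"
  have \<zeta>: "(?\<pi>, ?\<zeta>) \<in> diag_hom C (E.G, ?M) (\<I>, func_comp \<I> (colim_functor C c) E)"
    by (rule E.colim_unit_hom[OF assms(2) R.D.Functor_axioms])
  \<comment> \<open>The composite in Diag(C) from \<open>D\<close> through
    \<open>mu C (\<I>, E)\<close> and \<open>colim_push C c (\<I>, E)\<close> to \<open>D'\<close>:
    its functor is the required split opfibration, its natural transformation the unit.\<close>
  define F where "F = fst (diag_comp C J (S, \<sigma>) (diag_comp C J (?\<pi>, ?\<zeta>) (R', \<rho>')))"
  define \<eta> where "\<eta> = snd (diag_comp C J (S, \<sigma>) (diag_comp C J (?\<pi>, ?\<zeta>) (R', \<rho>')))"
  have F: "(F, \<eta>) = diag_comp C J (S, \<sigma>) (diag_comp C J (?\<pi>, ?\<zeta>) (R', \<rho>'))"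
    by (simp add: F_def \<eta>_def)
  then have F_eq: "F = func_comp J S (func_comp J ?\<pi> R')" by (simp add: diag_comp_simp)
  have "split_opfibration E.G \<I> ?\<pi>"
    using E.is_splitting_grothendieck E.\<pi>.Functor_axioms by (auto simp: split_opfibration_def)
  then have split: "split_opfibration J K F"
    unfolding F_eq by (rule split_opfibration_conjugate[OF R.inverse_functors S.inverse_functors])
  then obtain \<chi> where "split_opfib J K F \<chi>"
    by (auto simp: split_opfibration_def split_opfib_def split_opfib_axioms_def)
  then interpret F: split_opfib J K F \<chi> .
  have F_hom: "(F, \<eta>) \<in> diag_hom C (J, D) (K, D')"
    unfolding F by (rule diag_comp_hom[OF S.D'.Functor_axioms
      diag_comp_hom[OF S.D.Functor_axioms R.inv_hom \<zeta>] S.hom])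
  have "fibrewise_colimit J K C F D D' \<eta>"
    by (rule fibrewise_colimit_conjugate[OF R S \<zeta>
      E.fibrewise_colimit_unit[OF assms(2) R.D.Functor_axioms] F])
  then have "is_pointwise_left_kan J K C F D D' \<eta>"
    unfolding is_pointwise_left_kan_def
    using F.fibrewise_colimit_imp_left_kan[OF F_hom S.D'.Functor_axioms]
      F.fibrewise_colimit_imp_pointwise[OF F_hom S.D'.Functor_axioms] by blast
  with split show ?thesis by blast
qed

section \<open>Split opfibrations as diagrams of fibres\<close>

lemma small_subset: "small U A \<Longrightarrow> B \<subseteq> A \<Longrightarrow> small U B"
  unfolding small_def by (rule lesspoll_trans1[OF subset_imp_lepoll])

lemma fibre_diagram_simps [simp]:
  "X \<in> Obj J \<Longrightarrow> fobj F X = k \<Longrightarrow> fobj (snd (fibre_diagram J K F D k)) X = fobj D X"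
  "f \<in> Arr J \<Longrightarrow> farr F f = Id K k \<Longrightarrow> farr (snd (fibre_diagram J K F D k)) f = farr D f"
  by (simp_all add: fibre_diagram_def)

lemma fibre_diagram_eq: "fibre_diagram J K F D k = (fibre J K F k, snd (fibre_diagram J K F D k))"
  by (simp add: fibre_diagram_def)

section \<open>Transport between fibres along chosen lifts\<close>

context split_opfib
begin

text \<open>On a vertical arrow \<open>f\<close> this is the unique vertical arrow that closes the
  square formed by \<open>f\<close> and the lifts of \<open>l\<close> at its two ends.\<close>

definition push :: "'l \<Rightarrow> ('i, 'j, 'i, 'j) func" where
  "push l =
     \<lparr>fobj = (\<lambda>X\<in>Obj (fibre J K F (Dom K l)). Cod J (\<chi> X l)),
      farr = (\<lambda>f\<in>Arr (fibre J K F (Dom K l)). vertical (\<chi> (Cod J f) l \<odot>\<^bsub>J\<^esub> f))\<rparr>"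

lemma push_fobj [simp]:
  "X \<in> Obj J \<Longrightarrow> Dom K l = fobj F X \<Longrightarrow> fobj (push l) X = Cod J (\<chi> X l)"
  by (simp add: push_def)

lemma vertical_ends:
  assumes "f \<in> Arr J" "farr F f = Id K k" "k \<in> Obj K"
  shows "Dom J f \<in> Obj J" "Cod J f \<in> Obj J" "fobj F (Dom J f) = k" "fobj F (Cod J f) = k"
  using assms A.Dom_closed A.Cod_closed vertical_fobj[OF assms] by auto

lemma push_farr:
  assumes f: "f \<in> Arr J" "farr F f = Id K (Dom K l)" and l: "l \<in> Arr K"
  shows "farr (push l) f \<in> Arr J" "Dom J (farr (push l) f) = Cod J (\<chi> (Dom J f) l)"
    "Cod J (farr (push l) f) = Cod J (\<chi> (Cod J f) l)" "farr F (farr (push l) f) = Id K (Cod K l)"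
    "farr (push l) f \<odot>\<^bsub>J\<^esub> \<chi> (Dom J f) l = \<chi> (Cod J f) l \<odot>\<^bsub>J\<^esub> f"
proof -
  note e = vertical_ends[OF f B.Dom_closed[OF l]]
  let ?g = "\<chi> (Cod J f) l \<odot>\<^bsub>J\<^esub> f"
  have g: "?g \<in> Arr J" "Dom J ?g = Dom J f" "Cod J ?g = Cod J (\<chi> (Cod J f) l)" "farr F ?g = l"
    using f l e by (simp_all add: farr_Comp')
  have p: "farr (push l) f = vertical ?g" using f by (simp add: push_def)
  have "fobj F (Cod J (\<chi> (Cod J f) l)) = Cod K l" using e l by simp
  then show "farr (push l) f \<in> Arr J" "Dom J (farr (push l) f) = Cod J (\<chi> (Dom J f) l)"
    "Cod J (farr (push l) f) = Cod J (\<chi> (Cod J f) l)" "farr F (farr (push l) f) = Id K (Cod K l)"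
    "farr (push l) f \<odot>\<^bsub>J\<^esub> \<chi> (Dom J f) l = ?g"
    using vertical[OF g(1), unfolded g(2,4)] unfolding p g(3) by simp_all
qed

text \<open>The square determines the transported arrow, so every functoriality law of
  \<open>push\<close> reduces to pasting squares.\<close>

lemma push_farr_eqI:
  assumes f: "f \<in> Arr J" "farr F f = Id K (Dom K l)" and l: "l \<in> Arr K"
    and v: "v \<in> Arr J" "Dom J v = Cod J (\<chi> (Dom J f) l)" "farr F v = Id K (Cod K l)"
      "v \<odot>\<^bsub>J\<^esub> \<chi> (Dom J f) l = \<chi> (Cod J f) l \<odot>\<^bsub>J\<^esub> f"
  shows "farr (push l) f = v"
proof -
  note e = vertical_ends[OF f B.Dom_closed[OF l]]
  have "farr (push l) f = vertical (\<chi> (Cod J f) l \<odot>\<^bsub>J\<^esub> f)" using f by (simp add: push_def)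
  also have "\<dots> = v" by (rule vertical_eqI[OF e(1) l e(3)[symmetric] v])
  finally show ?thesis .
qed

lemma Functor_push:
  assumes l: "l \<in> Arr K"
  shows "Functor (fibre J K F (Dom K l)) (fibre J K F (Cod K l)) (push l)"
proof -
  interpret A': category "fibre J K F (Dom K l)" by (rule category_fibre[OF B.Dom_closed[OF l]])
  interpret B': category "fibre J K F (Cod K l)" by (rule category_fibre[OF B.Cod_closed[OF l]])
  show ?thesis
  proof (unfold_locales, goal_cases)
    case (3 X)
    then show ?case using l by simp
  next
    case (4 f X Y)
    then have f: "f \<in> Arr J" "farr F f = Id K (Dom K l)" "Dom J f = X" "Cod J f = Y" by (auto simp: hom_iff)
    note e = vertical_ends[OF f(1,2) B.Dom_closed[OF l], unfolded f(3,4)]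
    show ?case using push_farr[OF f(1,2) l] f(3,4) e l by (simp add: hom_iff)
  next
    case (5 X)
    then have X: "X \<in> Obj J" "fobj F X = Dom K l" by simp_all
    have "farr (push l) (Id J X) = Id J (Cod J (\<chi> X l))"
      by (rule push_farr_eqI) (use X l in \<open>simp_all add: farr_Id\<close>)
    then show ?case using X l by simp
  next
    case (6 f X Y g Z)
    then have f: "f \<in> Arr J" "farr F f = Id K (Dom K l)" and g: "g \<in> Arr J" "farr F g = Id K (Dom K l)"
      and fg: "Cod J f = Dom J g" by (auto simp: hom_iff)
    note e = vertical_ends[OF f B.Dom_closed[OF l]] vertical_ends[OF g B.Dom_closed[OF l]]
    note p = push_farr[OF f l] and q = push_farr[OF g l]
    have "farr (push l) (g \<odot>\<^bsub>J\<^esub> f) = farr (push l) g \<odot>\<^bsub>J\<^esub> farr (push l) f"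
    proof (rule push_farr_eqI)
      show "g \<odot>\<^bsub>J\<^esub> f \<in> Arr J" "farr F (g \<odot>\<^bsub>J\<^esub> f) = Id K (Dom K l)"
        using f g fg l by (simp_all add: farr_Comp' B.Dom_closed)
      have "(farr (push l) g \<odot>\<^bsub>J\<^esub> farr (push l) f) \<odot>\<^bsub>J\<^esub> \<chi> (Dom J f) l =
        (farr (push l) g \<odot>\<^bsub>J\<^esub> \<chi> (Dom J g) l) \<odot>\<^bsub>J\<^esub> f"
        using p q(1-4) fg f(1) e l by (simp add: A.Comp_assoc)
      also have "\<dots> = \<chi> (Cod J g) l \<odot>\<^bsub>J\<^esub> g \<odot>\<^bsub>J\<^esub> f"
        unfolding q(5) using fg f(1) g(1) e l by (simp add: A.Comp_assoc)
      finally show "(farr (push l) g \<odot>\<^bsub>J\<^esub> farr (push l) f) \<odot>\<^bsub>J\<^esub> \<chi> (Dom J (g \<odot>\<^bsub>J\<^esub> f)) l =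
        \<chi> (Cod J (g \<odot>\<^bsub>J\<^esub> f)) l \<odot>\<^bsub>J\<^esub> g \<odot>\<^bsub>J\<^esub> f"
        using f(1) g(1) fg by simp
      show "farr F (farr (push l) g \<odot>\<^bsub>J\<^esub> farr (push l) f) = Id K (Cod K l)"
        using p q fg l by (simp add: farr_Comp' B.Cod_closed)
    qed (use p q fg f(1) g(1) l in simp_all)
    then show ?case by simp
  qed (auto simp: push_def)
qed

lemma push_Id:
  assumes k: "k \<in> Obj K"
  shows "push (Id K k) = func_id (fibre J K F k)"
proof (rule func_eqI)
  show "Functor (fibre J K F k) (fibre J K F k) (push (Id K k))"
    using Functor_push[of "Id K k"] k by simp
  show "Functor (fibre J K F k) (fibre J K F k) (func_id (fibre J K F k))"
    by (rule Functor_func_id[OF category_fibre[OF k]])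
  fix X assume "X \<in> Obj (fibre J K F k)"
  then have "X \<in> Obj J" "fobj F X = k" by simp_all
  then show "fobj (push (Id K k)) X = fobj (func_id (fibre J K F k)) X"
    using k lift_Id[of X] by simp
next
  fix f assume "f \<in> Arr (fibre J K F k)"
  then have f: "f \<in> Arr J" "farr F f = Id K k" by simp_all
  note e = vertical_ends[OF f k]
  have "farr (push (Id K k)) f = f"
    by (rule push_farr_eqI) (use f k e lift_Id[OF e(1)] lift_Id[OF e(2)] in simp_all)
  then show "farr (push (Id K k)) f = farr (func_id (fibre J K F k)) f" using f by simp
qed

text \<open>This is where the splitting is felt: \<open>lift_Comp\<close> factors the lift of a
  composite as an equality, so the squares for \<open>l\<close> and \<open>l'\<close> paste to the
  one for the composite. With arbitrary opcartesian lifts the two sides would in general be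
  isomorphic but not equal.\<close>

lemma push_Comp:
  assumes l: "l \<in> Arr K" and l': "l' \<in> Arr K" and ll': "Cod K l = Dom K l'"
  shows "push (l' \<odot>\<^bsub>K\<^esub> l) = func_comp (fibre J K F (Dom K l)) (push l') (push l)"
proof (rule func_eqI)
  show "Functor (fibre J K F (Dom K l)) (fibre J K F (Cod K l')) (push (l' \<odot>\<^bsub>K\<^esub> l))"
    using Functor_push[of "l' \<odot>\<^bsub>K\<^esub> l"] l l' ll' by simp
  show "Functor (fibre J K F (Dom K l)) (fibre J K F (Cod K l'))
      (func_comp (fibre J K F (Dom K l)) (push l') (push l))"
    by (rule Functor_func_comp[OF Functor_push[OF l] Functor_push[OF l', folded ll']])
  fix X assume "X \<in> Obj (fibre J K F (Dom K l))"
  then have X: "X \<in> Obj J" "fobj F X = Dom K l" by simp_all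
  then show "fobj (push (l' \<odot>\<^bsub>K\<^esub> l)) X = fobj (func_comp (fibre J K F (Dom K l)) (push l') (push l)) X"
    using l l' ll' by (simp add: lift_Comp)
next
  fix f assume "f \<in> Arr (fibre J K F (Dom K l))"
  then have f: "f \<in> Arr J" "farr F f = Id K (Dom K l)" by simp_all
  note e = vertical_ends[OF f B.Dom_closed[OF l]]
  note p = push_farr[OF f l]
  have "farr F (farr (push l) f) = Id K (Dom K l')" using p(4) ll' by simp
  note q = push_farr[OF p(1) this l', unfolded p(2,3)]
  have X: "Cod J (\<chi> (Dom J f) l) \<in> Obj J" "fobj F (Cod J (\<chi> (Dom J f) l)) = Dom K l'"
    "Cod J (\<chi> (Cod J f) l) \<in> Obj J" "fobj F (Cod J (\<chi> (Cod J f) l)) = Dom K l'"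
    using e l ll' by simp_all
  have lift: "\<chi> (Dom J f) (l' \<odot>\<^bsub>K\<^esub> l) = \<chi> (Cod J (\<chi> (Dom J f) l)) l' \<odot>\<^bsub>J\<^esub> \<chi> (Dom J f) l"
    "\<chi> (Cod J f) (l' \<odot>\<^bsub>K\<^esub> l) = \<chi> (Cod J (\<chi> (Cod J f) l)) l' \<odot>\<^bsub>J\<^esub> \<chi> (Cod J f) l"
    using e l l' ll' by (simp_all add: lift_Comp)
  have "farr (push (l' \<odot>\<^bsub>K\<^esub> l)) f = farr (push l') (farr (push l) f)"
  proof (rule push_farr_eqI)
    have "farr (push l') (farr (push l) f) \<odot>\<^bsub>J\<^esub> \<chi> (Dom J f) (l' \<odot>\<^bsub>K\<^esub> l) =
      (farr (push l') (farr (push l) f) \<odot>\<^bsub>J\<^esub> \<chi> (Cod J (\<chi> (Dom J f) l)) l') \<odot>\<^bsub>J\<^esub> \<chi> (Dom J f) l"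
      unfolding lift using q(1-4) X e l l' by (simp add: A.Comp_assoc)
    also have "\<dots> = \<chi> (Cod J (\<chi> (Cod J f) l)) l' \<odot>\<^bsub>J\<^esub> farr (push l) f \<odot>\<^bsub>J\<^esub> \<chi> (Dom J f) l"
      unfolding q(5) using p(1-4) X e l l' by (simp add: A.Comp_assoc)
    also have "\<dots> = \<chi> (Cod J f) (l' \<odot>\<^bsub>K\<^esub> l) \<odot>\<^bsub>J\<^esub> f"
      unfolding p(5) lift using X e l l' f(1) by (simp add: A.Comp_assoc)
    finally show "farr (push l') (farr (push l) f) \<odot>\<^bsub>J\<^esub> \<chi> (Dom J f) (l' \<odot>\<^bsub>K\<^esub> l) =
      \<chi> (Cod J f) (l' \<odot>\<^bsub>K\<^esub> l) \<odot>\<^bsub>J\<^esub> f" .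
  qed (use f p q l l' ll' X e in \<open>simp_all add: lift\<close>)
  then show "farr (push (l' \<odot>\<^bsub>K\<^esub> l)) f = farr (func_comp (fibre J K F (Dom K l)) (push l') (push l)) f"
    using f by simp
qed

text \<open>The inverse of the Grothendieck construction with values in Diag(C). Besides the
  transport functor, \<open>l\<close> carries the natural transformation obtained by applying
  \<open>D\<close> to the lifts of \<open>l\<close>; it lets \<open>mu\<close> recover
  \<open>D\<close> on arrows that are not vertical.\<close>

definition fibres where
  "fibres D =
     \<lparr>fobj = (\<lambda>k\<in>Obj K. fibre_diagram J K F D k),
      farr = (\<lambda>l\<in>Arr K. (fibre_diagram J K F D (Dom K l),
        (push l, \<lambda>X\<in>Obj (fibre J K F (Dom K l)). farr D (\<chi> X l)),
        fibre_diagram J K F D (Cod K l)))\<rparr>"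

text \<open>The naturality square is the image under \<open>D\<close> of the square that defines
  \<open>push\<close> on arrows.\<close>

lemma fibres_hom:
  assumes D: "Functor J C D" and l: "l \<in> Arr K"
  shows "(push l, \<lambda>X\<in>Obj (fibre J K F (Dom K l)). farr D (\<chi> X l)) \<in>
    diag_hom C (fibre_diagram J K F D (Dom K l)) (fibre_diagram J K F D (Cod K l))"
proof -
  interpret D: Functor J C D by fact
  note k = B.Dom_closed[OF l] B.Cod_closed[OF l]
  show ?thesis
  proof (subst (1 2) fibre_diagram_eq, rule diag_homI[OF Functor_push[OF l]
      Functor_fibre_diagram[OF D k(1), unfolded fst_fibre_diagram]
      Functor_fibre_diagram[OF D k(2), unfolded fst_fibre_diagram]])
    fix X assume "X \<in> Obj (fibre J K F (Dom K l))"
    then have X: "X \<in> Obj J" "fobj F X = Dom K l" by simp_all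
    then show "(\<lambda>X\<in>Obj (fibre J K F (Dom K l)). farr D (\<chi> X l)) X
      \<in> hom C (fobj (snd (fibre_diagram J K F D (Dom K l))) X)
          (fobj (snd (fibre_diagram J K F D (Cod K l))) (fobj (push l) X))"
      using l by (simp add: hom_iff)
  next
    fix f assume "f \<in> Arr (fibre J K F (Dom K l))"
    then have f: "f \<in> Arr J" "farr F f = Id K (Dom K l)" by simp_all
    note e = vertical_ends[OF f k(1)] and p = push_farr[OF f l]
    have "farr D (\<chi> (Cod J f) l) \<odot>\<^bsub>C\<^esub> farr D f = farr D (farr (push l) f) \<odot>\<^bsub>C\<^esub> farr D (\<chi> (Dom J f) l)"
      using arg_cong[OF p(5), of "farr D"] p(1,2) e l f(1) by (simp add: D.farr_Comp')
    then show "(\<lambda>X\<in>Obj (fibre J K F (Dom K l)). farr D (\<chi> X l)) (Cod (fibre J K F (Dom K l)) f) \<odot>\<^bsub>C\<^esub>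
        farr (snd (fibre_diagram J K F D (Dom K l))) f =
      farr (snd (fibre_diagram J K F D (Cod K l))) (farr (push l) f) \<odot>\<^bsub>C\<^esub>
        (\<lambda>X\<in>Obj (fibre J K F (Dom K l)). farr D (\<chi> X l)) (Dom (fibre J K F (Dom K l)) f)"
      using f e p by simp
  qed simp
qed

end

text \<open>Index functors compose strictly by \<open>push_Id\<close> and \<open>push_Comp\<close>,
  natural transformations because \<open>D\<close> is applied to lifts that are themselves
  functorial. The fibres are small as parts of \<open>J\<close>.\<close>

lemma Functor_fibres:
  fixes J K :: "('u, 'u) cat" and D :: "('u, 'u, 'o, 'm) func"
  assumes "split_opfib J K F \<chi>" and J: "small_category TYPE('u) J" and D: "Functor J C D"
  shows "Functor K (Diag C) (split_opfib.fibres J K F \<chi> D)"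
proof -
  interpret split_opfib J K F \<chi> by fact
  interpret D: Functor J C D by fact
  interpret Diag: category "Diag C :: (('u, 'o, 'm) sdiagram, _) cat" by (rule category_Diag)
  have small: "fibre_diagram J K F D k \<in> small_diagrams C" if k: "k \<in> Obj K" for k
  proof -
    have "small TYPE('u) (Obj (fibre J K F k))" "small TYPE('u) (Arr (fibre J K F k))"
      using J by (auto simp: small_category_def intro: small_subset)
    then have "small_category TYPE('u) (fibre J K F k)"
      by (simp add: small_category_def category_fibre[OF k])
    with Functor_fibre_diagram[OF D k] show ?thesis
      by (subst fibre_diagram_eq) (simp add: small_diagrams_def)
  qed
  show ?thesis
  proof (unfold_locales, goal_cases)
    case (3 k)
    then show ?case using small by (simp add: fibres_def)
  next
    case (4 l k k')
    then have l: "l \<in> Arr K" "Dom K l = k" "Cod K l = k'" "k \<in> Obj K" "k' \<in> Obj K"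
      using B.hom_Obj[OF 4] by (auto simp: hom_iff)
    then show ?case
      using fibres_hom[OF D l(1)] small[OF l(4)] small[OF l(5)]
      by (simp add: fibres_def Diag_hom_iff)
  next
    case (5 k)
    have "(\<lambda>X\<in>Obj (fibre J K F k). farr D (\<chi> X (Id K k))) =
      (\<lambda>X\<in>Obj (fibre J K F k). Id C (fobj (snd (fibre_diagram J K F D k)) X))"
    proof (rule restrict_ext)
      fix X assume "X \<in> Obj (fibre J K F k)"
      then have X: "X \<in> Obj J" "fobj F X = k" by simp_all
      then show "farr D (\<chi> X (Id K k)) = Id C (fobj (snd (fibre_diagram J K F D k)) X)"
        using lift_Id[OF X(1)] by (simp add: D.farr_Id)
    qed
    then have "diag_id C (fibre_diagram J K F D k) =
      (push (Id K k), \<lambda>X\<in>Obj (fibre J K F k). farr D (\<chi> X (Id K k)))"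
      using 5 by (subst fibre_diagram_eq) (simp add: diag_id_def push_Id)
    then show ?case using 5 by (simp add: fibres_def)
  next
    case (6 l k k' l' k'')
    then have l: "l \<in> Arr K" "Dom K l = k" "Cod K l = k'" and l': "l' \<in> Arr K" "Dom K l' = k'" "Cod K l' = k''"
      by (auto simp: hom_iff)
    have "(\<lambda>X\<in>Obj (fibre J K F k). farr D (\<chi> X (l' \<odot>\<^bsub>K\<^esub> l))) =
      (\<lambda>X\<in>Obj (fibre J K F k). (\<lambda>X\<in>Obj (fibre J K F k'). farr D (\<chi> X l')) (fobj (push l) X) \<odot>\<^bsub>C\<^esub>
        (\<lambda>X\<in>Obj (fibre J K F k). farr D (\<chi> X l)) X)"
    proof (rule restrict_ext)
      fix X assume "X \<in> Obj (fibre J K F k)"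
      then have X: "X \<in> Obj J" "fobj F X = k" by simp_all
      then show "farr D (\<chi> X (l' \<odot>\<^bsub>K\<^esub> l)) =
        (\<lambda>X\<in>Obj (fibre J K F k'). farr D (\<chi> X l')) (fobj (push l) X) \<odot>\<^bsub>C\<^esub>
          (\<lambda>X\<in>Obj (fibre J K F k). farr D (\<chi> X l)) X"
        using l l' by (simp add: lift_Comp D.farr_Comp')
    qed
    then have "diag_comp C (fibre J K F k) (push l', \<lambda>X\<in>Obj (fibre J K F k'). farr D (\<chi> X l'))
        (push l, \<lambda>X\<in>Obj (fibre J K F k). farr D (\<chi> X l)) =
      (push (l' \<odot>\<^bsub>K\<^esub> l), \<lambda>X\<in>Obj (fibre J K F k). farr D (\<chi> X (l' \<odot>\<^bsub>K\<^esub> l)))"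
      using push_Comp[OF l(1) l'(1)] l l' by (simp add: diag_comp_simp)
    then show ?case using l l' by (simp add: fibres_def)
  qed (simp_all add: fibres_def)
qed

section \<open>The Grothendieck construction of the fibres\<close>

locale split_opfib_diagram = split_opfib J K F \<chi> + D: Functor J C D
  for J K :: "('u, 'u) cat" and F \<chi> and C :: "('o, 'm) cat" and D +
  assumes J_small: "small_category TYPE('u) J"
begin

sublocale fib: diagram_of_diagrams C K "fibres D"
  by (intro diagram_of_diagrams.intro D.B.category_axioms
    Functor_fibres[OF split_opfib_axioms J_small D.Functor_axioms])

lemma fibres_simps [simp]:
  "k \<in> Obj K \<Longrightarrow> fobj (fibres D) k = fibre_diagram J K F D k"
  "k \<in> Obj K \<Longrightarrow> E0_obj (fibres D) k = fibre J K F k"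
  "k \<in> Obj K \<Longrightarrow> E1_obj (fibres D) k = snd (fibre_diagram J K F D k)"
  "l \<in> Arr K \<Longrightarrow> E0_arr (fibres D) l = push l"
  "l \<in> Arr K \<Longrightarrow> E1_arr (fibres D) l = (\<lambda>X\<in>Obj (fibre J K F (Dom K l)). farr D (\<chi> X l))"
  by (simp_all add: fibres_def E0_obj_def E1_obj_def E0_arr_def E1_arr_def)

lemma G_Obj: "x \<in> Obj fib.G \<longleftrightarrow> snd x \<in> Obj J \<and> fobj F (snd x) = fst x"
  using fobj_closed[of "snd x"] by (auto simp: grothendieck_simps(1))

lemma G_Arr:
  "a \<in> Arr fib.G \<longleftrightarrow> fst a \<in> Obj fib.G \<and> snd (snd a) \<in> Obj fib.G \<and>
    arr_base a \<in> hom K (fst (fst a)) (fst (snd (snd a))) \<and>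
    arr_fibre a \<in> Arr J \<and> farr F (arr_fibre a) = Id K (fst (snd (snd a))) \<and>
    Dom J (arr_fibre a) = Cod J (\<chi> (snd (fst a)) (arr_base a)) \<and>
    Cod J (arr_fibre a) = snd (snd (snd a))" (is "?l \<longleftrightarrow> ?r")
proof -
  have "arr_fibre a \<in> hom (E0_obj (fibres D) (fst (snd (snd a))))
      (fobj (E0_arr (fibres D) (arr_base a)) (snd (fst a))) (snd (snd (snd a))) \<longleftrightarrow>
    arr_fibre a \<in> Arr J \<and> farr F (arr_fibre a) = Id K (fst (snd (snd a))) \<and>
    Dom J (arr_fibre a) = Cod J (\<chi> (snd (fst a)) (arr_base a)) \<and>
    Cod J (arr_fibre a) = snd (snd (snd a))"
    if a: "fst a \<in> Obj fib.G" "snd (snd a) \<in> Obj fib.G"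
      "arr_base a \<in> hom K (fst (fst a)) (fst (snd (snd a)))"
  proof -
    have "fst (snd (snd a)) \<in> Obj K" "arr_base a \<in> Arr K" "Dom K (arr_base a) = fobj F (snd (fst a))"
      "snd (fst a) \<in> Obj J"
      using a fobj_closed[of "snd (snd (snd a))"] by (simp_all add: G_Obj hom_iff)
    then show ?thesis by (simp add: hom_iff)
  qed
  then show ?thesis unfolding grothendieck_simps(2)[of a] by blast
qed

text \<open>An arrow of \<open>fib.G\<close> is the datum of a chosen lift followed by a vertical
  arrow. \<open>total\<close> composes the two, and \<open>decompose\<close> recovers them from the
  unique such factorisation of an arrow of \<open>J\<close>.\<close>

definition total where
  "total = \<lparr>fobj = (\<lambda>x\<in>Obj fib.G. snd x),
     farr = (\<lambda>a\<in>Arr fib.G. arr_fibre a \<odot>\<^bsub>J\<^esub> \<chi> (snd (fst a)) (arr_base a))\<rparr>"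

definition decompose where
  "decompose = \<lparr>fobj = (\<lambda>X\<in>Obj J. (fobj F X, X)),
     farr = (\<lambda>g\<in>Arr J. ((fobj F (Dom J g), Dom J g), (farr F g, vertical g), (fobj F (Cod J g), Cod J g)))\<rparr>"

lemma G_ArrD:
  assumes "a \<in> Arr fib.G"
  shows "snd (fst a) \<in> Obj J" "fst (fst a) = fobj F (snd (fst a))"
    "snd (snd (snd a)) \<in> Obj J" "fst (snd (snd a)) = fobj F (snd (snd (snd a)))"
    "arr_base a \<in> Arr K" "Dom K (arr_base a) = fobj F (snd (fst a))"
    "Cod K (arr_base a) = fobj F (snd (snd (snd a)))"
    "arr_fibre a \<in> Arr J" "Dom J (arr_fibre a) = Cod J (\<chi> (snd (fst a)) (arr_base a))"
    "Cod J (arr_fibre a) = snd (snd (snd a))"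
    "farr F (arr_fibre a) = Id K (fobj F (snd (snd (snd a))))"
  using assms by (simp_all add: G_Arr G_Obj hom_iff)

text \<open>Composition in the Grothendieck construction transports the fibre component of
  \<open>a\<close> along the base arrow of \<open>b\<close>. The square that defines
  \<open>push\<close> exchanges this transported arrow with the lift of that base arrow, which puts
  each lift next to its own vertical part.\<close>

lemma Functor_total: "Functor fib.G J total"
proof (unfold_locales, goal_cases)
  case (3 x)
  then show ?case by (simp add: total_def G_Obj)
next
  case (4 a x y)
  then have a: "a \<in> Arr fib.G" "fst a = x" "snd (snd a) = y" and xy: "x \<in> Obj fib.G" "y \<in> Obj fib.G"
    using fib.G.hom_Obj[OF 4] by (auto simp: hom_iff grothendieck_simps(3,4))
  show ?case using G_ArrD[OF a(1)] a xy by (simp add: total_def hom_iff)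
next
  case (5 x)
  then have x: "snd x \<in> Obj J" "fobj F (snd x) = fst x" "fst x \<in> Obj K"
    using fobj_closed[of "snd x"] by (simp_all add: G_Obj)
  have "Id fib.G x \<in> Arr fib.G" using 5 by simp
  then show ?case using 5 x lift_Id[OF x(1)] by (simp add: total_def) (simp add: grothendieck_simps(5))
next
  case (6 a x y b z)
  then have a: "a \<in> Arr fib.G" and b: "b \<in> Arr fib.G" and ab: "b \<odot>\<^bsub>fib.G\<^esub> a \<in> Arr fib.G"
    and y: "snd (snd a) = fst b"
    using fib.G.Comp_hom[OF 6] by (auto simp: hom_iff grothendieck_simps(3,4))
  note p = G_ArrD[OF a, unfolded y] and q = G_ArrD[OF b]
  let ?l = "arr_base a" and ?f = "arr_fibre a" and ?l' = "arr_base b" and ?f' = "arr_fibre b"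
  let ?X = "snd (fst a)"
  have f: "farr F ?f = Id K (Dom K ?l')" using p(11) q(6) by simp
  note r = push_farr[OF p(8) f q(5), unfolded p(9,10)]
  have l: "Cod K ?l = Dom K ?l'" using p(7) q(6) by simp
  have X: "Cod J (\<chi> ?X ?l) \<in> Obj J" "fobj F (Cod J (\<chi> ?X ?l)) = Dom K ?l'"
    using p l by simp_all
  have "farr total (b \<odot>\<^bsub>fib.G\<^esub> a) =
    (?f' \<odot>\<^bsub>J\<^esub> farr (push ?l') ?f) \<odot>\<^bsub>J\<^esub> \<chi> ?X (?l' \<odot>\<^bsub>K\<^esub> ?l)"
  proof -
    have "fst (snd (snd b)) \<in> Obj K" using q(3,4) fobj_closed by simp
    then have "E0_obj (fibres D) (fst (snd (snd b))) = fibre J K F (fst (snd (snd b)))" by simp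
    then show ?thesis using ab q(5) by (simp add: total_def) (simp add: grothendieck_simps(6))
  qed
  also have "\<dots> = ?f' \<odot>\<^bsub>J\<^esub> (farr (push ?l') ?f \<odot>\<^bsub>J\<^esub> \<chi> (Cod J (\<chi> ?X ?l)) ?l') \<odot>\<^bsub>J\<^esub> \<chi> ?X ?l"
    using p(1,5,6) q(5,6,8,9) r(1-4) X l by (simp add: lift_Comp A.Comp_assoc)
  also have "\<dots> = (?f' \<odot>\<^bsub>J\<^esub> \<chi> (snd (fst b)) ?l') \<odot>\<^bsub>J\<^esub> ?f \<odot>\<^bsub>J\<^esub> \<chi> ?X ?l"
    unfolding r(5) using p q by (simp add: A.Comp_assoc)
  also have "\<dots> = farr total b \<odot>\<^bsub>J\<^esub> farr total a"
    using a b by (simp add: total_def)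
  finally show ?case .
qed (simp_all add: total_def)

lemma decompose_Arr: "g \<in> Arr J \<Longrightarrow> farr decompose g \<in> Arr fib.G"
  by (simp add: decompose_def G_Arr G_Obj hom_iff A.Dom_closed A.Cod_closed)

lemma total_decompose: "g \<in> Arr J \<Longrightarrow> farr total (farr decompose g) = g"
  using decompose_Arr[of g] by (simp add: total_def) (simp add: decompose_def)

lemma decompose_total:
  assumes a: "a \<in> Arr fib.G"
  shows "farr decompose (farr total a) = a"
proof -
  note p = G_ArrD[OF a]
  let ?g = "arr_fibre a \<odot>\<^bsub>J\<^esub> \<chi> (snd (fst a)) (arr_base a)"
  have g: "?g \<in> Arr J" "Dom J ?g = snd (fst a)" "Cod J ?g = snd (snd (snd a))"
    using p by simp_all
  have "farr F ?g = arr_base a" using p by (simp add: farr_Comp')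
  moreover have "vertical ?g = arr_fibre a"
    by (rule vertical_eqI[of "snd (fst a)" "arr_base a"]) (use p in simp_all)
  moreover have "farr total a = ?g" using a by (simp add: total_def)
  ultimately show ?thesis using g p(2,4) by (simp add: decompose_def prod_eq_iff)
qed

lemma Functor_decompose: "Functor J fib.G decompose"
proof (rule Functor_inverse[OF Functor_total])
  show "fobj decompose X \<in> Obj fib.G \<and> fobj total (fobj decompose X) = X" if "X \<in> Obj J" for X
    using that by (simp add: decompose_def total_def G_Obj)
  show "farr decompose g \<in> hom fib.G (fobj decompose (Dom J g)) (fobj decompose (Cod J g)) \<and>
    farr total (farr decompose g) = g" if g: "g \<in> Arr J" for g
    using decompose_Arr[OF g] total_decompose[OF g] g
    by (simp add: hom_iff grothendieck_simps(3,4)) (simp add: decompose_def A.Dom_closed A.Cod_closed)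
qed (simp_all add: decompose_total, simp_all add: decompose_def)

text \<open>An arrow is sent by \<open>mu\<close> to \<open>D\<close> of its vertical part after
  \<open>D\<close> of its lift, so \<open>mu\<close> of the fibres is equal to \<open>D\<close>
  after \<open>total\<close>. The isomorphism is then \<open>total\<close> with identity
  components.\<close>

lemma mu_fibres_iso: "diag_iso C (mu C (K, fibres D)) (J, D)"
proof -
  have "snd (mu C (K, fibres D)) = func_comp fib.G D total"
    unfolding fib.mu_eq snd_conv func_comp_def compose_def
  proof (rule arg_cong2[of _ _ _ _ "\<lambda>f g. \<lparr>fobj = f, farr = g\<rparr>"]; rule restrict_ext)
    fix x assume "x \<in> Obj fib.G"
    then show "fobj (E1_obj (fibres D) (fst x)) (snd x) = fobj D (fobj total x)"
      using fobj_closed[of "snd x"] by (simp add: total_def) (simp add: G_Obj)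
  next
    fix a assume a: "a \<in> Arr fib.G"
    note p = G_ArrD[OF a]
    have "fst (snd (snd a)) \<in> Obj K" using p(3,4) fobj_closed by simp
    then show "farr (E1_obj (fibres D) (fst (snd (snd a)))) (arr_fibre a) \<odot>\<^bsub>C\<^esub>
        E1_arr (fibres D) (arr_base a) (snd (fst a)) = farr D (farr total a)"
      using a p by (simp add: total_def D.farr_Comp')
  qed
  then have mu: "mu C (K, fibres D) = (fib.G, func_comp fib.G D total)"
    by (simp add: prod_eq_iff fib.mu_simps(1))
  have M: "Functor fib.G C (func_comp fib.G D total)"
    by (rule Functor_func_comp[OF Functor_total D.Functor_axioms])
  interpret total: Functor fib.G J total by (rule Functor_total)
  have D_obj: "fobj D (fobj total x) \<in> Obj C" if "x \<in> Obj fib.G" for x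
    using that by (simp add: total.fobj_closed D.fobj_closed)
  let ?\<rho> = "\<lambda>x\<in>Obj fib.G. Id C (fobj D (fobj total x))"
  show ?thesis unfolding mu
  proof (rule diag_isoI)
    show "(total, ?\<rho>) \<in> diag_hom C (fib.G, func_comp fib.G D total) (J, D)"
      by (rule diag_homI[OF Functor_total M D.Functor_axioms])
        (simp_all add: hom_iff D_obj fib.G.Dom_closed fib.G.Cod_closed)
    show "Functor J C D" "Functor J fib.G decompose" by (rule D.Functor_axioms Functor_decompose)+
    show "fobj decompose (fobj total x) = x" if "x \<in> Obj fib.G" for x
      using that by (simp add: total_def) (simp add: decompose_def G_Obj prod_eq_iff)
    show "fobj total (fobj decompose X) = X" if "X \<in> Obj J" for X
      using that by (simp add: decompose_def total_def G_Obj)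
    show "?\<rho> x \<in> hom C (fobj D (fobj total x)) (fobj (func_comp fib.G D total) x) \<and>
      ?\<rho> x \<odot>\<^bsub>C\<^esub> ?\<rho> x = Id C (fobj (func_comp fib.G D total) x) \<and>
      ?\<rho> x \<odot>\<^bsub>C\<^esub> ?\<rho> x = Id C (fobj D (fobj total x))" if "x \<in> Obj fib.G" for x
      using that D_obj[OF that] by (simp add: hom_iff)
  qed (simp_all add: decompose_total total_decompose)
qed

text \<open>Over each \<open>k\<close> the chosen colimit and \<open>fobj L k\<close> are colimits
  of the same fibre diagram, so the comparison maps are invertible and the index functor can be the
  identity. Naturality at \<open>l\<close> is tested on coprojections at \<open>X\<close>, where
  both sides reduce to \<open>\<eta>\<close> at the codomain of \<open>\<chi> X l\<close> after
  \<open>D\<close> of this lift.\<close>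

lemma colim_push_fibres_iso:
  fixes c :: "('u, 'o, 'm) choice"
  assumes choice: "colimit_choice C c"
    and hom: "(F, \<eta>) \<in> diag_hom C (J, D) (K, L)" and L: "Functor K C L"
    and colim: "fibrewise_colimit J K C F D L \<eta>"
  shows "diag_iso C (colim_push C c (K, fibres D)) (K, L)"
proof -
  note d = diag_homD[OF hom]
  interpret L: Functor K C L by (rule L)
  let ?N = "func_comp K (colim_functor C c) (fibres D)"
  let ?fd = "fibre_diagram J K F D"
  have N: "Functor K C ?N" by (rule fib.Functor_colim_push[OF choice])
  interpret N: Functor K C ?N by (rule N)
  have N_obj: "fobj ?N k = fst (c (?fd k))" if "k \<in> Obj K" for k
    using fib.colim_push_fobj[OF choice that] that by simp
  have cN: "is_colimit C (fibre J K F k, snd (?fd k)) (fobj ?N k) (snd (c (?fd k)))" if k: "k \<in> Obj K" for k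
    unfolding N_obj[OF k] using small_diagram_colimit[OF choice fib.E_small[OF k]] k
    by simp
  have cL: "is_colimit C (fibre J K F k, snd (?fd k)) (fobj L k) \<eta>" if k: "k \<in> Obj K" for k
    using colim k unfolding fibrewise_colimit_def by (subst (asm) fibre_diagram_eq) simp
  have ex1: "\<exists>!u. u \<in> hom C (fobj ?N k) (fobj L k) \<and>
      (\<forall>X\<in>Obj (fibre J K F k). u \<odot>\<^bsub>C\<^esub> snd (c (?fd k)) X = \<eta> X)" if k: "k \<in> Obj K" for k
    by (rule colimit_factor[OF cN[OF k] colimit_cocone[OF cL[OF k]]])
  have "\<forall>k\<in>Obj K. \<exists>u. u \<in> hom C (fobj ?N k) (fobj L k) \<and>
      (\<forall>X\<in>Obj (fibre J K F k). u \<odot>\<^bsub>C\<^esub> snd (c (?fd k)) X = \<eta> X)"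
    by (rule ballI) (rule ex1_implies_ex[OF ex1])
  from bchoice[OF this] obtain \<rho>0 where \<rho>0: "\<forall>k\<in>Obj K. \<rho>0 k \<in> hom C (fobj ?N k) (fobj L k) \<and>
      (\<forall>X\<in>Obj (fibre J K F k). \<rho>0 k \<odot>\<^bsub>C\<^esub> snd (c (?fd k)) X = \<eta> X)"
    by (rule exE)
  define \<rho> where "\<rho> = restrict \<rho>0 (Obj K)"
  have \<rho>: "\<rho> k \<in> hom C (fobj ?N k) (fobj L k) \<and>
      (\<forall>X\<in>Obj (fibre J K F k). \<rho> k \<odot>\<^bsub>C\<^esub> snd (c (?fd k)) X = \<eta> X)" if k: "k \<in> Obj K" for k
    unfolding \<rho>_def restrict_apply'[OF k] by (rule bspec[OF \<rho>0 k])
  have \<rho>_hom: "\<rho> k \<in> hom C (fobj ?N k) (fobj L k)" if "k \<in> Obj K" for k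
    using \<rho>[OF that] by (rule conjunct1)
  have \<rho>_eq: "\<rho> k \<odot>\<^bsub>C\<^esub> snd (c (?fd k)) X = \<eta> X" if "k \<in> Obj K" "X \<in> Obj J" "fobj F X = k" for k X
    using bspec[OF conjunct2[OF \<rho>[OF that(1)]], of X] that(2,3) by simp
  have inv: "\<exists>v \<in> hom C (fobj L k) (fobj ?N k). v \<odot>\<^bsub>C\<^esub> \<rho> k = Id C (fobj ?N k) \<and> \<rho> k \<odot>\<^bsub>C\<^esub> v = Id C (fobj L k)"
    if k: "k \<in> Obj K" for k
    by (rule colimit_unique[OF cN[OF k] cL[OF k] \<rho>_hom[OF k] bspec[OF conjunct2[OF \<rho>[OF k]]]])
  then obtain \<sigma> where \<sigma>: "\<And>k. k \<in> Obj K \<Longrightarrow> \<sigma> k \<in> hom C (fobj L k) (fobj ?N k) \<and>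
      \<sigma> k \<odot>\<^bsub>C\<^esub> \<rho> k = Id C (fobj ?N k) \<and> \<rho> k \<odot>\<^bsub>C\<^esub> \<sigma> k = Id C (fobj L k)"
    unfolding Bex_def by metis
  have id: "Functor K K (func_id K)" by (rule Functor_func_id[OF B.category_axioms])
  have "diag_iso C (K, ?N) (K, L)"
  proof (rule diag_isoI[OF diag_homI[OF id N L] L id])
    show "\<rho> \<in> extensional (Obj K)" by (simp add: \<rho>_def)
    show "\<rho> k \<in> hom C (fobj ?N k) (fobj L (fobj (func_id K) k))" if "k \<in> Obj K" for k
      using \<rho>_hom[OF that] that by (simp del: fobj_func_comp)
    fix l assume l: "l \<in> Arr K"
    note k = B.Dom_closed[OF l] B.Cod_closed[OF l]
    note Nl = N.farr_hom[OF B.arr_hom[OF l]] and Ll = L.farr_hom[OF B.arr_hom[OF l]]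
    have "\<rho> (Cod K l) \<odot>\<^bsub>C\<^esub> farr ?N l = farr L l \<odot>\<^bsub>C\<^esub> \<rho> (Dom K l)"
    proof (rule colimit_cancel[OF cN[OF k(1)] D.B.Comp_hom[OF Nl \<rho>_hom[OF k(2)]]
        D.B.Comp_hom[OF \<rho>_hom[OF k(1)] Ll]])
      fix X assume "X \<in> Obj (fibre J K F (Dom K l))"
      then have X: "X \<in> Obj J" "fobj F X = Dom K l" by simp_all
      then have f: "\<chi> X l \<in> Arr J" "Dom J (\<chi> X l) = X" "Cod J (\<chi> X l) \<in> Obj J"
        "fobj F (Cod J (\<chi> X l)) = Cod K l" "farr F (\<chi> X l) = l" using l by simp_all
      have \<iota>: "snd (c (?fd (fobj F Y))) Y \<in> hom C (fobj D Y) (fobj ?N (fobj F Y))" if "Y \<in> Obj J" for Y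
        using colimit_cocone[OF cN[OF fobj_closed[OF that]]] that
        by (simp add: is_cocone_iff del: fobj_func_comp)
      note \<iota>X = \<iota>[OF X(1), unfolded X(2)] and \<iota>Y = \<iota>[OF f(3), unfolded f(4)]
      have D\<chi>: "farr D (\<chi> X l) \<in> hom C (fobj D X) (fobj D (Cod J (\<chi> X l)))"
        using f by (simp add: hom_iff)
      have "farr ?N l \<odot>\<^bsub>C\<^esub> snd (c (?fd (Dom K l))) X =
          snd (c (?fd (Cod K l))) (Cod J (\<chi> X l)) \<odot>\<^bsub>C\<^esub> farr D (\<chi> X l)"
        using fib.colim_push_farr[OF choice B.arr_hom[OF l], of X] X k l
        by (simp del: farr_func_comp)
      then have "(\<rho> (Cod K l) \<odot>\<^bsub>C\<^esub> farr ?N l) \<odot>\<^bsub>C\<^esub> snd (c (?fd (Dom K l))) X =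
          \<rho> (Cod K l) \<odot>\<^bsub>C\<^esub> snd (c (?fd (Cod K l))) (Cod J (\<chi> X l)) \<odot>\<^bsub>C\<^esub> farr D (\<chi> X l)"
        unfolding D.B.assoc[OF \<iota>X Nl \<rho>_hom[OF k(2)]] by (rule arg_cong)
      also have "\<dots> = \<eta> (Cod J (\<chi> X l)) \<odot>\<^bsub>C\<^esub> farr D (\<chi> X l)"
        unfolding D.B.assoc[OF D\<chi> \<iota>Y \<rho>_hom[OF k(2)], symmetric] \<rho>_eq[OF k(2) f(3,4)] ..
      also have "\<dots> = farr L l \<odot>\<^bsub>C\<^esub> \<eta> X"
        using d(5)[OF f(1)] f by simp
      also have "\<dots> = (farr L l \<odot>\<^bsub>C\<^esub> \<rho> (Dom K l)) \<odot>\<^bsub>C\<^esub> snd (c (?fd (Dom K l))) X"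
        unfolding D.B.assoc[OF \<iota>X \<rho>_hom[OF k(1)] Ll] \<rho>_eq[OF k(1) X] ..
      finally show "(\<rho> (Cod K l) \<odot>\<^bsub>C\<^esub> farr ?N l) \<odot>\<^bsub>C\<^esub> snd (c (?fd (Dom K l))) X =
        (farr L l \<odot>\<^bsub>C\<^esub> \<rho> (Dom K l)) \<odot>\<^bsub>C\<^esub> snd (c (?fd (Dom K l))) X" .
    qed
    then show "\<rho> (Cod K l) \<odot>\<^bsub>C\<^esub> farr ?N l = farr L (farr (func_id K) l) \<odot>\<^bsub>C\<^esub> \<rho> (Dom K l)"
      using l by (simp del: farr_func_comp)
  next
    show "\<sigma> k \<in> hom C (fobj L (fobj (func_id K) k)) (fobj ?N k) \<and>
      \<sigma> k \<odot>\<^bsub>C\<^esub> \<rho> k = Id C (fobj ?N k) \<and> \<rho> k \<odot>\<^bsub>C\<^esub> \<sigma> k = Id C (fobj L (fobj (func_id K) k))"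
      if "k \<in> Obj K" for k
      using \<sigma>[OF that] that by (simp del: fobj_func_comp)
  qed simp_all
  then show ?thesis by (simp add: colim_push_def)
qed

end

text \<open>The partial evaluation is the diagram of fibres, indexed by \<open>K\<close>; it belongs
  to Diag(Diag(C)) because \<open>K\<close> is small as the domain of \<open>D'\<close>.\<close>

lemma left_kan_imp_partial_colimit:
  fixes J K :: "('u, 'u) cat"
  assumes choice: "colimit_choice C c"
    and J: "(J, D) \<in> small_diagrams C" and K: "(K, D') \<in> small_diagrams C"
    and F: "split_opfibration J K F" and kan: "is_pointwise_left_kan J K C F D D' \<eta>"
  shows "partial_colimit C c (J, D) (K, D')"
proof -
  from F obtain \<chi> where "split_opfib J K F \<chi>"
    by (auto simp: split_opfibration_def split_opfib_def split_opfib_axioms_def)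
  then interpret F: split_opfib J K F \<chi> .
  interpret F: split_opfib_diagram J K F \<chi> C D
    using small_diagramsD[OF J]
    by (intro split_opfib_diagram.intro split_opfib_diagram_axioms.intro F.split_opfib_axioms)
  have hom: "(F, \<eta>) \<in> diag_hom C (J, D) (K, D')"
    using kan F.Functor_axioms by (auto simp: is_pointwise_left_kan_def is_left_kan_def diag_hom_iff)
  have "diag_iso C (colim_push C c (K, F.fibres D)) (K, D')"
    by (rule F.colim_push_fibres_iso[OF choice hom small_diagramsD(2)[OF K]
      F.pointwise_imp_fibrewise_colimit[OF kan]])
  moreover have "(K, F.fibres D) \<in> small_diagrams (Diag C)"
    using small_diagramsD(1)[OF K] F.fib.E.Functor_axioms by (simp add: small_diagrams_def)
  ultimately have "partial_evaluation C c (K, F.fibres D) (J, D) (K, D')"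
    using F.mu_fibres_iso by (simp add: partial_evaluation_def)
  then show ?thesis by (auto simp: partial_colimit_def)
qed

theorem theorem5p5:
  fixes C :: "('o, 'm) cat"
    and c :: "('u, 'o, 'm) choice"
    and J K :: "('u, 'u) cat"
    and D D' :: "('u, 'u, 'o, 'm) func"
  assumes "universe TYPE('u)"
    and "category C"
    and "locally_small TYPE('u) C"
    and "cocomplete TYPE('u) C"
    and "colimit_choice C c"
    and "(J, D) \<in> Obj (Diag C)"
    and "(K, D') \<in> Obj (Diag C)"
  shows "partial_colimit C c (J, D) (K, D') \<longleftrightarrow>
    (\<exists>F \<eta>. split_opfibration J K F \<and> is_pointwise_left_kan J K C F D D' \<eta>)"
proof
  show "\<exists>F \<eta>. split_opfibration J K F \<and> is_pointwise_left_kan J K C F D D' \<eta>"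
    if "partial_colimit C c (J, D) (K, D')"
    by (rule partial_colimit_imp_left_kan[OF assms(2,5) that])
  show "partial_colimit C c (J, D) (K, D')"
    if "\<exists>F \<eta>. split_opfibration J K F \<and> is_pointwise_left_kan J K C F D D' \<eta>"
    using that left_kan_imp_partial_colimit[OF assms(5)] assms(6,7) unfolding Diag_simps(1) by blast
qed

end
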